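(* Consider a stable single-server queue $GI/GI/1$ with feedback ($\rho=\lambda b/q<1$), whose first customer arrives at an empty system. Assume that the service time distribution $G$ is intermediate regularly varying. Let $U$ be the sojourn time of the first customer, and let $$P_{k,\ell,i,j}(x)=\mathbb{P}\big(U>x,\ K=k+\ell,\ X_{k-1}=j,\ \sigma_{k,i}>x(1-\rho)\big).$$ Suppose there exists a collection of nonnegative functions $\{g_{k,\ell,i,j}(x)\}$ such that, as $x\to\infty$, $$P_{k,\ell,i,j}(x)=(1+o(1))\,g_{k,\ell,i,j}(x),\qquad\forall\,k\ge1,\ \ell\ge0,\ 0\le i\le j,$$ and constants $C_{k,\ell,i,j}$ such that, for any $k\ge1$, $\ell\ge0$, $j\ge0$, $0\le i\le j$, $x\ge0$, $$g_{k,\ell,i,j}(x)\le C_{k,\ell,i,j}\,\mathbb{P}(\sigma>x),\qquad C:=\sum_{k=1}^\infty\sum_{\ell=0}^\infty\sum_{j=0}^\infty\sum_{i=0}^jC_{k,\ell,i,j}<\infty.$$ Then $$\mathbb{P}(U>x)\ \sim\ \sum_{k=1}^\infty\sum_{\ell=0}^\infty\sum_{j=0}^\infty\sum_{i=0}^j g_{k,\ell,i,j}(x)\qquad\text{as }x\to\infty.$$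
   Context: $GI/GI/1$ feedback queue: exogenous customers arrive to a single server as a renewal process with i.i.d. inter-arrival times of finite mean $a>0$; $\lambda=1/a$; $N^e(t)$ is the number of exogenous arrivals in $(0,t]$, counted after the arrival of the first customer at time $0$. Customers are served in the order of their (external and internal) arrivals to the queue. All service times are i.i.d. with distribution $G$ on the nonnegative half-line with finite mean $b>0$, independent of the arrival process; $\sigma$ denotes a random variable with distribution $G$. A customer completing a service returns to the end of the queue for another service with probability $p\in(0,1)$ or leaves the system with probability $q=1-p$, independently of everything else. Stability means $\rho=\lambda b/q<1$. First (tagged) customer: it arrives at time $0$ and finds the system empty. Its number of services $K$ has $\mathbb{P}(K=k)=qp^{k-1}$, $k\ge1$, and is independent of everything else. Put $X_0=0$, $T_0=0$ and, for $k\ge1$, $$U_k=\sum_{i=0}^{X_{k-1}}\sigma_{k,i},\qquad T_k=T_{k-1}+U_k,\qquad X_k=N^e(T_k)-N^e(T_{k-1})+N^B_k(X_{k-1}),$$ where the $\sigma_{k,i}$ are i.i.d. with distribution $G$, $N^B_k(n)$ is Binomial with parameters $n,p$, and the families $\{\sigma_{k,i}\}$, $\{N_k^B(\cdot)\}$, $N^e$, $K$ are independent, with the $N_k^B$ independent over $k$. ($X_k$ is the queue length behind the first customer when it finishes its $k$th service; $\sigma_{k,0}$ is its $k$th service time and $\sigma_{k,i}$, $1\le i\le X_{k-1}$, are the service times of the customers ahead of it at its $k$th turn.) The sojourn time is $U=\sum_{k=1}^K U_k$. A distribution $F$ with tail $\overline F=1-F$, $\overline F(x)>0$ for all $x$,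 is intermediate regularly varying if $\lim_{\alpha\downarrow1}\liminf_{x\to\infty}\overline F(\alpha x)/\overline F(x)=1$. $f(x)\sim g(x)$ means $f(x)/g(x)\to1$ as $x\to\infty$. *)

theory Defs
  imports "HOL-Probability.Probability" "HOL-Library.Landau_Symbols"
begin

definition tail :: "real measure \<Rightarrow> real \<Rightarrow> real" where
  "tail F x = 1 - cdf F x"

definition intermediate_regularly_varying :: "real measure \<Rightarrow> bool" where
  "intermediate_regularly_varying F \<longleftrightarrow>
     (\<forall>x. tail F x > 0) \<and>
     ((\<lambda>\<alpha>. Liminf at_top (\<lambda>x. ereal (tail F (\<alpha> * x) / tail F x))) \<longlongrightarrow> 1) (at_right 1)"

text \<open>
  Inter-arrival times are \<open>\<tau> n\<close> for \<open>n \<ge> 1\<close>; the \<open>n\<close>-th exogenous customer after the tagged one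
  arrives at \<open>arrival_time \<tau> n\<close>. Inter-arrival times may vanish with positive probability (batches).
  The set counted by \<open>num_arrivals\<close> is almost surely finite when the \<open>\<tau> n\<close> are i.i.d., nonnegative and
  of positive mean, so that \<open>card\<close> is the true count and the subtraction on \<open>nat\<close> in
  \<open>queue_length\<close> below is not truncated, outside a null event.
\<close>

definition arrival_time :: "(nat \<Rightarrow> 'w \<Rightarrow> real) \<Rightarrow> nat \<Rightarrow> 'w \<Rightarrow> real" where
  "arrival_time \<tau> n \<omega> = (\<Sum>m=1..n. \<tau> m \<omega>)"

definition num_arrivals :: "(nat \<Rightarrow> 'w \<Rightarrow> real) \<Rightarrow> real \<Rightarrow> 'w \<Rightarrow> nat" where
  "num_arrivals \<tau> t \<omega> = card {n. 1 \<le> n \<and> arrival_time \<tau> n \<omega> \<in> {0<..t}}"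

text \<open>
  \<open>completion_time \<tau> \<sigma> B k\<close> and \<open>queue_length \<tau> \<sigma> B k\<close> are $T_k$ and $X_k$; \<open>B k n\<close> is the number
  $N^B_k(n)$ of those among \<open>n\<close> customers who return to the queue.
\<close>

fun completion_time ::
    "(nat \<Rightarrow> 'w \<Rightarrow> real) \<Rightarrow> (nat \<Rightarrow> nat \<Rightarrow> 'w \<Rightarrow> real) \<Rightarrow> (nat \<Rightarrow> nat \<Rightarrow> 'w \<Rightarrow> nat) \<Rightarrow> nat \<Rightarrow> 'w \<Rightarrow> real"
  and queue_length ::
    "(nat \<Rightarrow> 'w \<Rightarrow> real) \<Rightarrow> (nat \<Rightarrow> nat \<Rightarrow> 'w \<Rightarrow> real) \<Rightarrow> (nat \<Rightarrow> nat \<Rightarrow> 'w \<Rightarrow> nat) \<Rightarrow> nat \<Rightarrow> 'w \<Rightarrow> nat"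
where
  "completion_time \<tau> \<sigma> B 0 \<omega> = 0"
| "completion_time \<tau> \<sigma> B (Suc k) \<omega> =
     completion_time \<tau> \<sigma> B k \<omega> + (\<Sum>i=0..queue_length \<tau> \<sigma> B k \<omega>. \<sigma> (Suc k) i \<omega>)"
| "queue_length \<tau> \<sigma> B 0 \<omega> = 0"
| "queue_length \<tau> \<sigma> B (Suc k) \<omega> =
     (num_arrivals \<tau> (completion_time \<tau> \<sigma> B (Suc k) \<omega>) \<omega>
       - num_arrivals \<tau> (completion_time \<tau> \<sigma> B k \<omega>) \<omega>)
     + B (Suc k) (queue_length \<tau> \<sigma> B k \<omega>) \<omega>"

text \<open>$U_k$ for $k \ge 1$:\<close>

definition cycle_time ::
    "(nat \<Rightarrow> 'w \<Rightarrow> real) \<Rightarrow> (nat \<Rightarrow> nat \<Rightarrow> 'w \<Rightarrow> real) \<Rightarrow> (nat \<Rightarrow> nat \<Rightarrow> 'w \<Rightarrow> nat) \<Rightarrow> nat \<Rightarrow> 'w \<Rightarrow> real" where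
  "cycle_time \<tau> \<sigma> B k \<omega> = (\<Sum>i=0..queue_length \<tau> \<sigma> B (k - 1) \<omega>. \<sigma> k i \<omega>)"

definition sojourn_time ::
    "(nat \<Rightarrow> 'w \<Rightarrow> real) \<Rightarrow> (nat \<Rightarrow> nat \<Rightarrow> 'w \<Rightarrow> real) \<Rightarrow> (nat \<Rightarrow> nat \<Rightarrow> 'w \<Rightarrow> nat) \<Rightarrow> ('w \<Rightarrow> nat) \<Rightarrow> 'w \<Rightarrow> real" where
  "sojourn_time \<tau> \<sigma> B K \<omega> = (\<Sum>k=1..K \<omega>. cycle_time \<tau> \<sigma> B k \<omega>)"

text \<open>
  The primitive random elements take values in different types, so their joint independence is
  stated as independence of the \<open>\<sigma>\<close>-algebras they generate. For each \<open>k\<close> the whole process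
  \<open>n \<mapsto> B k n\<close> is a single random element; its joint law over \<open>n\<close> is left unspecified.
\<close>

datatype source = Interarrival nat | Service nat nat | Feedback nat | Visits

definition sources :: "source set" where
  "sources = {Interarrival n | n. n \<ge> 1} \<union> {Service k i | k i. k \<ge> 1} \<union>
             {Feedback k | k. k \<ge> 1} \<union> {Visits}"

fun source_events ::
    "'w measure \<Rightarrow> (nat \<Rightarrow> 'w \<Rightarrow> real) \<Rightarrow> (nat \<Rightarrow> nat \<Rightarrow> 'w \<Rightarrow> real) \<Rightarrow> (nat \<Rightarrow> nat \<Rightarrow> 'w \<Rightarrow> nat) \<Rightarrow>
     ('w \<Rightarrow> nat) \<Rightarrow> source \<Rightarrow> 'w set set" where
  "source_events M \<tau> \<sigma> B K (Interarrival n) = sets (vimage_algebra (space M) (\<tau> n) borel)"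
| "source_events M \<tau> \<sigma> B K (Service k i) = sets (vimage_algebra (space M) (\<sigma> k i) borel)"
| "source_events M \<tau> \<sigma> B K (Feedback k) =
     sets (vimage_algebra (space M) (\<lambda>\<omega> n. B k n \<omega>) (\<Pi>\<^sub>M n\<in>UNIV. count_space UNIV))"
| "source_events M \<tau> \<sigma> B K Visits = sets (vimage_algebra (space M) K (count_space UNIV))"

text \<open>\<open>A\<close> and \<open>G\<close> are the inter-arrival and service time distributions.\<close>

locale feedback_queue =
  prob_space M + interarrival: real_distribution A + service: real_distribution G
  for M :: "'w measure" and A G :: "real measure" +
  fixes p :: real
    and \<tau> :: "nat \<Rightarrow> 'w \<Rightarrow> real"
    and \<sigma> :: "nat \<Rightarrow> nat \<Rightarrow> 'w \<Rightarrow> real"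
    and B :: "nat \<Rightarrow> nat \<Rightarrow> 'w \<Rightarrow> nat"
    and K :: "'w \<Rightarrow> nat"
  assumes p: "0 < p" "p < 1"
    and interarrival_nonneg: "AE t in A. 0 \<le> t"
    and interarrival_mean: "integrable A (\<lambda>t. t)" "0 < (\<integral>t. t \<partial>A)"
    and service_nonneg: "AE s in G. 0 \<le> s"
    and service_mean: "integrable G (\<lambda>s. s)" "0 < (\<integral>s. s \<partial>G)"
    and interarrival_measurable: "\<And>n. n \<ge> 1 \<Longrightarrow> random_variable borel (\<tau> n)"
    and interarrival_distr: "\<And>n. n \<ge> 1 \<Longrightarrow> distr M borel (\<tau> n) = A"
    and service_measurable: "\<And>k i. k \<ge> 1 \<Longrightarrow> random_variable borel (\<sigma> k i)"
    and service_distr: "\<And>k i. k \<ge> 1 \<Longrightarrow> distr M borel (\<sigma> k i) = G"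
    and feedback_measurable: "\<And>k n. k \<ge> 1 \<Longrightarrow> random_variable (count_space UNIV) (B k n)"
    and feedback_distr:
      "\<And>k n. k \<ge> 1 \<Longrightarrow> distr M (count_space UNIV) (B k n) = measure_pmf (binomial_pmf n p)"
    and visits_measurable: "random_variable (count_space UNIV) K"
    and visits_distr: "\<And>k. k \<ge> 1 \<Longrightarrow> \<P>(\<omega> in M. K \<omega> = k) = (1 - p) * p ^ (k - 1)"
    and indep_sources: "indep_sets (source_events M \<tau> \<sigma> B K) sources"

definition load :: "real measure \<Rightarrow> real measure \<Rightarrow> real \<Rightarrow> real" where
  "load A G p = (1 / (\<integral>t. t \<partial>A)) * (\<integral>s. s \<partial>G) / (1 - p)"

text \<open>
  Index quadruples \<open>(k, l, j, i)\<close> of the fourfold sums. The summands are nonnegative (for arguments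
  \<open>x \<ge> 0\<close>), so the iterated sum is the unordered sum over this set. Some of the joint probabilities
  to be approximated vanish identically (e.g. for \<open>k = 1\<close>, \<open>j > 0\<close>); the convention \<open>0/0 = 1\<close> built into
  \<open>asymp_equiv\<close> makes \<open>f \<sim>[at_top] g\<close> mean exactly $f(x) = (1+o(1)) g(x)$ in that case as well.
\<close>

definition jump_indices :: "(nat \<times> nat \<times> nat \<times> nat) set" where
  "jump_indices = {(k, l, j, i). 1 \<le> k \<and> i \<le> j}"

end

theory Submission
  imports Defs "HOL-Real_Asymp.Real_Asymp"
begin

text \<open>
  A sojourn time above \<open>x\<close> is caused by one big service time. Suppose a service of length \<open>y\<close> takes place
  while the tagged customer is in the system. About \<open>y\<close> divided by the mean inter-arrival time customers
  join meanwhile, and they, the customers who arrive during their services, and all returns, are served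
  between the further turns of the tagged customer. Summing over all further turns, the total delay is at
  most about \<open>y / (1 - \<rho>)\<close>. So a delay of \<open>x\<close> requires a service longer than \<open>x * (1 - \<rho>)\<close>, and two such
  services are much less likely than one. All errors are measured against \<open>tail G x\<close>, which is a lower
  bound for the tail of the sojourn time because the first service already belongs to it.

  Three facts make this precise.

  Without a big service the event is negligible (\<open>no_big_jump_negligible\<close>): for every
  \<open>\<delta> < 1 - \<rho>\<close>, the probability of a sojourn time above \<open>x\<close> without a service above \<open>\<delta> * x\<close> is of smaller
  order than \<open>tail G x\<close>. The proof is an exponential Lyapunov function. Weighting time by \<open>v\<close> and every
  customer in the queue by \<open>\<theta>\<close>, the process of (elapsed time, queue length) has exponential drift at
  most a factor \<open>1 + O(v)\<close> per turn, provided the services truncated at \<open>y = \<delta> * x\<close> have an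
  exponential moment of order \<open>v\<close> that is governed by the mean. This is so for the \<open>v\<close> with
  \<open>exp (v * y) * tail G y = 1 / y\<close> (\<open>tail_exponent\<close>). As the number of turns is geometric, the
  exponential moment of the sojourn time exceeds 1 by only \<open>O(v)\<close>, and Markov's inequality applied to
  that excess gains just enough. Subtracting 1 is essential: with a finite mean only, the services
  need not have a moment of any order above 1, and the plain exponential bound is too weak.

  Renewal arrivals enter only through a pathwise bound: for every rate \<open>lam\<close> above the arrival rate,
  the number of arrivals up to time \<open>t\<close> is at most \<open>lam * t + m\<close> for all \<open>t\<close> at once, where the random
  variable \<open>m\<close> has exponential moments (\<open>arrival_envelope_exists\<close>). This avoids any conditioning on the
  past of the arrival process at the times of service completion.

  Several big services are negligible (\<open>position_count_first_jump\<close>, \<open>earlier_jump_count_tendsto_0\<close>): all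
  big services except the first one, in the lexicographic order of the indices \<open>(k, i)\<close>, have an
  earlier big service. A service time is independent of everything that precedes it, so the expected number of those is \<open>tail G\<close> times
  the expected number of services that have an earlier big service, which vanishes because the
  expected number of services in a sojourn is finite (\<open>position_count_integrable\<close>).

  Hence the tail of the sojourn time agrees, up to \<open>o(tail G)\<close>, with the expected number of big
  services in a sojourn exceeding \<open>x\<close> (\<open>single_big_jump\<close>), and by Fubini this number is the sum of the
  joint probabilities in the theorem. Intermediate regular variation removes the gap between the
  thresholds \<open>\<delta> * x\<close> and \<open>x * (1 - \<rho>)\<close>. Finally dominated convergence over the indices replaces
  each joint probability by its asymptotic equivalent.
\<close>

section \<open>Intermediate regularly varying tails\<close>

text \<open>
  Doubling estimates for a tail compare \<open>z\<close> with \<open>z / 2\<close>; they spread from one dyadic window to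
  all larger arguments.
\<close>

lemma halving_induct [consumes 2, case_names base step]:
  fixes z z0 :: real
  assumes "0 < z0" "z0 \<le> z"
    and base: "\<And>z. z0 \<le> z \<Longrightarrow> z < 2 * z0 \<Longrightarrow> P z"
    and step: "\<And>z. 2 * z0 \<le> z \<Longrightarrow> P (z / 2) \<Longrightarrow> P z"
  shows "P z"
proof -
  obtain n where n: "z / z0 < 2 ^ n"
    using real_arch_pow[of 2 "z / z0"] by auto
  have "z0 \<le> z \<Longrightarrow> z < 2 ^ n * z0 \<Longrightarrow> P z" for n z
  proof (induction n arbitrary: z)
    case (Suc n)
    show ?case
    proof (cases "z < 2 * z0")
      case False
      then have "P (z / 2)"
        using Suc by (intro Suc.IH) auto
      then show ?thesis
        using False step by auto
    qed (use Suc base in auto)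
  qed auto
  moreover have "z < 2 ^ n * z0"
    using n \<open>0 < z0\<close> by (simp add: field_simps)
  ultimately show ?thesis
    using assms by blast
qed

context real_distribution
begin

lemma tail_eq_measure: "tail M x = measure M {x<..}"
proof -
  have "UNIV - {..x} = {x<..}" by auto
  moreover have "measure M (UNIV - {..x}) = 1 - measure M {..x}"
    using prob_compl[of "{..x}"] by simp
  ultimately show ?thesis
    unfolding tail_def cdf_def by simp
qed

lemma tail_nonneg: "0 \<le> tail M x"
  by (simp add: tail_eq_measure)

lemma tail_antimono: "x \<le> y \<Longrightarrow> tail M y \<le> tail M x"
  unfolding tail_eq_measure by (intro finite_measure_mono) auto

text \<open>
  The hypothesis on the liminf provides a factor above 1 by which the argument may be enlarged at
  small cost; its reciprocal is \<open>\<beta>\<close>.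
\<close>

lemma irv_tail_shrink:
  assumes irv: "intermediate_regularly_varying M" and "\<eta> > 0"
  obtains \<beta> where "0 < \<beta>" "\<beta> < 1" "eventually (\<lambda>x. tail M (\<beta> * x) \<le> (1 + \<eta>) * tail M x) at_top"
proof -
  have "eventually (\<lambda>\<alpha>. ereal (1 / (1 + \<eta>)) < Liminf at_top (\<lambda>x. ereal (tail M (\<alpha> * x) / tail M x))) (at_right 1)"
    using irv \<open>\<eta> > 0\<close> unfolding intermediate_regularly_varying_def
    by (intro order_tendstoD(1)) auto
  moreover have "eventually (\<lambda>\<alpha>::real. 1 < \<alpha>) (at_right 1)"
    by (rule eventually_at_right_less)
  ultimately have "eventually (\<lambda>\<alpha>. ereal (1 / (1 + \<eta>)) < Liminf at_top (\<lambda>x. ereal (tail M (\<alpha> * x) / tail M x)) \<and> 1 < \<alpha>) (at_right 1)"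
    by eventually_elim auto
  then obtain \<alpha> where \<alpha>: "1 < \<alpha>"
    "ereal (1 / (1 + \<eta>)) < Liminf at_top (\<lambda>x. ereal (tail M (\<alpha> * x) / tail M x))"
    by (metis (mono_tags, lifting) eventually_happens trivial_limit_at_right_real)
  have pos: "tail M x > 0" for x
    using irv by (auto simp: intermediate_regularly_varying_def)
  have "eventually (\<lambda>x. tail M x \<le> (1 + \<eta>) * tail M (\<alpha> * x)) at_top"
    using less_LiminfD[OF \<alpha>(2)]
  proof eventually_elim
    case (elim x)
    then show ?case using pos[of x] \<open>\<eta> > 0\<close> by (simp add: field_simps)
  qed
  moreover have "filterlim (\<lambda>x. 1 / \<alpha> * x) at_top at_top"
    using \<alpha> by real_asymp
  ultimately have "eventually (\<lambda>x. tail M (1 / \<alpha> * x) \<le> (1 + \<eta>) * tail M (\<alpha> * (1 / \<alpha> * x))) at_top"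
    by (rule eventually_compose_filterlim)
  then show ?thesis
    using \<alpha> by (intro that[of "1 / \<alpha>"]) auto
qed

text \<open>
  Finitely many steps of \<open>irv_tail_shrink\<close> reach every factor \<open>c\<close>.
\<close>

lemma irv_tail_dominated:
  assumes irv: "intermediate_regularly_varying M" and "c > 0"
  obtains D where "D > 0" "eventually (\<lambda>x. tail M (c * x) \<le> D * tail M x) at_top"
proof -
  obtain \<beta> where \<beta>: "0 < \<beta>" "\<beta> < 1"
    and ev: "eventually (\<lambda>x. tail M (\<beta> * x) \<le> (1 + 1) * tail M x) at_top"
    using irv_tail_shrink[OF irv, of 1] by auto
  obtain n where n: "\<beta> ^ n < c"
    using real_arch_pow_inv[of c \<beta>] \<beta> \<open>c > 0\<close> by auto
  have "eventually (\<lambda>x. tail M (\<beta> ^ n * x) \<le> 2 ^ n * tail M x) at_top" for n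
  proof (induction n)
    case (Suc n)
    have "filterlim (\<lambda>x. \<beta> * x) at_top at_top"
      using \<beta> by real_asymp
    from eventually_compose_filterlim[OF Suc this] ev show ?case
    proof eventually_elim
      case (elim x)
      have "tail M (\<beta> ^ Suc n * x) = tail M (\<beta> ^ n * (\<beta> * x))"
        by (simp add: mult_ac)
      also have "\<dots> \<le> 2 ^ n * tail M (\<beta> * x)"
        using elim by simp
      also have "\<dots> \<le> 2 ^ n * ((1 + 1) * tail M x)"
        using elim by (intro mult_left_mono) auto
      finally show ?case by simp
    qed
  qed auto
  from this[of n] eventually_ge_at_top[of 0]
  have "eventually (\<lambda>x. tail M (c * x) \<le> 2 ^ n * tail M x) at_top"
  proof eventually_elim
    case (elim x)
    have "tail M (c * x) \<le> tail M (\<beta> ^ n * x)"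
      using n elim by (intro tail_antimono mult_right_mono) auto
    with elim show ?case by simp
  qed
  then show ?thesis
    by (rule that[rotated]) simp
qed

text \<open>
  The second limit is the first one combined with Markov's inequality on the event above \<open>y\<close>.
\<close>

lemma tail_mult_tendsto_0:
  assumes int: "integrable M (\<lambda>s. s)"
  shows "((\<lambda>y. \<integral>s. s * indicator {y<..} s \<partial>M) \<longlongrightarrow> 0) at_top"
    and "((\<lambda>y. y * tail M y) \<longlongrightarrow> 0) at_top"
proof -
  have "((\<lambda>y. \<integral>s. s * indicator {y<..} s \<partial>M) \<longlongrightarrow> (\<integral>s. 0 \<partial>M)) at_top"
  proof (rule integral_dominated_convergence_at_top)
    show "integrable M (\<lambda>s. \<bar>s\<bar>)" using int by simp
    show "AE s in M. ((\<lambda>y. s * indicator {y<..} s) \<longlongrightarrow> 0) at_top"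
    proof (rule AE_I2)
      fix s :: real
      have "eventually (\<lambda>y. s * indicator {y<..} s = 0) at_top"
        using eventually_ge_at_top[of s] by eventually_elim auto
      then show "((\<lambda>y. s * indicator {y<..} s) \<longlongrightarrow> 0) at_top"
        by (rule tendsto_eventually)
    qed
  qed (auto simp: indicator_def)
  then show 1: "((\<lambda>y. \<integral>s. s * indicator {y<..} s \<partial>M) \<longlongrightarrow> 0) at_top" by simp
  show "((\<lambda>y. y * tail M y) \<longlongrightarrow> 0) at_top"
  proof (rule tendsto_sandwich[OF _ _ tendsto_const 1])
    show "eventually (\<lambda>y. 0 \<le> y * tail M y) at_top"
      using eventually_ge_at_top[of 0] by eventually_elim (simp add: tail_nonneg)
    show "eventually (\<lambda>y. y * tail M y \<le> (\<integral>s. s * indicator {y<..} s \<partial>M)) at_top"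
      using eventually_ge_at_top[of 0]
    proof eventually_elim
      case (elim y)
      have "y * tail M y = (\<integral>s. y * indicator {y<..} s \<partial>M)"
        by (simp add: tail_eq_measure)
      also have "\<dots> \<le> (\<integral>s. s * indicator {y<..} s \<partial>M)"
      proof (rule integral_mono)
        show "integrable M (\<lambda>s. y * indicator {y<..} s)"
          by (intro integrable_mult_right integrable_real_indicator) (auto simp: emeasure_eq_measure)
        show "integrable M (\<lambda>s. s * indicator {y<..} s)"
          using int by (intro integrable_real_mult_indicator) auto
      qed (auto simp: indicator_def)
      finally show ?case .
    qed
  qed
qed

text \<open>
  The exponential tilt for which a single value at the truncation level \<open>y\<close> contributes
  \<open>1 / y\<close> to the exponential moment (\<open>tail_exponent_exp\<close>). This contribution is of smaller order than the
  tilt itself, so the truncated moment is still governed by the mean, and the gain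
  \<open>exp (- tail_exponent y * y)\<close> in Markov's inequality is \<open>y * tail M y\<close>.
\<close>

definition tail_exponent :: "real \<Rightarrow> real" where
  "tail_exponent y = - ln (y * tail M y) / y"

lemma irv_halving:
  assumes irv: "intermediate_regularly_varying M"
  obtains D z0 where "D \<ge> 1" "z0 > 0" "\<And>z. z \<ge> z0 \<Longrightarrow> tail M (z / 2) \<le> D * tail M z"
proof -
  obtain D where D: "D > 0" "eventually (\<lambda>x. tail M (1 / 2 * x) \<le> D * tail M x) at_top"
    using irv_tail_dominated[OF irv, of "1/2"] by auto
  then obtain z0 where z0: "\<And>z. z \<ge> z0 \<Longrightarrow> tail M (z / 2) \<le> D * tail M z"
    by (auto simp: eventually_at_top_linorder)
  show ?thesis
  proof (rule that[of "max 1 D" "max 1 z0"])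
    fix z assume z: "max 1 z0 \<le> z"
    then have "tail M (z / 2) \<le> D * tail M z" by (intro z0) auto
    also have "\<dots> \<le> max 1 D * tail M z"
      by (intro mult_right_mono) (auto simp: tail_nonneg)
    finally show "tail M (z / 2) \<le> max 1 D * tail M z" .
  qed auto
qed

text \<open>
  The first limit says that \<open>y * tail M y\<close> vanishes. The second one holds because the tail decays
  at most like a power, by repeated halving.
\<close>

lemma tail_exponent_asymptotics:
  assumes irv: "intermediate_regularly_varying M" and int: "integrable M (\<lambda>s. s)"
  shows "filterlim (\<lambda>y. y * tail_exponent y) at_top at_top"
    and "(tail_exponent \<longlongrightarrow> 0) at_top"
proof -
  have pos: "tail M x > 0" for x
    using irv by (auto simp: intermediate_regularly_varying_def)
  have "filterlim (\<lambda>y. y * tail M y) (at_right 0) at_top"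
    unfolding filterlim_at using tail_mult_tendsto_0(2)[OF int] pos
    by (auto intro!: eventually_mono[OF eventually_gt_at_top[of 0]] simp: less_imp_neq[symmetric])
  then have "filterlim (\<lambda>y. ln (y * tail M y)) at_bot at_top"
    by (rule filterlim_compose[OF ln_at_0])
  then have 1: "filterlim (\<lambda>y. - ln (y * tail M y)) at_top at_top"
    by (simp add: filterlim_uminus_at_top)
  show lim: "filterlim (\<lambda>y. y * tail_exponent y) at_top at_top"
    by (rule filterlim_mono_eventually[OF 1 order_refl order_refl])
       (use eventually_gt_at_top[of 0] in eventually_elim, auto simp: tail_exponent_def)
  obtain D z0 where D: "D \<ge> 1" "z0 > 0" "\<And>z. z \<ge> z0 \<Longrightarrow> tail M (z / 2) \<le> D * tail M z"
    using irv_halving[OF irv] by blast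
  obtain N where N: "D < 2 ^ N"
    using real_arch_pow[of 2 D] by auto
  define c where "c = tail M (2 * z0) * z0 ^ N"
  have c: "c > 0" using D pos by (simp add: c_def)
  have lower: "c \<le> tail M z * z ^ N" if "z0 \<le> z" for z
    using \<open>z0 > 0\<close> that
  proof (induction z rule: halving_induct)
    case (base z)
    then show ?case unfolding c_def using D
      by (intro mult_mono tail_antimono power_mono) (auto simp: tail_nonneg)
  next
    case (step z)
    have "tail M (z / 2) * (z / 2) ^ N \<le> (D * tail M z) * (z / 2) ^ N"
      using step D by (intro mult_right_mono D) auto
    also have "\<dots> \<le> (2 ^ N * tail M z) * (z / 2) ^ N"
      using step D N by (intro mult_right_mono) (auto simp: tail_nonneg)
    also have "\<dots> = tail M z * z ^ N"
      by (simp add: power_divide)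
    finally show ?case using step by simp
  qed
  have upper: "eventually (\<lambda>y. tail_exponent y \<le> (real N * ln y - ln c) / y) at_top"
    using eventually_ge_at_top[of "max z0 1"]
  proof eventually_elim
    case (elim y)
    then have "c / y ^ N \<le> tail M y" using lower[of y] by (simp add: field_simps)
    also have "\<dots> \<le> y * tail M y" using elim pos[of y] by simp
    finally have "ln (c / y ^ N) \<le> ln (y * tail M y)"
      using c elim pos by (subst ln_le_cancel_iff) auto
    then have "- ln (y * tail M y) \<le> real N * ln y - ln c"
      using c elim by (simp add: ln_div ln_realpow)
    then show ?case
      using elim unfolding tail_exponent_def by (intro divide_right_mono) auto
  qed
  have "((\<lambda>y. (real N * ln y - ln c) / y) \<longlongrightarrow> 0) at_top"
    by real_asymp
  moreover have "eventually (\<lambda>y. 0 \<le> tail_exponent y) at_top"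
    using eventually_gt_at_top[of 0] filterlim_at_top[THEN iffD1, OF lim, rule_format, of 0]
    by eventually_elim (auto simp: zero_le_mult_iff)
  ultimately show "(tail_exponent \<longlongrightarrow> 0) at_top"
    using upper by (intro tendsto_sandwich[OF _ _ tendsto_const, of 0 tail_exponent])
qed

lemma tail_exponent_exp:
  assumes "y > 0" "tail M y > 0"
  shows "exp (tail_exponent y * y) * tail M y = 1 / y"
  using assms by (simp add: tail_exponent_def exp_minus field_simps)

text \<open>
  Beyond \<open>2 * ln (2 * D) / u\<close> the weight \<open>exp (u * z)\<close> grows by a factor of at least \<open>2 * D\<close> from
  \<open>z / 2\<close> to \<open>z\<close>, while the tail drops by a factor of at most \<open>D\<close>. So the integral is dominated by its
  upper end.
\<close>

lemma exp_moment_between_le: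
  assumes D: "D \<ge> 1" "z0 > 0" "\<And>z. z \<ge> z0 \<Longrightarrow> tail M (z / 2) \<le> D * tail M z"
    and u: "u > 0" "z0 \<le> 2 * ln (2 * D) / u"
    and z: "2 * ln (2 * D) / u \<le> z"
  shows "(\<integral>\<^sup>+s. ennreal (exp (u * s)) * indicator {2 * ln (2 * D) / u<..z} s \<partial>M)
           \<le> ennreal (2 * D * (exp (u * z) * tail M z))"
proof -
  define w where "w = 2 * ln (2 * D) / u"
  define H where "H z = (\<integral>\<^sup>+s. ennreal (exp (u * s)) * indicator {w<..z} s \<partial>M)" for z
  have tail_bound: "(\<integral>\<^sup>+s. ennreal (exp (u * s)) * indicator {v<..z} s \<partial>M) \<le> ennreal (exp (u * z) * tail M v)" for v z
  proof -
    have "(\<integral>\<^sup>+s. ennreal (exp (u * s)) * indicator {v<..z} s \<partial>M)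
        \<le> (\<integral>\<^sup>+s. ennreal (exp (u * z)) * indicator {v<..} s \<partial>M)"
      using u by (intro nn_integral_mono) (auto split: split_indicator intro!: ennreal_leI)
    also have "\<dots> = ennreal (exp (u * z) * tail M v)"
      by (simp add: nn_integral_cmult_indicator emeasure_eq_measure tail_eq_measure ennreal_mult)
    finally show ?thesis .
  qed
  have "w > 0" unfolding w_def using D u by auto
  moreover have "w \<le> z" using z by (simp add: w_def)
  ultimately have "H z \<le> ennreal (2 * D * (exp (u * z) * tail M z))"
  proof (induction z rule: halving_induct)
    case (base z)
    have "H z \<le> ennreal (exp (u * z) * tail M w)"
      unfolding H_def by (rule tail_bound)
    also have "tail M w \<le> tail M (z / 2)"
      using base by (intro tail_antimono) auto
    also have "\<dots> \<le> 2 * D * tail M z"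
    proof -
      have "tail M (z / 2) \<le> D * tail M z"
        using base u by (intro D) (simp add: w_def)
      moreover have "0 \<le> D * tail M z"
        using D tail_nonneg by simp
      ultimately show ?thesis by simp
    qed
    finally show ?case
      by (simp add: mult_ac ennreal_leI)
  next
    case (step z)
    have "H z \<le> (\<integral>\<^sup>+s. ennreal (exp (u * s)) * indicator {w<..z / 2} s
                   + ennreal (exp (u * s)) * indicator {z / 2<..z} s \<partial>M)"
      unfolding H_def by (intro nn_integral_mono) (auto split: split_indicator)
    also have "\<dots> = H (z / 2) + (\<integral>\<^sup>+s. ennreal (exp (u * s)) * indicator {z / 2<..z} s \<partial>M)"
      unfolding H_def by (intro nn_integral_add) auto
    also have "\<dots> \<le> ennreal (2 * D * (exp (u * (z / 2)) * tail M (z / 2))) + ennreal (exp (u * z) * tail M (z / 2))"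
      by (intro add_mono step tail_bound)
    also have "\<dots> = ennreal ((2 * D * exp (u * (z / 2)) + exp (u * z)) * tail M (z / 2))"
      using D tail_nonneg by (simp flip: ennreal_plus add: algebra_simps)
    also have "\<dots> \<le> ennreal ((2 * exp (u * z)) * (D * tail M z))"
    proof (intro ennreal_leI mult_mono)
      have "ln (2 * D) \<le> u * (z / 2)"
        using step u by (simp add: w_def field_simps) (smt (verit) D(1) ln_ge_zero)
      then have "2 * D \<le> exp (u * (z / 2))"
        using D(1) by (simp add: ln_ge_iff[symmetric] ln_le_cancel_iff[symmetric])
      then have "2 * D * exp (u * (z / 2)) \<le> exp (u * (z / 2)) * exp (u * (z / 2))"
        by (intro mult_right_mono) auto
      also have "\<dots> = exp (u * z)" by (simp flip: exp_add)
      finally show "2 * D * exp (u * (z / 2)) + exp (u * z) \<le> 2 * exp (u * z)" by simp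
      show "tail M (z / 2) \<le> D * tail M z"
        using step u \<open>w > 0\<close> by (intro D) (auto simp: w_def)
    qed (auto simp: tail_nonneg)
    finally show ?case by (simp add: mult_ac)
  qed
  then show ?thesis by (simp add: H_def w_def)
qed

text \<open>
  The range of integration has three parts. Up to \<open>\<eta> / u\<close> the excess of the exponential
  over 1 is linear up to a factor \<open>exp \<eta>\<close>, which gives the mean. From there to a large constant over \<open>u\<close> the exponential is
  bounded and the integral is a multiple of \<open>u\<close> times a truncated mean that vanishes. The remaining
  part is bounded by \<open>exp_moment_between_le\<close>, and the choice of the exponent makes it \<open>O(1 / y)\<close>.
\<close>

lemma truncated_exp_moment_le:
  assumes irv: "intermediate_regularly_varying M" and int: "integrable M (\<lambda>s. s)"
    and nonneg: "AE s in M. 0 \<le> s" and b': "(\<integral>s. s \<partial>M) < b'"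
  shows "eventually (\<lambda>y. (\<integral>\<^sup>+s. ennreal (if s \<le> y then exp (tail_exponent y * s) else 0) \<partial>M)
           \<le> ennreal (1 + tail_exponent y * b')) at_top"
proof -
  define b where "b = (\<integral>s. s \<partial>M)"
  define m where "m t = (\<integral>s. s * indicator {t<..} s \<partial>M)" for t
  have pos: "tail M x > 0" for x
    using irv by (auto simp: intermediate_regularly_varying_def)
  have "b \<ge> 0"
    unfolding b_def using nonneg by (rule integral_nonneg_AE)
  have m_nonneg: "m t \<ge> 0" for t
    unfolding m_def using nonneg by (intro integral_nonneg_AE) auto
  obtain D z0 where D: "D \<ge> 1" "z0 > 0" "\<And>z. z \<ge> z0 \<Longrightarrow> tail M (z / 2) \<le> D * tail M z"
    using irv_halving[OF irv] by blast
  define a where "a = 2 * ln (2 * D)"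
  have "a > 0" using D by (simp add: a_def)
  have "((\<lambda>\<eta>. exp \<eta> * b) \<longlongrightarrow> exp 0 * b) (at_right 0)"
    by (intro tendsto_intros)
  then have "eventually (\<lambda>\<eta>. exp \<eta> * b < b') (at_right 0)"
    using b' by (intro order_tendstoD(2)) (auto simp: b_def)
  then have "eventually (\<lambda>\<eta>. exp \<eta> * b < b' \<and> \<eta> > 0) (at_right 0)"
    using eventually_at_right_less[of 0] by eventually_elim auto
  then obtain \<eta> where \<eta>: "\<eta> > 0" "exp \<eta> * b < b'"
    by (metis (mono_tags, lifting) eventually_happens trivial_limit_at_right_real)
  have pointwise: "ennreal (if s \<le> y then exp (u * s) else 0)
      \<le> ennreal (1 + u * exp \<eta> * s + exp a * (u / \<eta>) * (s * indicator {\<eta> / u<..} s))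
         + ennreal (exp (u * s)) * indicator {a / u<..y} s"
    if "s \<ge> 0" "u > 0" for s u y
  proof -
    \<comment> \<open>The four cases are: cut off, large, small and intermediate values.\<close>
    consider "y < s" | "a / u < s" "s \<le> y" | "s \<le> \<eta> / u" "s \<le> y" | "\<eta> / u < s" "s \<le> a / u" "s \<le> y"
      by linarith
    then show ?thesis
    proof cases
      case 3
      have "1 - u * s \<le> exp (- (u * s))"
        using exp_ge_add_one_self[of "- (u * s)"] by simp
      then have "(1 - u * s) * exp (u * s) \<le> exp (- (u * s)) * exp (u * s)"
        by (intro mult_right_mono) auto
      then have "exp (u * s) \<le> 1 + u * s * exp (u * s)"
        by (simp add: algebra_simps flip: exp_add)
      also have "\<dots> \<le> 1 + u * s * exp \<eta>"
        using 3 that by (intro add_left_mono mult_left_mono) (auto simp: field_simps)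
      also have "\<dots> \<le> 1 + u * exp \<eta> * s + exp a * (u / \<eta>) * (s * indicator {\<eta> / u<..} s)"
        using that \<eta> by (auto split: split_indicator simp: algebra_simps)
      finally show ?thesis
        using 3 by (simp add: add_increasing2 ennreal_leI)
    next
      case 4
      have "exp (u * s) \<le> exp a * 1"
        using 4 that by (auto simp: field_simps)
      also have "\<dots> \<le> exp a * (u / \<eta> * s)"
        using 4 that \<eta> by (intro mult_left_mono) (auto simp: field_simps)
      also have "\<dots> \<le> 1 + u * exp \<eta> * s + exp a * (u / \<eta>) * (s * indicator {\<eta> / u<..} s)"
        using that 4 by (auto simp: algebra_simps)
      finally show ?thesis
        using 4 by (simp add: add_increasing2 ennreal_leI)
    next
      case 2
      then show ?thesis by (simp add: add_increasing)
    qed auto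
  qed
  have bound: "(\<integral>\<^sup>+s. ennreal (if s \<le> y then exp (u * s) else 0) \<partial>M)
      \<le> ennreal (1 + u * exp \<eta> * b + exp a * (u / \<eta>) * m (\<eta> / u) + 2 * D * (exp (u * y) * tail M y))"
    if u: "u > 0" "z0 \<le> a / u" "a / u \<le> y" for u y
  proof -
    define f where "f s = 1 + u * exp \<eta> * s + exp a * (u / \<eta>) * (s * indicator {\<eta> / u<..} s)" for s
    have f_int: "integrable M f" unfolding f_def using int
      by (intro Bochner_Integration.integrable_add integrable_mult_right integrable_real_mult_indicator) auto
    have f_nonneg: "AE s in M. 0 \<le> f s"
      using nonneg by eventually_elim (use u \<eta> in \<open>auto simp: f_def intro!: add_nonneg_nonneg\<close>)
    have "(\<integral>\<^sup>+s. ennreal (if s \<le> y then exp (u * s) else 0) \<partial>M)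
        \<le> (\<integral>\<^sup>+s. ennreal (f s) + ennreal (exp (u * s)) * indicator {a / u<..y} s \<partial>M)"
    proof (rule nn_integral_mono_AE)
      show "AE s in M. ennreal (if s \<le> y then exp (u * s) else 0) \<le> ennreal (f s) + ennreal (exp (u * s)) * indicator {a / u<..y} s"
        using nonneg by eventually_elim (use u in \<open>unfold f_def, intro pointwise\<close>)
    qed
    also have "\<dots> = (\<integral>\<^sup>+s. ennreal (f s) \<partial>M) + (\<integral>\<^sup>+s. ennreal (exp (u * s)) * indicator {a / u<..y} s \<partial>M)"
      unfolding f_def by (intro nn_integral_add) auto
    also have "(\<integral>\<^sup>+s. ennreal (f s) \<partial>M) = ennreal (\<integral>s. f s \<partial>M)"
      by (intro nn_integral_eq_integral f_int f_nonneg)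
    also have "(\<integral>s. f s \<partial>M) = 1 + u * exp \<eta> * b + exp a * (u / \<eta>) * m (\<eta> / u)"
    proof -
      have "integrable M (\<lambda>s. s * indicator {\<eta> / u<..} s)"
        using int by (intro integrable_real_mult_indicator) auto
      then show ?thesis
        unfolding f_def b_def m_def using int prob_space by simp
    qed
    also have "(\<integral>\<^sup>+s. ennreal (exp (u * s)) * indicator {a / u<..y} s \<partial>M) \<le> ennreal (2 * D * (exp (u * y) * tail M y))"
      unfolding a_def using D u by (intro exp_moment_between_le[where ?z0.0 = z0]) (auto simp: a_def)
    finally show ?thesis
      using u D \<open>b \<ge> 0\<close> \<eta> m_nonneg tail_nonneg[of y]
      by (subst ennreal_plus) (auto intro!: add_nonneg_nonneg)
  qed
  define u where "u = tail_exponent"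
  have lim: "filterlim (\<lambda>y. y * u y) at_top at_top" "(u \<longlongrightarrow> 0) at_top"
    using tail_exponent_asymptotics[OF irv int] by (auto simp: u_def)
  have u_pos: "eventually (\<lambda>y. u y > 0 \<and> y > 0) at_top"
    using filterlim_at_top_dense[THEN iffD1, OF lim(1), rule_format, of 0] eventually_gt_at_top[of 0]
    by eventually_elim (auto simp: zero_less_mult_iff)
  have u_right: "filterlim u (at_right 0) at_top"
    unfolding filterlim_at using lim(2) u_pos by (auto elim: eventually_mono)
  have inv: "filterlim (\<lambda>y. c / u y) at_top at_top" if "c > 0" for c
  proof (rule filterlim_compose[OF _ u_right])
    show "filterlim (\<lambda>v. c / v) at_top (at_right 0)"
      using that by real_asymp
  qed
  have m_lim: "((\<lambda>y. m (\<eta> / u y)) \<longlongrightarrow> 0) at_top"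
    using tail_mult_tendsto_0(1)[OF int] inv[OF \<open>\<eta> > 0\<close>] unfolding m_def by (rule filterlim_compose)
  have inv_lim: "((\<lambda>y. 1 / (y * u y)) \<longlongrightarrow> 0) at_top"
    by (intro tendsto_divide_0[OF tendsto_const] filterlim_at_top_imp_at_infinity lim)
  have "((\<lambda>y. exp \<eta> * b + exp a / \<eta> * m (\<eta> / u y) + 2 * D * (1 / (y * u y))) \<longlongrightarrow> exp \<eta> * b + exp a / \<eta> * 0 + 2 * D * 0) at_top"
    by (intro tendsto_add tendsto_mult tendsto_const m_lim inv_lim)
  then have "eventually (\<lambda>y. exp \<eta> * b + exp a / \<eta> * m (\<eta> / u y) + 2 * D * (1 / (y * u y)) < b') at_top"
    using \<eta> by (intro order_tendstoD(2)) auto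
  moreover have "eventually (\<lambda>y. y * u y \<ge> a) at_top" "eventually (\<lambda>y. a / u y \<ge> z0) at_top"
    using lim(1) inv[OF \<open>a > 0\<close>] by (auto simp: filterlim_at_top)
  ultimately show ?thesis using u_pos
  proof eventually_elim
    case (elim y)
    have "(\<integral>\<^sup>+s. ennreal (if s \<le> y then exp (u y * s) else 0) \<partial>M)
      \<le> ennreal (1 + u y * exp \<eta> * b + exp a * (u y / \<eta>) * m (\<eta> / u y) + 2 * D * (exp (u y * y) * tail M y))"
      using elim by (intro bound) (auto simp: field_simps)
    also have "exp (u y * y) * tail M y = 1 / y"
      unfolding u_def using elim pos by (intro tail_exponent_exp) auto
    also have "1 + u y * exp \<eta> * b + exp a * (u y / \<eta>) * m (\<eta> / u y) + 2 * D * (1 / y)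
        = 1 + u y * (exp \<eta> * b + exp a / \<eta> * m (\<eta> / u y) + 2 * D * (1 / (y * u y)))"
      using elim \<eta> by (simp add: field_simps)
    also have "\<dots> \<le> 1 + u y * b'"
      using elim by (intro add_left_mono mult_left_mono) auto
    finally show ?case
      unfolding u_def by (simp only: ennreal_leI)
  qed
qed

end

section \<open>Renewal arrivals\<close>

text \<open>
  The difference quotients of the Laplace transform at 0 tend to the mean.
\<close>

lemma (in real_distribution) laplace_transform_less:
  assumes int: "integrable M (\<lambda>t. t)" and nonneg: "AE t in M. 0 \<le> t" and a: "a < (\<integral>t. t \<partial>M)"
  obtains \<theta> where "\<theta> > 0" "(\<integral>t. exp (- (\<theta> * t)) \<partial>M) < 1 - \<theta> * a"
proof -
  define f where "f n t = (1 - exp (- (1 / real (Suc n) * t))) * real (Suc n)" for n and t :: real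
  have "(\<lambda>n. \<integral>t. f n t \<partial>M) \<longlonglongrightarrow> (\<integral>t. t \<partial>M)"
  proof (rule integral_dominated_convergence)
    show "integrable M (\<lambda>t. t)" by (rule int)
    show "AE t in M. (\<lambda>n. f n t) \<longlonglongrightarrow> t"
    proof (rule AE_I2)
      fix t :: real
      show "(\<lambda>n. f n t) \<longlonglongrightarrow> t"
        unfolding f_def by real_asymp
    qed
    fix n
    show "AE t in M. norm (f n t) \<le> t"
      using nonneg
    proof eventually_elim
      case (elim t)
      have "1 - exp (- (1 / real (Suc n) * t)) \<le> 1 / real (Suc n) * t"
        using exp_ge_add_one_self[of "- (1 / real (Suc n) * t)"] by linarith
      then have "f n t \<le> (1 / real (Suc n) * t) * real (Suc n)"
        unfolding f_def by (intro mult_right_mono) auto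
      moreover have "0 \<le> f n t"
        using elim unfolding f_def by auto
      ultimately show ?case by simp
    qed
  qed (auto simp: f_def)
  then have "eventually (\<lambda>n. a < (\<integral>t. f n t \<partial>M)) sequentially"
    using a by (rule order_tendstoD(1))
  then obtain n where n: "a < (\<integral>t. f n t \<partial>M)"
    by (auto simp: eventually_sequentially)
  define \<theta> where "\<theta> = 1 / real (Suc n)"
  have "\<theta> > 0" by (simp add: \<theta>_def)
  have "integrable M (\<lambda>t. exp (- (\<theta> * t)))"
    using nonneg \<open>\<theta> > 0\<close>
    by (intro integrable_const_bound[where B = 1]) (auto elim!: eventually_mono)
  then have "(\<integral>t. f n t \<partial>M) = (1 - (\<integral>t. exp (- (\<theta> * t)) \<partial>M)) / \<theta>"
    using prob_space unfolding f_def \<theta>_def by simp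
  then have "(\<integral>t. exp (- (\<theta> * t)) \<partial>M) < 1 - \<theta> * a"
    using mult_strict_left_mono[OF n \<open>\<theta> > 0\<close>] \<open>\<theta> > 0\<close> by simp
  with \<open>\<theta> > 0\<close> show ?thesis by (rule that)
qed

text \<open>
  A linear lower bound for the arrival epochs bounds the counting process linearly. It also makes the
  counted set finite, so that its cardinality is a true count and is monotone in \<open>t\<close>.
\<close>

lemma num_arrivals_subset:
  assumes "\<And>n. real n \<le> lam * arrival_time \<tau> n \<omega> + m" "0 \<le> lam"
  shows "{n. 1 \<le> n \<and> arrival_time \<tau> n \<omega> \<in> {0<..t}} \<subseteq> {1..nat \<lfloor>lam * t + m\<rfloor>}"
proof safe
  fix n assume n: "1 \<le> n" "arrival_time \<tau> n \<omega> \<in> {0<..t}"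
  have "real n \<le> lam * arrival_time \<tau> n \<omega> + m" by (rule assms)
  also have "\<dots> \<le> lam * t + m"
    using n assms by (intro add_right_mono mult_left_mono) auto
  finally show "n \<in> {1..nat \<lfloor>lam * t + m\<rfloor>}"
    using n by (auto simp: le_nat_floor)
qed

lemma num_arrivals_le:
  assumes "\<And>n. real n \<le> lam * arrival_time \<tau> n \<omega> + m" "0 \<le> lam" "0 \<le> m" "0 \<le> t"
  shows "real (num_arrivals \<tau> t \<omega>) \<le> lam * t + m"
proof -
  have "num_arrivals \<tau> t \<omega> \<le> card {1..nat \<lfloor>lam * t + m\<rfloor>}"
    unfolding num_arrivals_def using assms by (intro card_mono num_arrivals_subset) auto
  also have "real \<dots> \<le> lam * t + m"
    using assms by simp
  finally show ?thesis by simp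
qed

lemma num_arrivals_mono:
  assumes "\<And>n. real n \<le> lam * arrival_time \<tau> n \<omega> + m" "0 \<le> lam" "t \<le> t'"
  shows "num_arrivals \<tau> t \<omega> \<le> num_arrivals \<tau> t' \<omega>"
  unfolding num_arrivals_def
proof (rule card_mono)
  show "finite {n. 1 \<le> n \<and> arrival_time \<tau> n \<omega> \<in> {0<..t'}}"
    by (rule finite_subset[OF num_arrivals_subset[OF assms(1,2)]]) auto
qed (use assms in auto)

lemma num_arrivals_0 [simp]: "num_arrivals \<tau> 0 \<omega> = 0"
  by (simp add: num_arrivals_def)

lemma sojourn_time_eq: "sojourn_time \<tau> \<sigma> B K \<omega> = completion_time \<tau> \<sigma> B (K \<omega>) \<omega>"
proof -
  have "(\<Sum>k=1..n. cycle_time \<tau> \<sigma> B k \<omega>) = completion_time \<tau> \<sigma> B n \<omega>" for n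
    by (induction n) (auto simp: cycle_time_def)
  then show ?thesis by (simp add: sojourn_time_def)
qed

section \<open>Information and independence\<close>

context feedback_queue
begin

abbreviation T :: "nat \<Rightarrow> 'w \<Rightarrow> real" where "T \<equiv> completion_time \<tau> \<sigma> B"
abbreviation X :: "nat \<Rightarrow> 'w \<Rightarrow> nat" where "X \<equiv> queue_length \<tau> \<sigma> B"

definition info :: "source set \<Rightarrow> 'w measure" where
  "info J = sigma (space M) (\<Union>j\<in>J. source_events M \<tau> \<sigma> B K j)"

definition arrivals :: "source set" where
  "arrivals = {Interarrival n | n. n \<ge> 1}"

text \<open>
  The sources that determine the system up to the completion of the tagged customer's \<open>k\<close>-th
  service. All inter-arrival times are included, whether or not the arrivals lie in the past: what
  matters is that the services and feedback decisions of the next turn are independent of it.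
\<close>

definition history :: "nat \<Rightarrow> source set" where
  "history k = arrivals \<union> {Service r i | r i. 1 \<le> r \<and> r \<le> k} \<union> {Feedback r | r. 1 \<le> r \<and> r \<le> k}"

lemma source_events_subset_Pow: "source_events M \<tau> \<sigma> B K j \<subseteq> Pow (space M)"
  using sets.space_closed by (cases j) fastforce+

lemma Int_stable_source_events: "Int_stable (source_events M \<tau> \<sigma> B K j)"
  by (cases j) (auto intro: sets.Int_stable)

lemma space_info [simp]: "space (info J) = space M"
  by (simp add: info_def space_measure_of_conv)

lemma sets_info: "sets (info J) = sigma_sets (space M) (\<Union>j\<in>J. source_events M \<tau> \<sigma> B K j)"
  unfolding info_def using source_events_subset_Pow by (intro sets_measure_of) blast

lemma sets_info_mono: "I \<subseteq> J \<Longrightarrow> sets (info I) \<subseteq> sets (info J)"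
  unfolding sets_info by (intro sigma_sets_mono') auto

lemma sets_info_events: "J \<subseteq> sources \<Longrightarrow> sets (info J) \<subseteq> events"
  unfolding sets_info using indep_sources
  by (intro sets.sigma_sets_subset) (auto simp: indep_sets_def)

lemma measurable_info_mono: "f \<in> measurable (info I) N \<Longrightarrow> I \<subseteq> J \<Longrightarrow> f \<in> measurable (info J) N"
  using sets_info_mono[of I J] by (auto simp: measurable_def)

lemma measurable_info_events: "f \<in> measurable (info J) N \<Longrightarrow> J \<subseteq> sources \<Longrightarrow> f \<in> measurable M N"
  using sets_info_events[of J] by (auto simp: measurable_def)

lemma measurable_infoI:
  assumes "source_events M \<tau> \<sigma> B K j = sets (vimage_algebra (space M) f N)" "j \<in> J" "f \<in> space M \<rightarrow> space N"
  shows "f \<in> measurable (info J) N"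
proof (rule measurableI)
  fix A assume "A \<in> sets N"
  then have "f -` A \<inter> space M \<in> source_events M \<tau> \<sigma> B K j"
    unfolding assms(1) by (rule in_vimage_algebra)
  then show "f -` A \<inter> space (info J) \<in> sets (info J)"
    unfolding sets_info using \<open>j \<in> J\<close> by auto
qed (use assms(3) in auto)

lemma interarrival_info: "Interarrival n \<in> J \<Longrightarrow> \<tau> n \<in> borel_measurable (info J)"
  by (rule measurable_infoI[of "Interarrival n"]) auto

lemma service_info: "Service k i \<in> J \<Longrightarrow> \<sigma> k i \<in> borel_measurable (info J)"
  by (rule measurable_infoI[of "Service k i"]) auto

lemma visits_info: "Visits \<in> J \<Longrightarrow> K \<in> measurable (info J) (count_space UNIV)"
  by (rule measurable_infoI[of Visits]) auto

lemma feedback_info: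
  assumes "Feedback k \<in> J"
  shows "B k n \<in> measurable (info J) (count_space UNIV)"
proof -
  have "(\<lambda>\<omega> n. B k n \<omega>) \<in> measurable (info J) (\<Pi>\<^sub>M n\<in>UNIV. count_space UNIV)"
    using assms by (intro measurable_infoI[of "Feedback k"]) (auto simp: space_PiM)
  from measurable_compose[OF this measurable_component_singleton[of n]] show ?thesis
    by simp
qed

lemma nn_integral_indep_info:
  assumes f: "f \<in> borel_measurable (info I)" and g: "g \<in> borel_measurable (info J)"
    and IJ: "I \<inter> J = {}" "I \<subseteq> sources" "J \<subseteq> sources"
  shows "(\<integral>\<^sup>+\<omega>. f \<omega> * g \<omega> \<partial>M) = (\<integral>\<^sup>+\<omega>. f \<omega> \<partial>M) * (\<integral>\<^sup>+\<omega>. g \<omega> \<partial>M :: ennreal)"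
proof -
  let ?L = "case_bool I J" and ?h = "case_bool f g"
  have "indep_sets (\<lambda>b. sigma_sets (space M) (\<Union>j\<in>?L b. source_events M \<tau> \<sigma> B K j)) UNIV"
  proof (rule indep_sets_collect_sigma)
    show "indep_sets (source_events M \<tau> \<sigma> B K) (\<Union>b\<in>UNIV. ?L b)"
      using IJ by (intro indep_sets_mono_index[OF _ indep_sources]) (auto simp: UNIV_bool)
    show "disjoint_family_on ?L UNIV"
      using IJ by (auto simp: disjoint_family_on_def split: bool.splits)
  qed (rule Int_stable_source_events)
  then have "indep_sets (\<lambda>b. {?h b -` A \<inter> space M | A. A \<in> sets borel}) UNIV"
  proof (rule indep_sets_mono_sets)
    fix b :: bool
    have "?h b \<in> borel_measurable (info (?L b))" using f g by (cases b) auto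
    from measurable_sets[OF this]
    show "{?h b -` A \<inter> space M | A. A \<in> sets borel} \<subseteq> sigma_sets (space M) (\<Union>j\<in>?L b. source_events M \<tau> \<sigma> B K j)"
      by (auto simp: sets_info)
  qed
  moreover have "random_variable borel (?h b)" for b
    using f g IJ by (cases b) (auto intro: measurable_info_events)
  ultimately have "indep_vars (\<lambda>_. borel) ?h UNIV"
    unfolding indep_vars_def2 by auto
  from indep_vars_nn_integral[OF _ this] show ?thesis
    by (simp add: UNIV_bool mult.commute)
qed

lemma arrival_time_info: "arrivals \<subseteq> J \<Longrightarrow> arrival_time \<tau> n \<in> borel_measurable (info J)"
  unfolding arrival_time_def [abs_def]
  by (intro borel_measurable_sum interarrival_info) (auto simp: arrivals_def)

lemma num_arrivals_info:
  assumes "arrivals \<subseteq> J" and t: "t \<in> borel_measurable (info J)"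
  shows "(\<lambda>\<omega>. num_arrivals \<tau> (t \<omega>) \<omega>) \<in> measurable (info J) (count_space UNIV)"
  unfolding num_arrivals_def
proof (rule measurable_card)
  fix n
  have [measurable]: "arrival_time \<tau> n \<in> borel_measurable (info J)" "t \<in> borel_measurable (info J)"
    using assms by (auto intro: arrival_time_info)
  show "{\<omega> \<in> space (info J). n \<in> {n. 1 \<le> n \<and> arrival_time \<tau> n \<omega> \<in> {0<..t \<omega>}}} \<in> sets (info J)"
    by (simp del: space_info) measurable
qed

lemma history_mono: "k \<le> k' \<Longrightarrow> history k \<subseteq> history k'"
  unfolding history_def by fastforce

lemma arrivals_subset_history: "arrivals \<subseteq> history k"
  by (auto simp: history_def)

lemma history_sources: "history k \<subseteq> sources"
  by (auto simp: history_def arrivals_def sources_def)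

lemma queue_info_history:
  "T k \<in> borel_measurable (info (history k)) \<and> X k \<in> measurable (info (history k)) (count_space UNIV)"
proof (induction k)
  case (Suc k)
  let ?J = "history (Suc k)"
  have Tk [measurable]: "T k \<in> borel_measurable (info ?J)"
    and X [measurable]: "X k \<in> measurable (info ?J) (count_space UNIV)"
    using Suc history_mono[of k "Suc k"] by (auto intro: measurable_info_mono)
  have [measurable]: "\<sigma> (Suc k) i \<in> borel_measurable (info ?J)" for i
    by (rule service_info) (auto simp: history_def)
  have [measurable]: "B (Suc k) n \<in> measurable (info ?J) (count_space UNIV)" for n
    by (rule feedback_info) (auto simp: history_def)
  have "(\<lambda>\<omega>. \<Sum>i=0..n. \<sigma> (Suc k) i \<omega>) \<in> borel_measurable (info ?J)" for n
    by measurable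
  from measurable_compose_countable[OF this X]
  have "(\<lambda>\<omega>. T k \<omega> + (\<Sum>i=0..X k \<omega>. \<sigma> (Suc k) i \<omega>)) \<in> borel_measurable (info ?J)"
    by (intro borel_measurable_add Tk)
  moreover have "T (Suc k) = (\<lambda>\<omega>. T k \<omega> + (\<Sum>i=0..X k \<omega>. \<sigma> (Suc k) i \<omega>))"
    by (rule ext) simp
  ultimately have TS: "T (Suc k) \<in> borel_measurable (info ?J)"
    by simp
  have "(\<lambda>\<omega>. B (Suc k) (X k \<omega>) \<omega>) \<in> measurable (info ?J) (count_space UNIV)"
    by (rule measurable_compose_countable[OF _ X]) measurable
  moreover have "(\<lambda>\<omega>. num_arrivals \<tau> (T (Suc k) \<omega>) \<omega>) \<in> measurable (info ?J) (count_space UNIV)"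
    "(\<lambda>\<omega>. num_arrivals \<tau> (T k \<omega>) \<omega>) \<in> measurable (info ?J) (count_space UNIV)"
    by (intro num_arrivals_info arrivals_subset_history TS Tk)+
  ultimately have "(\<lambda>\<omega>. (num_arrivals \<tau> (T (Suc k) \<omega>) \<omega> - num_arrivals \<tau> (T k \<omega>) \<omega>) + B (Suc k) (X k \<omega>) \<omega>) \<in> measurable (info ?J) (count_space UNIV)"
    by measurable
  moreover have "X (Suc k) = (\<lambda>\<omega>. (num_arrivals \<tau> (T (Suc k) \<omega>) \<omega> - num_arrivals \<tau> (T k \<omega>) \<omega>) + B (Suc k) (X k \<omega>) \<omega>)"
    by (rule ext) simp
  ultimately show ?case using TS by simp
qed auto

lemma T_info: "history k \<subseteq> J \<Longrightarrow> T k \<in> borel_measurable (info J)"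
  and X_info: "history k \<subseteq> J \<Longrightarrow> X k \<in> measurable (info J) (count_space UNIV)"
  using queue_info_history[of k] measurable_info_mono by blast+

lemma X_measurable [measurable]: "X k \<in> measurable M (count_space UNIV)"
  and T_measurable [measurable]: "T k \<in> borel_measurable M"
  using X_info[of k "history k"] T_info[of k "history k"] history_sources
  by (auto intro: measurable_info_events)

text \<open>
  Wald's step: a random index that is known on one side can be frozen when integrating over an
  independent side.
\<close>

lemma nn_integral_countable_index:
  assumes F: "F \<in> borel_measurable (info I)" and N: "N \<in> measurable (info I) (count_space UNIV)"
    and H: "\<And>n::nat. H n \<in> borel_measurable (info J)"
    and IJ: "I \<inter> J = {}" "I \<subseteq> sources" "J \<subseteq> sources"
  shows "(\<integral>\<^sup>+\<omega>. F \<omega> * H (N \<omega>) \<omega> \<partial>M) = (\<integral>\<^sup>+\<omega>. F \<omega> * (\<integral>\<^sup>+\<omega>'. H (N \<omega>) \<omega>' \<partial>M) \<partial>M :: ennreal)"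
proof -
  have by_value: "F \<omega> * f (N \<omega>) = (\<Sum>n. (F \<omega> * indicator {n} (N \<omega>)) * f n)"
    for \<omega> and f :: "nat \<Rightarrow> ennreal"
    by (subst suminf_finite[of "{N \<omega>}"]) auto
  have FN: "(\<lambda>\<omega>. F \<omega> * indicator {n} (N \<omega>)) \<in> borel_measurable (info I)" for n
    by (intro borel_measurable_times_ennreal F measurable_compose[OF N]) simp
  have meas [measurable]: "(\<lambda>\<omega>. F \<omega> * indicator {n} (N \<omega>)) \<in> borel_measurable M" "H n \<in> borel_measurable M" for n
    using FN[of n] H[of n] IJ by (auto intro: measurable_info_events)
  have "(\<integral>\<^sup>+\<omega>. F \<omega> * H (N \<omega>) \<omega> \<partial>M) = (\<Sum>n. \<integral>\<^sup>+\<omega>. (F \<omega> * indicator {n} (N \<omega>)) * H n \<omega> \<partial>M)"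
    by (subst by_value[of _ "\<lambda>n. H n _"], rule nn_integral_suminf) measurable
  also have "\<dots> = (\<Sum>n. (\<integral>\<^sup>+\<omega>. F \<omega> * indicator {n} (N \<omega>) \<partial>M) * (\<integral>\<^sup>+\<omega>'. H n \<omega>' \<partial>M))"
    using nn_integral_indep_info[OF FN H IJ] by simp
  also have "\<dots> = (\<Sum>n. \<integral>\<^sup>+\<omega>. (F \<omega> * indicator {n} (N \<omega>)) * (\<integral>\<^sup>+\<omega>'. H n \<omega>' \<partial>M) \<partial>M)"
    by (simp add: nn_integral_multc)
  also have "\<dots> = (\<integral>\<^sup>+\<omega>. (\<Sum>n. (F \<omega> * indicator {n} (N \<omega>)) * (\<integral>\<^sup>+\<omega>'. H n \<omega>' \<partial>M)) \<partial>M)"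
    by (rule nn_integral_suminf[symmetric]) measurable
  also have "\<dots> = (\<integral>\<^sup>+\<omega>. F \<omega> * (\<integral>\<^sup>+\<omega>'. H (N \<omega>) \<omega>' \<partial>M) \<partial>M)"
    by (intro nn_integral_cong by_value[symmetric])
  finally show ?thesis .
qed

lemma nn_integral_service: "k \<ge> 1 \<Longrightarrow> f \<in> borel_measurable borel \<Longrightarrow> (\<integral>\<^sup>+\<omega>. f (\<sigma> k i \<omega>) \<partial>M) = (\<integral>\<^sup>+s. f s \<partial>G)"
  using nn_integral_distr[of "\<sigma> k i" M borel f] service_measurable[of k i] service_distr[of k i] by simp

lemma nn_integral_interarrival: "n \<ge> 1 \<Longrightarrow> f \<in> borel_measurable borel \<Longrightarrow> (\<integral>\<^sup>+\<omega>. f (\<tau> n \<omega>) \<partial>M) = (\<integral>\<^sup>+t. f t \<partial>A)"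
  using nn_integral_distr[of "\<tau> n" M borel f] interarrival_measurable[of n] interarrival_distr[of n] by simp

lemma AE_service_nonneg: "AE \<omega> in M. \<forall>k\<ge>1. \<forall>i. 0 \<le> \<sigma> k i \<omega>"
proof -
  have "AE \<omega> in M. 0 \<le> \<sigma> k i \<omega>" if k: "k \<ge> 1" for k i
  proof (rule AE_distrD[OF service_measurable[OF k]])
    show "AE s in distr M borel (\<sigma> k i). 0 \<le> s"
      unfolding service_distr[OF k] by (rule service_nonneg)
  qed
  then show ?thesis
    by (simp add: AE_all_countable)
qed

text \<open>
  The random variable \<open>m\<close> is a random intercept that keeps the whole arrival process below a line of slope
  \<open>lam\<close>.
\<close>

definition arrival_envelope :: "real \<Rightarrow> ('w \<Rightarrow> real) \<Rightarrow> bool" where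
  "arrival_envelope lam m \<longleftrightarrow> m \<in> borel_measurable (info arrivals) \<and> (\<forall>\<omega>. 0 \<le> m \<omega>) \<and>
     (AE \<omega> in M. \<forall>n. real n \<le> lam * arrival_time \<tau> n \<omega> + m \<omega>)"

text \<open>
  Let \<open>S\<close> be the arrival epochs. For suitable \<open>\<theta>0\<close> the numbers \<open>exp (\<theta>0 * (n - lam * S n))\<close> have
  geometrically decreasing expectations, since \<open>n - lam * S n\<close> is a random walk with negative drift. Their
  sum \<open>W\<close> is integrable and dominates each of them, so \<open>ln W / \<theta>0\<close> is an envelope. Its
  exponential moments are linear in \<open>\<theta>\<close> by convexity.
\<close>

lemma arrival_envelope_exists:
  assumes lam: "1 / (\<integral>t. t \<partial>A) < lam"
  obtains m \<theta>0 c where "arrival_envelope lam m" "\<theta>0 > 0" "c \<ge> 0"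
    "\<And>\<theta>. 0 \<le> \<theta> \<Longrightarrow> \<theta> \<le> \<theta>0 \<Longrightarrow> (\<integral>\<^sup>+\<omega>. ennreal (exp (\<theta> * m \<omega>)) \<partial>M) \<le> ennreal (1 + c * \<theta>)"
proof -
  define a where "a = (\<integral>t. t \<partial>A)"
  have "a > 0" using interarrival_mean by (simp add: a_def)
  then have "lam > 0" using lam by (smt (verit) a_def divide_pos_pos)
  have "1 / lam < a"
    using lam \<open>a > 0\<close> \<open>lam > 0\<close> by (simp add: a_def field_simps)
  then obtain \<theta> where \<theta>: "\<theta> > 0" "(\<integral>t. exp (- (\<theta> * t)) \<partial>A) < 1 - \<theta> * (1 / lam)"
    using interarrival.laplace_transform_less[OF interarrival_mean(1) interarrival_nonneg, of "1 / lam"]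
    unfolding a_def by metis
  define \<theta>0 where "\<theta>0 = \<theta> / lam"
  have \<theta>_eq: "\<theta> = \<theta>0 * lam" using \<open>lam > 0\<close> by (simp add: \<theta>0_def)
  define \<gamma> where "\<gamma> = exp \<theta>0 * (\<integral>t. exp (- (\<theta> * t)) \<partial>A)"
  have "\<theta>0 > 0" using \<theta> \<open>lam > 0\<close> by (simp add: \<theta>0_def)
  have "(\<integral>t. exp (- (\<theta> * t)) \<partial>A) < exp (- \<theta>0)"
    using \<theta>(2) exp_ge_add_one_self[of "- \<theta>0"] by (simp add: \<theta>0_def)
  then have "\<gamma> < 1"
    unfolding \<gamma>_def by (simp add: exp_minus field_simps)
  have "\<gamma> \<ge> 0" unfolding \<gamma>_def by simp
  have step: "(\<integral>\<^sup>+t. ennreal (exp (\<theta>0 - \<theta> * t)) \<partial>A) = ennreal \<gamma>"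
  proof -
    have "integrable A (\<lambda>t. exp (- (\<theta> * t)))"
      using interarrival_nonneg \<theta> by (intro interarrival.integrable_const_bound[where B = 1]) (auto elim!: eventually_mono)
    then have "(\<integral>\<^sup>+t. ennreal (exp \<theta>0 * exp (- (\<theta> * t))) \<partial>A) = ennreal (\<integral>t. exp \<theta>0 * exp (- (\<theta> * t)) \<partial>A)"
      by (intro nn_integral_eq_integral) auto
    moreover have "exp (\<theta>0 - \<theta> * t) = exp \<theta>0 * exp (- (\<theta> * t))" for t
      by (simp add: mult_exp_exp)
    ultimately show ?thesis
      by (simp add: \<gamma>_def)
  qed
  define e where "e n \<omega> = ennreal (exp (\<theta>0 * real n - \<theta> * arrival_time \<tau> n \<omega>))" for n \<omega>
  have e_info: "e n \<in> borel_measurable (info arrivals)" for n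
    using arrival_time_info[of arrivals n] unfolding e_def by measurable
  have e_int: "(\<integral>\<^sup>+\<omega>. e n \<omega> \<partial>M) = ennreal (\<gamma> ^ n)" for n
  proof (induction n)
    case 0
    then show ?case by (simp add: e_def arrival_time_def emeasure_space_1)
  next
    case (Suc n)
    let ?I = "{Interarrival k | k. 1 \<le> k \<and> k \<le> n}" and ?J = "{Interarrival (Suc n)}"
    have "e (Suc n) \<omega> = e n \<omega> * ennreal (exp (\<theta>0 - \<theta> * \<tau> (Suc n) \<omega>))" for \<omega>
      unfolding e_def by (simp add: arrival_time_def algebra_simps flip: exp_add ennreal_mult)
    then have "(\<integral>\<^sup>+\<omega>. e (Suc n) \<omega> \<partial>M) = (\<integral>\<^sup>+\<omega>. e n \<omega> * ennreal (exp (\<theta>0 - \<theta> * \<tau> (Suc n) \<omega>)) \<partial>M)"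
      by simp
    also have "\<dots> = (\<integral>\<^sup>+\<omega>. e n \<omega> \<partial>M) * (\<integral>\<^sup>+\<omega>. ennreal (exp (\<theta>0 - \<theta> * \<tau> (Suc n) \<omega>)) \<partial>M)"
    proof (rule nn_integral_indep_info)
      have [measurable]: "arrival_time \<tau> n \<in> borel_measurable (info ?I)"
        unfolding arrival_time_def [abs_def] by (intro borel_measurable_sum interarrival_info) auto
      show "e n \<in> borel_measurable (info ?I)" unfolding e_def by measurable
      have [measurable]: "\<tau> (Suc n) \<in> borel_measurable (info ?J)" by (intro interarrival_info) auto
      show "(\<lambda>\<omega>. ennreal (exp (\<theta>0 - \<theta> * \<tau> (Suc n) \<omega>))) \<in> borel_measurable (info ?J)" by measurable
    qed (auto simp: sources_def)
    also have "(\<integral>\<^sup>+\<omega>. ennreal (exp (\<theta>0 - \<theta> * \<tau> (Suc n) \<omega>)) \<partial>M) = ennreal \<gamma>"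
      by (subst nn_integral_interarrival[where f = "\<lambda>t. ennreal (exp (\<theta>0 - \<theta> * t))"]) (auto simp: step)
    finally show ?case
      using Suc \<open>\<gamma> \<ge> 0\<close> by (simp add: mult.commute flip: ennreal_mult)
  qed
  define W where "W \<omega> = (\<Sum>n. e n \<omega>)" for \<omega>
  have W_info: "W \<in> borel_measurable (info arrivals)"
    unfolding W_def using e_info by measurable
  have [measurable]: "e n \<in> borel_measurable M" "W \<in> borel_measurable M" for n
    using e_info[of n] W_info by (auto intro!: measurable_info_events simp: arrivals_def sources_def)
  have "(\<integral>\<^sup>+\<omega>. W \<omega> \<partial>M) = (\<Sum>n. ennreal (\<gamma> ^ n))"
    unfolding W_def by (subst nn_integral_suminf) (auto simp: e_int)
  also have "\<dots> = ennreal (\<Sum>n. \<gamma> ^ n)"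
    using \<open>\<gamma> \<ge> 0\<close> \<open>\<gamma> < 1\<close> by (intro suminf_ennreal2 summable_geometric) auto
  finally obtain w where w: "(\<integral>\<^sup>+\<omega>. W \<omega> \<partial>M) = ennreal w" "w \<ge> 0"
    using \<open>\<gamma> \<ge> 0\<close> \<open>\<gamma> < 1\<close> by (metis suminf_nonneg summable_geometric zero_le_power abs_of_nonneg real_norm_def)
  have e_le_W: "e n \<omega> \<le> W \<omega>" for n \<omega>
    unfolding W_def using sum_le_suminf[of "\<lambda>n. e n \<omega>" "{n}"] by auto
  have W_ge_1: "1 \<le> W \<omega>" for \<omega>
    using e_le_W[of 0 \<omega>] by (simp add: e_def arrival_time_def)
  define m where "m \<omega> = (if W \<omega> = \<top> then 0 else ln (enn2real (W \<omega>)) / \<theta>0)" for \<omega>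
  have W_real: "1 \<le> enn2real (W \<omega>)" if "W \<omega> \<noteq> \<top>" for \<omega>
    using W_ge_1[of \<omega>] that enn2real_mono[of 1 "W \<omega>"] by (simp add: top.not_eq_extremum)
  have m_nonneg: "0 \<le> m \<omega>" for \<omega>
    using W_real[of \<omega>] \<open>\<theta>0 > 0\<close> by (simp add: m_def)
  have m_info: "m \<in> borel_measurable (info arrivals)"
    unfolding m_def using W_info by measurable
  have AE_W: "AE \<omega> in M. W \<omega> \<noteq> \<top>"
    using nn_integral_noteq_infinite[of W M] w by simp
  have env: "AE \<omega> in M. \<forall>n. real n \<le> lam * arrival_time \<tau> n \<omega> + m \<omega>"
    using AE_W
  proof eventually_elim
    case (elim \<omega>)
    show ?case
    proof
      fix n
      have "exp (\<theta>0 * real n - \<theta> * arrival_time \<tau> n \<omega>) \<le> enn2real (W \<omega>)"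
        using enn2real_mono[OF e_le_W[of n \<omega>]] elim by (simp add: e_def top.not_eq_extremum)
      then have "\<theta>0 * real n - \<theta> * arrival_time \<tau> n \<omega> \<le> ln (enn2real (W \<omega>))"
        using W_real[OF elim] by (subst ln_ge_iff) auto
      also have "\<dots> = \<theta>0 * m \<omega>"
        using elim \<open>\<theta>0 > 0\<close> by (simp add: m_def)
      finally have "\<theta>0 * real n \<le> \<theta>0 * (lam * arrival_time \<tau> n \<omega> + m \<omega>)"
        using \<theta>_eq by (simp add: algebra_simps)
      then show "real n \<le> lam * arrival_time \<tau> n \<omega> + m \<omega>"
        using \<open>\<theta>0 > 0\<close> by simp
    qed
  qed
  have mom: "(\<integral>\<^sup>+\<omega>. ennreal (exp (\<theta> * m \<omega>)) \<partial>M) \<le> ennreal (1 + w / \<theta>0 * \<theta>)"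
    if "0 \<le> \<theta>" "\<theta> \<le> \<theta>0" for \<theta>
  proof -
    define r where "r = \<theta> / \<theta>0"
    have r: "0 \<le> r" "r \<le> 1" using that \<open>\<theta>0 > 0\<close> by (auto simp: r_def)
    have "(\<integral>\<^sup>+\<omega>. ennreal (exp (\<theta> * m \<omega>)) \<partial>M) \<le> (\<integral>\<^sup>+\<omega>. 1 + ennreal r * W \<omega> \<partial>M)"
    proof (rule nn_integral_mono_AE, use AE_W in eventually_elim)
      case (elim \<omega>)
      \<comment> \<open>Convexity of exp between 0 and \<open>\<theta>0 * m \<omega>\<close>.\<close>
      have "exp ((1 - r) *\<^sub>R 0 + r *\<^sub>R (\<theta>0 * m \<omega>)) \<le> (1 - r) * exp 0 + r * exp (\<theta>0 * m \<omega>)"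
        using r by (intro convex_onD[OF exp_convex]) auto
      also have "exp (\<theta>0 * m \<omega>) = enn2real (W \<omega>)"
        using W_real[OF elim] elim \<open>\<theta>0 > 0\<close> by (simp add: m_def)
      finally have "exp (\<theta> * m \<omega>) \<le> 1 + r * enn2real (W \<omega>)"
        using r \<open>\<theta>0 > 0\<close> by (simp add: r_def)
      then have "ennreal (exp (\<theta> * m \<omega>)) \<le> ennreal (1 + r * enn2real (W \<omega>))"
        by (rule ennreal_leI)
      also have "\<dots> = 1 + ennreal r * W \<omega>"
        using r elim by (simp add: ennreal_mult top.not_eq_extremum)
      finally show ?case .
    qed
    also have "\<dots> = 1 + ennreal r * ennreal w"
      by (simp add: nn_integral_add nn_integral_cmult w emeasure_space_1)
    also have "\<dots> = ennreal (1 + w / \<theta>0 * \<theta>)"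
    proof -
      have "w / \<theta>0 * \<theta> = r * w" by (simp add: r_def)
      moreover have "ennreal (1 + r * w) = ennreal 1 + ennreal (r * w)"
        using r w by (intro ennreal_plus) auto
      ultimately show ?thesis
        using r w by (simp add: ennreal_mult)
    qed
    finally show ?thesis .
  qed
  show ?thesis
  proof (rule that)
    show "arrival_envelope lam m"
      unfolding arrival_envelope_def using m_info m_nonneg env by auto
    show "w / \<theta>0 \<ge> 0" using w \<open>\<theta>0 > 0\<close> by simp
  qed (use mom \<open>\<theta>0 > 0\<close> in auto)
qed

end

section \<open>One turn of the tagged customer and mean queue lengths\<close>

lemma nn_integral_binomial_pmf_mgf:
  assumes "0 \<le> p" "p \<le> 1"
  shows "(\<integral>\<^sup>+k. ennreal (exp (\<theta> * real k)) \<partial>binomial_pmf n p) = ennreal ((1 - p + p * exp \<theta>) ^ n)"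
proof (induction n)
  case (Suc n)
  define c where "c = 1 - p + p * exp \<theta>"
  have "0 \<le> c" using assms by (auto simp: c_def)
  have "(\<integral>\<^sup>+k. ennreal (exp (\<theta> * real k)) \<partial>binomial_pmf (Suc n) p)
      = (\<integral>\<^sup>+k. ennreal (exp (\<theta> * real (Suc k))) \<partial>binomial_pmf n p) * ennreal p
        + (\<integral>\<^sup>+k. ennreal (exp (\<theta> * real k)) \<partial>binomial_pmf n p) * ennreal (1 - p)"
    using assms by (simp add: binomial_pmf_Suc)
  also have "(\<integral>\<^sup>+k. ennreal (exp (\<theta> * real (Suc k))) \<partial>binomial_pmf n p)
      = (\<integral>\<^sup>+k. ennreal (exp \<theta>) * ennreal (exp (\<theta> * real k)) \<partial>binomial_pmf n p)"
    by (simp add: algebra_simps exp_add ennreal_mult)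
  also have "\<dots> = ennreal (exp \<theta> * c ^ n)"
    using \<open>0 \<le> c\<close> by (simp add: nn_integral_cmult Suc c_def ennreal_mult)
  also have "\<dots> * ennreal p + (\<integral>\<^sup>+k. ennreal (exp (\<theta> * real k)) \<partial>binomial_pmf n p) * ennreal (1 - p)
      = ennreal (exp \<theta> * c ^ n * p + c ^ n * (1 - p))"
    unfolding Suc c_def[symmetric] using assms \<open>0 \<le> c\<close> by (simp add: ennreal_mult ennreal_plus)
  also have "exp \<theta> * c ^ n * p + c ^ n * (1 - p) = c ^ Suc n"
    by (simp add: c_def algebra_simps)
  finally show ?case by (simp only: c_def)
qed (use assms in \<open>simp add: binomial_pmf_0\<close>)

lemma nn_integral_binomial_pmf_id:
  assumes "0 \<le> p" "p \<le> 1"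
  shows "(\<integral>\<^sup>+k. ennreal (real k) \<partial>binomial_pmf n p) = ennreal (real n * p)"
proof (induction n)
  case (Suc n)
  have "(\<integral>\<^sup>+k. ennreal (real k) \<partial>binomial_pmf (Suc n) p)
      = (\<integral>\<^sup>+k. 1 + ennreal (real k) \<partial>binomial_pmf n p) * ennreal p
        + (\<integral>\<^sup>+k. ennreal (real k) \<partial>binomial_pmf n p) * ennreal (1 - p)"
    using assms by (simp add: binomial_pmf_Suc)
  also have "(\<integral>\<^sup>+k. 1 + ennreal (real k) \<partial>binomial_pmf n p) = ennreal (1 + real n * p)"
    using assms by (simp add: nn_integral_add Suc measure_pmf.emeasure_space_1)
  also have "\<dots> * ennreal p + (\<integral>\<^sup>+k. ennreal (real k) \<partial>binomial_pmf n p) * ennreal (1 - p)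
      = ennreal ((1 + real n * p) * p + real n * p * (1 - p))"
    unfolding Suc using assms by (simp add: ennreal_mult ennreal_plus)
  also have "(1 + real n * p) * p + real n * p * (1 - p) = real (Suc n) * p"
    by (simp add: algebra_simps)
  finally show ?case .
qed (use assms in \<open>simp add: binomial_pmf_0\<close>)

declare completion_time.simps(2) [simp del] queue_length.simps(2) [simp del]

context feedback_queue
begin

lemma arrivals_sources: "arrivals \<subseteq> sources"
  using arrivals_subset_history history_sources by blast

definition fresh :: "nat \<Rightarrow> source set" where
  "fresh k = {Service (Suc k) i | i. True} \<union> {Feedback (Suc k)}"

lemma fresh_disjoint: "history k \<inter> fresh k = {}" and fresh_sources: "fresh k \<subseteq> sources"
  by (auto simp: fresh_def history_def arrivals_def sources_def)

lemma service_fresh: "\<sigma> (Suc k) i \<in> borel_measurable (info (fresh k))"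
  by (rule service_info) (auto simp: fresh_def)

lemma feedback_fresh: "B (Suc k) n \<in> measurable (info (fresh k)) (count_space UNIV)"
  by (rule feedback_info) (auto simp: fresh_def)

lemma nn_integral_feedback: "(\<integral>\<^sup>+\<omega>. f (B (Suc k) n \<omega>) \<partial>M) = (\<integral>\<^sup>+j. f j \<partial>binomial_pmf n p)"
  using nn_integral_distr[of "B (Suc k) n" M "count_space UNIV" f] feedback_measurable[of "Suc k" n]
    feedback_distr[of "Suc k" n] by simp

lemma nn_integral_fresh_sum:
  "(\<integral>\<^sup>+\<omega>. (\<Sum>i=0..X k \<omega>. ennreal (\<sigma> (Suc k) i \<omega>)) \<partial>M) = ennreal (\<integral>s. s \<partial>G) * (\<integral>\<^sup>+\<omega>. ennreal (1 + real (X k \<omega>)) \<partial>M)"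
proof -
  note service_fresh [measurable]
  have b: "(\<integral>\<^sup>+\<omega>. ennreal (\<sigma> (Suc k) i \<omega>) \<partial>M) = ennreal (\<integral>s. s \<partial>G)" for i
    using nn_integral_service[of "Suc k" ennreal i] nn_integral_eq_integral[OF service_mean(1) service_nonneg] by simp
  have [measurable]: "\<sigma> (Suc k) i \<in> borel_measurable M" for i
    by (rule service_measurable) simp
  have "(\<integral>\<^sup>+\<omega>. 1 * (\<Sum>i=0..X k \<omega>. ennreal (\<sigma> (Suc k) i \<omega>)) \<partial>M)
      = (\<integral>\<^sup>+\<omega>. 1 * (\<integral>\<^sup>+\<omega>'. (\<Sum>i=0..X k \<omega>. ennreal (\<sigma> (Suc k) i \<omega>')) \<partial>M) \<partial>M)"
    using fresh_disjoint history_sources fresh_sources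
    by (intro nn_integral_countable_index[where I = "history k" and J = "fresh k" and N = "X k" and H = "\<lambda>n \<omega>. \<Sum>i=0..n. ennreal (\<sigma> (Suc k) i \<omega>)"] X_info)
       (auto intro: X_info)
  also have "\<dots> = (\<integral>\<^sup>+\<omega>. ennreal (\<integral>s. s \<partial>G) * ennreal (1 + real (X k \<omega>)) \<partial>M)"
    by (simp add: nn_integral_sum b ennreal_of_nat_eq_real_of_nat mult.commute add.commute)
  finally show ?thesis
    by (simp add: nn_integral_cmult)
qed

lemma nn_integral_fresh_feedback:
  "(\<integral>\<^sup>+\<omega>. ennreal (real (B (Suc k) (X k \<omega>) \<omega>)) \<partial>M) = ennreal p * (\<integral>\<^sup>+\<omega>. ennreal (real (X k \<omega>)) \<partial>M)"
proof -
  note feedback_fresh [measurable]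
  have "(\<integral>\<^sup>+\<omega>. 1 * ennreal (real (B (Suc k) (X k \<omega>) \<omega>)) \<partial>M)
      = (\<integral>\<^sup>+\<omega>. 1 * (\<integral>\<^sup>+\<omega>'. ennreal (real (B (Suc k) (X k \<omega>) \<omega>')) \<partial>M) \<partial>M)"
    using fresh_disjoint history_sources fresh_sources
    by (intro nn_integral_countable_index[where I = "history k" and J = "fresh k" and N = "X k" and H = "\<lambda>n \<omega>. ennreal (real (B (Suc k) n \<omega>))"] X_info)
       (auto intro: X_info)
  also have "\<dots> = (\<integral>\<^sup>+\<omega>. ennreal p * ennreal (real (X k \<omega>)) \<partial>M)"
    using p by (simp add: nn_integral_feedback[where f = "\<lambda>j. ennreal (real j)"] nn_integral_binomial_pmf_id ennreal_mult mult.commute)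
  finally show ?thesis
    by (simp add: nn_integral_cmult)
qed

text \<open>
  On these sample points the completion times do not decrease and the arrival counts are finite and
  monotone, so that the truncated subtraction in the queue length is a true difference.
\<close>

definition regular :: "real \<Rightarrow> ('w \<Rightarrow> real) \<Rightarrow> 'w \<Rightarrow> bool" where
  "regular lam m \<omega> \<longleftrightarrow> (\<forall>n. real n \<le> lam * arrival_time \<tau> n \<omega> + m \<omega>) \<and> (\<forall>k\<ge>1. \<forall>i. 0 \<le> \<sigma> k i \<omega>)"

lemma AE_regular: "arrival_envelope lam m \<Longrightarrow> AE \<omega> in M. regular lam m \<omega>"
  using AE_service_nonneg unfolding arrival_envelope_def regular_def by auto

lemma T_mono_step: "regular lam m \<omega> \<Longrightarrow> T k \<omega> \<le> T (Suc k) \<omega>"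
  by (auto simp: regular_def completion_time.simps(2) intro!: sum_nonneg)

lemma T_nonneg: "regular lam m \<omega> \<Longrightarrow> 0 \<le> T k \<omega>"
  by (induction k) (auto intro: order_trans[OF _ T_mono_step])

lemma X_Suc_regular:
  assumes "regular lam m \<omega>" "0 \<le> lam"
  shows "real (X (Suc k) \<omega>) = real (num_arrivals \<tau> (T (Suc k) \<omega>) \<omega>) - real (num_arrivals \<tau> (T k \<omega>) \<omega>) + real (B (Suc k) (X k \<omega>) \<omega>)"
proof -
  have "num_arrivals \<tau> (T k \<omega>) \<omega> \<le> num_arrivals \<tau> (T (Suc k) \<omega>) \<omega>"
    using assms by (intro num_arrivals_mono[of lam \<tau> \<omega> "m \<omega>"] T_mono_step) (auto simp: regular_def)
  then show ?thesis by (simp add: queue_length.simps(2) of_nat_diff)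
qed

lemma num_arrivals_T_le:
  assumes "regular lam m \<omega>" "0 \<le> lam" "0 \<le> m \<omega>"
  shows "real (num_arrivals \<tau> (T k \<omega>) \<omega>) \<le> lam * T k \<omega> + m \<omega>"
  using assms T_nonneg[OF assms(1)] by (intro num_arrivals_le) (auto simp: regular_def)

text \<open>
  Sum the queue lengths instead of following them one by one. The arrivals telescope, so the sum \<open>Y\<close> up to turn
  \<open>k + 1\<close> is at most \<open>lam * T + m\<close> plus the returns. The mean of \<open>T\<close> is the mean service time
  times the number of services, and the mean number of returns is \<open>p\<close> times the mean of \<open>Y\<close> up to
  turn \<open>k\<close>. Hence the new mean of \<open>Y\<close> is at most \<open>lam * b + p\<close> times the old one plus a term that is linear
  in \<open>k\<close>, where \<open>b\<close> is the mean service time, and stability makes the factor at most 1.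
\<close>

lemma total_queue_mean_le:
  assumes env: "arrival_envelope lam m" and lam: "0 \<le> lam" "lam * (\<integral>s. s \<partial>G) + p \<le> 1"
    and \<mu>: "(\<integral>\<^sup>+\<omega>. ennreal (m \<omega>) \<partial>M) \<le> ennreal \<mu>" "0 \<le> \<mu>"
  shows "(\<integral>\<^sup>+\<omega>. ennreal (\<Sum>r=0..k. real (X r \<omega>)) \<partial>M) \<le> ennreal (real k * (lam * (\<integral>s. s \<partial>G) * real k + \<mu>))"
proof -
  define b where "b = (\<integral>s. s \<partial>G)"
  have "b > 0" using service_mean by (simp add: b_def)
  note AE_reg = AE_regular[OF env]
  define Y where "Y k \<omega> = (\<Sum>r=0..k. real (X r \<omega>))" for k \<omega>
  define R where "R k \<omega> = (\<Sum>r<k. real (B (Suc r) (X r \<omega>) \<omega>))" for k \<omega>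
  have [measurable]: "\<sigma> (Suc k) i \<in> borel_measurable M" for k i
    by (rule service_measurable) simp
  have B_meas [measurable]: "(\<lambda>\<omega>. B (Suc k) (X k \<omega>) \<omega>) \<in> measurable M (count_space UNIV)" for k
    by (rule measurable_compose_countable[OF _ X_measurable]) (auto intro: feedback_measurable)
  have [measurable]: "(\<lambda>\<omega>. \<Sum>i=0..X k \<omega>. ennreal (\<sigma> (Suc k) i \<omega>)) \<in> borel_measurable M" for k
    by (rule measurable_compose_countable[OF _ X_measurable]) measurable
  have m_meas [measurable]: "m \<in> borel_measurable M" and m_nonneg: "0 \<le> m \<omega>" for \<omega>
    using env measurable_info_events[OF _ arrivals_sources] unfolding arrival_envelope_def by auto
  define y where "y k = (\<integral>\<^sup>+\<omega>. ennreal (Y k \<omega>) \<partial>M)" for k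
  have Y_meas [measurable]: "Y k \<in> borel_measurable M" for k
    unfolding Y_def by measurable
  have Y_nonneg: "0 \<le> Y k \<omega>" for k \<omega> by (simp add: Y_def sum_nonneg)
  have Y_Suc: "y (Suc k) = y k + (\<integral>\<^sup>+\<omega>. ennreal (real (X (Suc k) \<omega>)) \<partial>M)" for k
    unfolding y_def by (subst nn_integral_add[symmetric]) (auto simp: Y_def sum_nonneg simp flip: ennreal_plus)
  have y0: "y 0 = 0" by (simp add: y_def Y_def)
  have T_mean: "(\<integral>\<^sup>+\<omega>. ennreal (T (Suc k) \<omega>) \<partial>M) = ennreal b * (of_nat (Suc k) + y k)" for k
  proof -
    have T_Suc: "(\<integral>\<^sup>+\<omega>. ennreal (T (Suc k) \<omega>) \<partial>M) = (\<integral>\<^sup>+\<omega>. ennreal (T k \<omega>) \<partial>M) + ennreal b * (1 + (\<integral>\<^sup>+\<omega>. ennreal (real (X k \<omega>)) \<partial>M))" for k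
    proof -
      have "(\<integral>\<^sup>+\<omega>. ennreal (T (Suc k) \<omega>) \<partial>M) = (\<integral>\<^sup>+\<omega>. ennreal (T k \<omega>) + (\<Sum>i=0..X k \<omega>. ennreal (\<sigma> (Suc k) i \<omega>)) \<partial>M)"
      proof (rule nn_integral_cong_AE, use AE_reg in eventually_elim)
        case (elim \<omega>)
        then have "\<And>i. 0 \<le> \<sigma> (Suc k) i \<omega>" by (simp add: regular_def)
        then show ?case
          using T_nonneg[OF elim] by (simp add: completion_time.simps(2) sum_nonneg)
      qed
      also have "\<dots> = (\<integral>\<^sup>+\<omega>. ennreal (T k \<omega>) \<partial>M) + ennreal b * (\<integral>\<^sup>+\<omega>. ennreal (1 + real (X k \<omega>)) \<partial>M)"
        by (subst nn_integral_add) (auto simp: nn_integral_fresh_sum b_def)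
      also have "(\<integral>\<^sup>+\<omega>. ennreal (1 + real (X k \<omega>)) \<partial>M) = 1 + (\<integral>\<^sup>+\<omega>. ennreal (real (X k \<omega>)) \<partial>M)"
        by (simp add: nn_integral_add emeasure_space_1)
      finally show ?thesis .
    qed
    show ?thesis
    proof (induction k)
      case 0
      then show ?case by (subst T_Suc) (simp add: y0)
    next
      case (Suc k)
      show ?case
        by (subst T_Suc, subst Suc) (simp only: Y_Suc of_nat_Suc distrib_left ac_simps)
    qed
  qed
  have R_mean: "(\<integral>\<^sup>+\<omega>. ennreal (R (Suc k) \<omega>) \<partial>M) = ennreal p * y k" for k
  proof -
    have R_Suc: "(\<integral>\<^sup>+\<omega>. ennreal (R (Suc k) \<omega>) \<partial>M) = (\<integral>\<^sup>+\<omega>. ennreal (R k \<omega>) \<partial>M) + ennreal p * (\<integral>\<^sup>+\<omega>. ennreal (real (X k \<omega>)) \<partial>M)" for k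
    proof -
      have "(\<integral>\<^sup>+\<omega>. ennreal (R (Suc k) \<omega>) \<partial>M) = (\<integral>\<^sup>+\<omega>. ennreal (R k \<omega>) + ennreal (real (B (Suc k) (X k \<omega>) \<omega>)) \<partial>M)"
        by (simp add: R_def sum_nonneg)
      also have "\<dots> = (\<integral>\<^sup>+\<omega>. ennreal (R k \<omega>) \<partial>M) + (\<integral>\<^sup>+\<omega>. ennreal (real (B (Suc k) (X k \<omega>) \<omega>)) \<partial>M)"
        unfolding R_def by (intro nn_integral_add) measurable
      finally show ?thesis by (simp add: nn_integral_fresh_feedback)
    qed
    show ?thesis
    proof (induction k)
      case 0
      then show ?case by (subst R_Suc) (simp add: y0 R_def)
    next
      case (Suc k)
      show ?case by (subst R_Suc, subst Suc) (simp add: Y_Suc distrib_left)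
    qed
  qed
  have Y_le: "Y k \<omega> \<le> lam * T k \<omega> + m \<omega> + R k \<omega>" if "regular lam m \<omega>" for k \<omega>
  proof -
    have "Y k \<omega> = real (num_arrivals \<tau> (T k \<omega>) \<omega>) + R k \<omega>"
    proof (induction k)
      case (Suc k)
      have "Y (Suc k) \<omega> = Y k \<omega> + real (X (Suc k) \<omega>)" by (simp add: Y_def)
      also have "real (X (Suc k) \<omega>) = real (num_arrivals \<tau> (T (Suc k) \<omega>) \<omega>) - real (num_arrivals \<tau> (T k \<omega>) \<omega>) + real (B (Suc k) (X k \<omega>) \<omega>)"
        by (rule X_Suc_regular[OF that lam(1)])
      finally show ?case using Suc by (simp add: R_def)
    qed (simp add: Y_def R_def)
    then show ?thesis
      using num_arrivals_T_le[OF that lam(1) m_nonneg] by simp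
  qed
  have y_step: "y (Suc k) \<le> y k + ennreal (lam * b * real (Suc k) + \<mu>)" for k
  proof -
    have [measurable]: "R j \<in> borel_measurable M" for j unfolding R_def by measurable
    have R_nonneg: "0 \<le> R j \<omega>" for j \<omega> by (simp add: R_def sum_nonneg)
    have "y (Suc k) \<le> (\<integral>\<^sup>+\<omega>. ennreal lam * ennreal (T (Suc k) \<omega>) + ennreal (m \<omega>) + ennreal (R (Suc k) \<omega>) \<partial>M)"
      unfolding y_def
    proof (rule nn_integral_mono_AE, use AE_reg in eventually_elim)
      case (elim \<omega>)
      have "ennreal (Y (Suc k) \<omega>) \<le> ennreal (lam * T (Suc k) \<omega> + m \<omega> + R (Suc k) \<omega>)"
        by (rule ennreal_leI[OF Y_le[OF elim]])
      also have "\<dots> = ennreal lam * ennreal (T (Suc k) \<omega>) + ennreal (m \<omega>) + ennreal (R (Suc k) \<omega>)"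
        using lam m_nonneg R_nonneg T_nonneg[OF elim] by (simp add: ennreal_mult ennreal_plus)
      finally show ?case .
    qed
    also have "\<dots> = ennreal lam * (\<integral>\<^sup>+\<omega>. ennreal (T (Suc k) \<omega>) \<partial>M) + (\<integral>\<^sup>+\<omega>. ennreal (m \<omega>) \<partial>M) + (\<integral>\<^sup>+\<omega>. ennreal (R (Suc k) \<omega>) \<partial>M)"
      using T_measurable[of "Suc k"] by (simp add: nn_integral_add nn_integral_cmult)
    also have "\<dots> = ennreal lam * (ennreal b * (of_nat (Suc k) + y k)) + (\<integral>\<^sup>+\<omega>. ennreal (m \<omega>) \<partial>M) + ennreal p * y k"
      unfolding T_mean R_mean ..
    also have "\<dots> \<le> ennreal lam * (ennreal b * (of_nat (Suc k) + y k)) + ennreal \<mu> + ennreal p * y k"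
      by (intro add_mono order_refl \<mu>)
    also have "\<dots> = ennreal (lam * b + p) * y k + ennreal (lam * b * real (Suc k) + \<mu>)"
      using lam \<open>b > 0\<close> p \<mu> by (simp add: ennreal_mult ennreal_plus distrib_left distrib_right ennreal_of_nat_eq_real_of_nat ac_simps)
    also have "\<dots> \<le> 1 * y k + ennreal (lam * b * real (Suc k) + \<mu>)"
      using lam by (intro add_mono mult_right_mono) (auto simp: b_def)
    finally show ?thesis by simp
  qed
  have "y k \<le> ennreal (real k * (lam * b * real k + \<mu>))"
  proof (induction k)
    case (Suc k)
    have "y (Suc k) \<le> ennreal (real k * (lam * b * real k + \<mu>)) + ennreal (lam * b * real (Suc k) + \<mu>)"
      using y_step[of k] Suc by (rule order_trans[OF _ add_right_mono])
    also have "\<dots> = ennreal (real k * (lam * b * real k + \<mu>) + (lam * b * real (Suc k) + \<mu>))"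
      using lam \<open>b > 0\<close> \<mu> by (intro ennreal_plus[symmetric]) auto
    also have "\<dots> \<le> ennreal (real (Suc k) * (lam * b * real (Suc k) + \<mu>))"
      using lam \<open>b > 0\<close> \<mu> by (intro ennreal_leI) (auto simp: algebra_simps)
    finally show ?case .
  qed (simp add: y0)
  then show ?thesis
    unfolding y_def Y_def b_def .
qed

lemma AE_visits_pos: "AE \<omega> in M. 1 \<le> K \<omega>"
proof -
  note visits_measurable [measurable]
  have "(\<lambda>n. prob {\<omega> \<in> space M. K \<omega> = Suc n}) sums prob (\<Union>n. {\<omega> \<in> space M. K \<omega> = Suc n})"
    by (rule finite_measure_UNION) (auto simp: disjoint_family_on_def)
  moreover have "(\<lambda>n. (1 - p) * p ^ n) sums ((1 - p) * (1 / (1 - p)))"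
    using p by (intro sums_mult geometric_sums) auto
  moreover have "prob {\<omega> \<in> space M. K \<omega> = Suc n} = (1 - p) * p ^ n" for n
    using visits_distr[of "Suc n"] by simp
  ultimately have "prob (\<Union>n. {\<omega> \<in> space M. K \<omega> = Suc n}) = 1"
    using p by (auto dest: sums_unique2)
  also have "(\<Union>n. {\<omega> \<in> space M. K \<omega> = Suc n}) = {\<omega> \<in> space M. 1 \<le> K \<omega>}"
    by (auto simp: Suc_le_eq gr0_conv_Suc)
  finally show ?thesis
    by (subst (asm) prob_Collect_eq_1) auto
qed

text \<open>
  The law of the number of visits is prescribed at positive values only; these already have total mass 1.
\<close>

lemma nn_integral_visits:
  "(\<integral>\<^sup>+\<omega>. f (K \<omega>) \<partial>M) = (\<Sum>n. ennreal ((1 - p) * p ^ n) * f (Suc n))"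
proof -
  note visits_measurable [measurable]
  have "(\<integral>\<^sup>+\<omega>. f (K \<omega>) \<partial>M) = (\<integral>\<^sup>+\<omega>. (\<Sum>n. f (Suc n) * indicator {\<omega> \<in> space M. K \<omega> = Suc n} \<omega>) \<partial>M)"
  proof (rule nn_integral_cong_AE, use AE_visits_pos AE_space in eventually_elim)
    case (elim \<omega>)
    then show ?case
      by (subst suminf_finite[of "{K \<omega> - 1}"]) (auto simp: indicator_def)
  qed
  also have "\<dots> = (\<Sum>n. \<integral>\<^sup>+\<omega>. f (Suc n) * indicator {\<omega> \<in> space M. K \<omega> = Suc n} \<omega> \<partial>M)"
    by (rule nn_integral_suminf) measurable
  also have "\<dots> = (\<Sum>n. ennreal ((1 - p) * p ^ n) * f (Suc n))"
    using visits_distr[of "Suc _"] by (intro suminf_cong, subst nn_integral_cmult_indicator) (auto simp: emeasure_eq_measure mult.commute)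
  finally show ?thesis .
qed

lemma nn_integral_at_visits:
  assumes H: "\<And>n. H n \<in> borel_measurable (info (history n))"
  shows "(\<integral>\<^sup>+\<omega>. H (K \<omega>) \<omega> \<partial>M) = (\<Sum>n. ennreal ((1 - p) * p ^ n) * (\<integral>\<^sup>+\<omega>. H (Suc n) \<omega> \<partial>M))"
proof -
  have "history n \<subseteq> sources - {Visits}" for n
    using history_sources[of n] by (auto simp: history_def arrivals_def)
  then have "H n \<in> borel_measurable (info (sources - {Visits}))" for n
    using H by (blast intro: measurable_info_mono)
  then have "(\<integral>\<^sup>+\<omega>. 1 * H (K \<omega>) \<omega> \<partial>M) = (\<integral>\<^sup>+\<omega>. 1 * (\<integral>\<^sup>+\<omega>'. H (K \<omega>) \<omega>' \<partial>M) \<partial>M)"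
    by (intro nn_integral_countable_index[where I = "{Visits}" and J = "sources - {Visits}" and N = K] visits_info)
       (auto simp: sources_def)
  then show ?thesis
    using nn_integral_visits[of "\<lambda>n. \<integral>\<^sup>+\<omega>'. H n \<omega>' \<partial>M"] by simp
qed

section \<open>Exponential moments in the absence of big jumps\<close>

definition no_jump :: "real \<Rightarrow> nat \<Rightarrow> 'w \<Rightarrow> bool" where
  "no_jump y n \<omega> \<longleftrightarrow> (\<forall>k. 1 \<le> k \<and> k \<le> n \<longrightarrow> (\<forall>i\<le>X (k - 1) \<omega>. \<sigma> k i \<omega> \<le> y))"

lemma service_history: "1 \<le> k \<Longrightarrow> k \<le> n \<Longrightarrow> \<sigma> k i \<in> borel_measurable (info (history n))"
  by (rule service_info) (auto simp: history_def)

lemma no_jump_info: "Measurable.pred (info (history n)) (no_jump y n)"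
proof -
  define Q where "Q k \<omega> \<longleftrightarrow> (1 \<le> k \<and> k \<le> n \<longrightarrow> (\<forall>i\<le>X (k - 1) \<omega>. \<sigma> k i \<omega> \<le> y))" for k \<omega>
  have [measurable]: "Measurable.pred (info (history n)) (Q k)" for k
  proof (cases "1 \<le> k \<and> k \<le> n")
    case True
    have [measurable]: "X (k - 1) \<in> measurable (info (history n)) (count_space UNIV)"
      using True by (intro X_info history_mono) auto
    have [measurable]: "\<sigma> k i \<in> borel_measurable (info (history n))" for i
      using True by (intro service_history) auto
    show ?thesis unfolding Q_def by measurable
  next
    case False
    then have "Q k = (\<lambda>_. True)" unfolding Q_def by (intro ext) blast
    then show ?thesis by simp
  qed
  have "Measurable.pred (info (history n)) (\<lambda>\<omega>. \<forall>k. Q k \<omega>)"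
    by measurable
  then show ?thesis
    unfolding Q_def no_jump_def [abs_def] .
qed

text \<open>
  For \<open>w t = exp (u * t)\<close> cut off above \<open>y\<close> this is \<open>exp (u * T k \<omega>)\<close> on the event that no service
  exceeds \<open>y\<close>, and 0 elsewhere.
\<close>

definition jump_weight :: "(real \<Rightarrow> real) \<Rightarrow> nat \<Rightarrow> 'w \<Rightarrow> real" where
  "jump_weight w k \<omega> = (\<Prod>r<k. \<Prod>i=0..X r \<omega>. w (\<sigma> (Suc r) i \<omega>))"

lemma jump_weight_info:
  assumes [measurable]: "w \<in> borel_measurable borel"
  shows "jump_weight w k \<in> borel_measurable (info (history k))"
  unfolding jump_weight_def [abs_def]
proof (rule borel_measurable_prod)
  fix r assume "r \<in> {..<k}"
  then have r: "r < k" by simp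
  have [measurable]: "\<sigma> (Suc r) i \<in> borel_measurable (info (history k))" for i
    using r by (intro service_history) auto
  have "(\<lambda>\<omega>. \<Prod>i=0..n. w (\<sigma> (Suc r) i \<omega>)) \<in> borel_measurable (info (history k))" for n
    by measurable
  from measurable_compose_countable[OF this X_info[OF history_mono]] r
  show "(\<lambda>\<omega>. \<Prod>i=0..X r \<omega>. w (\<sigma> (Suc r) i \<omega>)) \<in> borel_measurable (info (history k))"
    by simp
qed

lemma nn_integral_fresh_prod:
  assumes w [measurable]: "w \<in> borel_measurable borel"
  shows "(\<integral>\<^sup>+\<omega>. (\<Prod>i=0..n. w (\<sigma> (Suc k) i \<omega>)) * f (B (Suc k) j \<omega>) \<partial>M)
           = (\<integral>\<^sup>+s. w s \<partial>G) ^ Suc n * (\<integral>\<^sup>+l. f l \<partial>binomial_pmf j p :: ennreal)"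
proof -
  let ?S = "\<lambda>I. {Service (Suc k) i | i. i \<in> I}"
  have sub: "?S I \<subseteq> sources" for I by (auto simp: sources_def)
  have prod_info: "(\<lambda>\<omega>. \<Prod>i=0..n. w (\<sigma> (Suc k) i \<omega>)) \<in> borel_measurable (info (?S {0..n}))" for n
  proof (rule borel_measurable_prod_ennreal)
    fix i assume "i \<in> {0..n}"
    then have [measurable]: "\<sigma> (Suc k) i \<in> borel_measurable (info (?S {0..n}))"
      by (intro service_info) auto
    show "(\<lambda>\<omega>. w (\<sigma> (Suc k) i \<omega>)) \<in> borel_measurable (info (?S {0..n}))"
      by measurable
  qed
  have "(\<integral>\<^sup>+\<omega>. (\<Prod>i=0..n. w (\<sigma> (Suc k) i \<omega>)) \<partial>M) = (\<integral>\<^sup>+s. w s \<partial>G) ^ Suc n"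
  proof (induction n)
    case (Suc n)
    have [measurable]: "\<sigma> (Suc k) (Suc n) \<in> borel_measurable (info (?S {Suc n}))"
      by (intro service_info) auto
    have "(\<integral>\<^sup>+\<omega>. (\<Prod>i=0..n. w (\<sigma> (Suc k) i \<omega>)) * w (\<sigma> (Suc k) (Suc n) \<omega>) \<partial>M)
        = (\<integral>\<^sup>+\<omega>. (\<Prod>i=0..n. w (\<sigma> (Suc k) i \<omega>)) \<partial>M) * (\<integral>\<^sup>+\<omega>. w (\<sigma> (Suc k) (Suc n) \<omega>) \<partial>M)"
    proof (rule nn_integral_indep_info[OF prod_info _ _ sub sub])
      show "(\<lambda>\<omega>. w (\<sigma> (Suc k) (Suc n) \<omega>)) \<in> borel_measurable (info (?S {Suc n}))" by measurable
    qed auto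
    then show ?case
      by (simp add: Suc nn_integral_service mult_ac)
  qed (simp add: nn_integral_service)
  moreover have "(\<integral>\<^sup>+\<omega>. (\<Prod>i=0..n. w (\<sigma> (Suc k) i \<omega>)) * f (B (Suc k) j \<omega>) \<partial>M)
      = (\<integral>\<^sup>+\<omega>. (\<Prod>i=0..n. w (\<sigma> (Suc k) i \<omega>)) \<partial>M) * (\<integral>\<^sup>+\<omega>. f (B (Suc k) j \<omega>) \<partial>M)"
  proof (rule nn_integral_indep_info[OF prod_info _ _ sub])
    have "B (Suc k) j \<in> measurable (info {Feedback (Suc k)}) (count_space UNIV)"
      by (intro feedback_info) auto
    then show "(\<lambda>\<omega>. f (B (Suc k) j \<omega>)) \<in> borel_measurable (info {Feedback (Suc k)})"
      by (rule measurable_compose) simp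
  qed (auto simp: sources_def)
  ultimately show ?thesis
    by (simp add: nn_integral_feedback)
qed

text \<open>
  The Lyapunov function. Every customer behind the tagged one carries the weight \<open>exp \<theta>\<close>; subtracting the
  arrivals from the exponent turns the arrival process into a spectator, because the arrivals
  of a turn cancel against the increase of the queue length. What remains of one turn is a service and
  a feedback decision for each customer ahead, with factor at most
  \<open>\<phi> * (1 - p + p * exp \<theta>) \<le> exp \<theta>\<close>, which is paid by the weight of that customer, and the
  service of the tagged customer, which contributes the factor \<open>\<phi>\<close>.
\<close>

lemma weighted_exp_moment_le:
  assumes env: "arrival_envelope lam m" and lam: "0 \<le> lam"
    and w [measurable]: "w \<in> borel_measurable borel" and w_nonneg: "\<And>s. 0 \<le> w s"
    and \<phi>: "(\<integral>\<^sup>+s. ennreal (w s) \<partial>G) \<le> ennreal \<phi>" "0 \<le> \<phi>" "\<phi> * (1 - p + p * exp \<theta>) \<le> exp \<theta>"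
  shows "(\<integral>\<^sup>+\<omega>. ennreal (jump_weight w k \<omega> *
            exp (\<theta> * (real (X k \<omega>) - real (num_arrivals \<tau> (T k \<omega>) \<omega>) + m \<omega>))) \<partial>M)
           \<le> ennreal (\<phi> ^ k) * (\<integral>\<^sup>+\<omega>. ennreal (exp (\<theta> * m \<omega>)) \<partial>M)"
proof (induction k)
  case 0
  show ?case by (simp add: jump_weight_def)
next
  case (Suc k)
  let ?N = "\<lambda>k \<omega>. real (num_arrivals \<tau> (T k \<omega>) \<omega>)"
  define F where "F \<omega> = ennreal (jump_weight w k \<omega> * exp (\<theta> * (m \<omega> - ?N k \<omega>)))" for \<omega>
  define H where "H n \<omega> = (\<Prod>i=0..n. ennreal (w (\<sigma> (Suc k) i \<omega>))) * ennreal (exp (\<theta> * real (B (Suc k) n \<omega>)))" for n \<omega>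
  define \<beta> where "\<beta> = 1 - p + p * exp \<theta>"
  have "\<beta> \<ge> 0" using p by (simp add: \<beta>_def)
  have weight_nonneg: "0 \<le> jump_weight w j \<omega>" for j \<omega>
    unfolding jump_weight_def by (intro prod_nonneg ballI w_nonneg)
  note jump_weight_info[OF w, of k, measurable]
  have T_meas [measurable]: "T k \<in> borel_measurable (info (history k))"
    by (rule T_info) simp
  have [measurable]: "m \<in> borel_measurable (info (history k))"
    by (rule measurable_info_mono[OF _ arrivals_subset_history]) (use env in \<open>simp add: arrival_envelope_def\<close>)
  have [measurable]: "(\<lambda>\<omega>. num_arrivals \<tau> (T k \<omega>) \<omega>) \<in> measurable (info (history k)) (count_space UNIV)"
    by (intro num_arrivals_info arrivals_subset_history T_meas)
  have F_info: "F \<in> borel_measurable (info (history k))"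
    unfolding F_def by measurable
  have H_info: "H n \<in> borel_measurable (info (fresh k))" for n
    using service_fresh[measurable] feedback_fresh[measurable] unfolding H_def by measurable
  have "(\<integral>\<^sup>+\<omega>. ennreal (jump_weight w (Suc k) \<omega> * exp (\<theta> * (real (X (Suc k) \<omega>) - ?N (Suc k) \<omega> + m \<omega>))) \<partial>M)
      = (\<integral>\<^sup>+\<omega>. F \<omega> * H (X k \<omega>) \<omega> \<partial>M)"
  proof (rule nn_integral_cong_AE, use AE_regular[OF env] in eventually_elim)
    case (elim \<omega>)
    have "\<theta> * (real (X (Suc k) \<omega>) - ?N (Suc k) \<omega> + m \<omega>) = \<theta> * (m \<omega> - ?N k \<omega>) + \<theta> * real (B (Suc k) (X k \<omega>) \<omega>)"
      unfolding X_Suc_regular[OF elim lam] by (simp add: algebra_simps)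
    then show ?case
      unfolding F_def H_def using w_nonneg weight_nonneg[of k \<omega>]
      by (simp add: jump_weight_def exp_add ennreal_mult prod_ennreal prod_nonneg mult_ac)
  qed
  also have "\<dots> = (\<integral>\<^sup>+\<omega>. F \<omega> * (\<integral>\<^sup>+\<omega>'. H (X k \<omega>) \<omega>' \<partial>M) \<partial>M)"
    by (rule nn_integral_countable_index[OF F_info X_info[OF order_refl] H_info fresh_disjoint history_sources fresh_sources])
  also have "\<dots> \<le> (\<integral>\<^sup>+\<omega>. ennreal \<phi> * (F \<omega> * ennreal (exp (\<theta> * real (X k \<omega>)))) \<partial>M)"
  proof (rule nn_integral_mono)
    fix \<omega>
    have "(\<integral>\<^sup>+\<omega>'. H n \<omega>' \<partial>M) = (\<integral>\<^sup>+s. ennreal (w s) \<partial>G) ^ Suc n * ennreal (\<beta> ^ n)" for n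
      unfolding H_def \<beta>_def
      using nn_integral_fresh_prod[of "\<lambda>s. ennreal (w s)" k n "\<lambda>l. ennreal (exp (\<theta> * real l))" n] p
      by (simp add: nn_integral_binomial_pmf_mgf)
    also have "\<dots> n \<le> ennreal \<phi> ^ Suc n * ennreal (\<beta> ^ n)" for n
      using \<phi> by (intro mult_right_mono power_mono) auto
    also have "\<dots> n = ennreal (\<phi> * (\<phi> * \<beta>) ^ n)" for n
      using \<phi> \<open>\<beta> \<ge> 0\<close> by (simp add: ennreal_power power_mult_distrib mult.assoc flip: ennreal_mult)
    also have "\<dots> n \<le> ennreal (\<phi> * exp \<theta> ^ n)" for n
      using \<phi> \<open>\<beta> \<ge> 0\<close> by (intro ennreal_leI mult_left_mono power_mono) (auto simp: \<beta>_def)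
    finally have "(\<integral>\<^sup>+\<omega>'. H (X k \<omega>) \<omega>' \<partial>M) \<le> ennreal (\<phi> * exp \<theta> ^ X k \<omega>)" .
    then have "F \<omega> * (\<integral>\<^sup>+\<omega>'. H (X k \<omega>) \<omega>' \<partial>M) \<le> F \<omega> * ennreal (\<phi> * exp \<theta> ^ X k \<omega>)"
      by (rule mult_left_mono) simp
    also have "\<dots> = ennreal \<phi> * (F \<omega> * ennreal (exp (\<theta> * real (X k \<omega>))))"
      using \<phi> by (simp add: ennreal_mult exp_of_nat2_mult mult_ac)
    finally show "F \<omega> * (\<integral>\<^sup>+\<omega>'. H (X k \<omega>) \<omega>' \<partial>M) \<le> ennreal \<phi> * (F \<omega> * ennreal (exp (\<theta> * real (X k \<omega>))))" .
  qed
  also have "\<dots> = ennreal \<phi> * (\<integral>\<^sup>+\<omega>. F \<omega> * ennreal (exp (\<theta> * real (X k \<omega>))) \<partial>M)"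
    by (intro nn_integral_cmult borel_measurable_times_ennreal measurable_info_events[OF F_info history_sources]
          measurable_compose[OF X_measurable]) simp
  also have "(\<integral>\<^sup>+\<omega>. F \<omega> * ennreal (exp (\<theta> * real (X k \<omega>))) \<partial>M)
      = (\<integral>\<^sup>+\<omega>. ennreal (jump_weight w k \<omega> * exp (\<theta> * (real (X k \<omega>) - ?N k \<omega> + m \<omega>))) \<partial>M)"
    using weight_nonneg unfolding F_def
    by (intro nn_integral_cong) (simp add: algebra_simps exp_add exp_diff flip: ennreal_mult)
  also have "ennreal \<phi> * \<dots> \<le> ennreal \<phi> * (ennreal (\<phi> ^ k) * (\<integral>\<^sup>+\<omega>. ennreal (exp (\<theta> * m \<omega>)) \<partial>M))"
    by (intro mult_left_mono Suc) auto
  finally show ?case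
    using \<phi> by (simp add: ennreal_mult mult.assoc)
qed

text \<open>
  The envelope converts the subtracted arrivals into time: at the end of turn \<open>k\<close> they
  cost at most \<open>\<theta> * (lam * T k + m)\<close> in the exponent, which leaves the rate \<open>s\<close> from \<open>s + \<theta> * lam\<close>.
\<close>

lemma exp_moment_no_jump_le:
  assumes env: "arrival_envelope lam m" and lam: "0 \<le> lam" and "0 \<le> \<theta>"
    and \<phi>: "(\<integral>\<^sup>+t. ennreal (if t \<le> y then exp ((s + \<theta> * lam) * t) else 0) \<partial>G) \<le> ennreal \<phi>"
      "0 \<le> \<phi>" "\<phi> * (1 - p + p * exp \<theta>) \<le> exp \<theta>"
  shows "(\<integral>\<^sup>+\<omega>. (if no_jump y k \<omega> then ennreal (exp (s * T k \<omega>)) else 0) \<partial>M)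
           \<le> ennreal (\<phi> ^ k) * (\<integral>\<^sup>+\<omega>. ennreal (exp (\<theta> * m \<omega>)) \<partial>M)"
proof -
  define u where "u = s + \<theta> * lam"
  define w where "w t = (if t \<le> y then exp (u * t) else 0)" for t
  have "(\<integral>\<^sup>+\<omega>. (if no_jump y k \<omega> then ennreal (exp (s * T k \<omega>)) else 0) \<partial>M)
      \<le> (\<integral>\<^sup>+\<omega>. ennreal (jump_weight w k \<omega> * exp (\<theta> * (real (X k \<omega>) - real (num_arrivals \<tau> (T k \<omega>) \<omega>) + m \<omega>))) \<partial>M)"
  proof (rule nn_integral_mono_AE, use AE_regular[OF env] in eventually_elim)
    case (elim \<omega>)
    show ?case
    proof (cases "no_jump y k \<omega>")
      case True
      have small: "\<sigma> (Suc r) i \<omega> \<le> y" if "r < k" "i \<le> X r \<omega>" for r i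
        using True that unfolding no_jump_def by (auto dest: spec[of _ "Suc r"])
      have T_eq: "T k \<omega> = (\<Sum>r<k. \<Sum>i=0..X r \<omega>. \<sigma> (Suc r) i \<omega>)" for k
        by (induction k) (auto simp: completion_time.simps(2))
      have "jump_weight w k \<omega> = (\<Prod>r<k. \<Prod>i=0..X r \<omega>. exp (u * \<sigma> (Suc r) i \<omega>))"
        unfolding jump_weight_def w_def using small by (intro prod.cong refl) auto
      also have "\<dots> = exp (u * T k \<omega>)"
        by (simp add: T_eq exp_sum sum_distrib_left)
      finally have weight: "jump_weight w k \<omega> = exp (u * T k \<omega>)" .
      have "real (num_arrivals \<tau> (T k \<omega>) \<omega>) \<le> lam * T k \<omega> + m \<omega>"
        using env by (intro num_arrivals_T_le[OF elim lam]) (auto simp: arrival_envelope_def)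
      then have "0 \<le> \<theta> * (lam * T k \<omega> + real (X k \<omega>) - real (num_arrivals \<tau> (T k \<omega>) \<omega>) + m \<omega>)"
        using \<open>0 \<le> \<theta>\<close> by (intro mult_nonneg_nonneg) auto
      then have "s * T k \<omega> \<le> u * T k \<omega> + \<theta> * (real (X k \<omega>) - real (num_arrivals \<tau> (T k \<omega>) \<omega>) + m \<omega>)"
        by (simp add: u_def algebra_simps)
      then show ?thesis
        using True by (simp add: weight ennreal_leI flip: exp_add)
    qed simp
  qed
  also have "\<dots> \<le> ennreal (\<phi> ^ k) * (\<integral>\<^sup>+\<omega>. ennreal (exp (\<theta> * m \<omega>)) \<partial>M)"
  proof (rule weighted_exp_moment_le[OF env lam])
    show "w \<in> borel_measurable borel"
      unfolding w_def by measurable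
    show "(\<integral>\<^sup>+t. ennreal (w t) \<partial>G) \<le> ennreal \<phi>"
      using \<phi>(1) unfolding w_def u_def .
  qed (use \<phi> in \<open>auto simp: w_def\<close>)
  finally show ?thesis .
qed

text \<open>
  The geometric number of turns absorbs a factor \<open>1 + v\<close> per turn as long as \<open>p * (1 + v)\<close> stays away from 1.
\<close>

lemma exp_moment_sojourn_no_jump_le:
  assumes env: "arrival_envelope lam m" and lam: "0 \<le> lam" and "0 \<le> \<theta>"
    and v: "(\<integral>\<^sup>+t. ennreal (if t \<le> y then exp ((s + \<theta> * lam) * t) else 0) \<partial>G) \<le> ennreal (1 + v)"
      "0 \<le> v" "2 * p * v \<le> 1 - p" "(1 + v) * (1 - p + p * exp \<theta>) \<le> exp \<theta>"
  shows "(\<integral>\<^sup>+\<omega>. (if no_jump y (K \<omega>) \<omega> then ennreal (exp (s * T (K \<omega>) \<omega>)) else 0) \<partial>M)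
           \<le> ennreal (1 + 2 / (1 - p) * v) * (\<integral>\<^sup>+\<omega>. ennreal (exp (\<theta> * m \<omega>)) \<partial>M)"
proof -
  let ?W = "\<integral>\<^sup>+\<omega>. ennreal (exp (\<theta> * m \<omega>)) \<partial>M"
  define r where "r = p * (1 + v)"
  have r: "0 \<le> r" "r < 1" using p v by (auto simp: r_def algebra_simps)
  have "(\<integral>\<^sup>+\<omega>. (if no_jump y (K \<omega>) \<omega> then ennreal (exp (s * T (K \<omega>) \<omega>)) else 0) \<partial>M)
      = (\<Sum>n. ennreal ((1 - p) * p ^ n) * (\<integral>\<^sup>+\<omega>. (if no_jump y (Suc n) \<omega> then ennreal (exp (s * T (Suc n) \<omega>)) else 0) \<partial>M))"
  proof (rule nn_integral_at_visits[where H = "\<lambda>n \<omega>. (if no_jump y n \<omega> then ennreal (exp (s * T n \<omega>)) else 0)"])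
    fix n
    have [measurable]: "T n \<in> borel_measurable (info (history n))" "Measurable.pred (info (history n)) (no_jump y n)"
      by (auto intro: T_info no_jump_info)
    show "(\<lambda>\<omega>. (if no_jump y n \<omega> then ennreal (exp (s * T n \<omega>)) else 0)) \<in> borel_measurable (info (history n))"
      by measurable
  qed
  also have "\<dots> \<le> (\<Sum>n. ennreal ((1 - p) * p ^ n) * (ennreal ((1 + v) ^ Suc n) * ?W))"
  proof (intro suminf_le mult_left_mono)
    fix n
    show "(\<integral>\<^sup>+\<omega>. (if no_jump y (Suc n) \<omega> then ennreal (exp (s * T (Suc n) \<omega>)) else 0) \<partial>M) \<le> ennreal ((1 + v) ^ Suc n) * ?W"
      using v by (intro exp_moment_no_jump_le[OF env lam \<open>0 \<le> \<theta>\<close>]) simp_all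
  qed simp_all
  also have "\<dots> = (\<Sum>n. ennreal ((1 - p) * (1 + v) * r ^ n) * ?W)"
  proof (rule suminf_cong)
    fix n
    have "(1 - p) * (1 + v) * r ^ n = ((1 - p) * p ^ n) * (1 + v) ^ Suc n"
      by (simp add: r_def power_mult_distrib)
    then show "ennreal ((1 - p) * p ^ n) * (ennreal ((1 + v) ^ Suc n) * ?W) = ennreal ((1 - p) * (1 + v) * r ^ n) * ?W"
      using p v by (simp only: ennreal_mult mult.assoc) (simp add: ennreal_mult mult.assoc)
  qed
  also have "\<dots> = ennreal (\<Sum>n. (1 - p) * (1 + v) * r ^ n) * ?W"
  proof -
    have "summable (\<lambda>n. (1 - p) * (1 + v) * r ^ n)"
      using r by (intro summable_mult summable_geometric) simp
    then have "(\<Sum>n. ennreal ((1 - p) * (1 + v) * r ^ n)) = ennreal (\<Sum>n. (1 - p) * (1 + v) * r ^ n)"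
      using p v r by (intro suminf_ennreal2) auto
    then show ?thesis by simp
  qed
  also have "(\<Sum>n. (1 - p) * (1 + v) * r ^ n) = (1 - p) * (1 + v) / (1 - r)"
    using r by (subst suminf_mult) (auto intro!: summable_geometric simp: suminf_geometric)
  also have "\<dots> \<le> 1 + 2 / (1 - p) * v"
  proof -
    have "(1 - p) / 2 \<le> 1 - r"
      using v by (simp add: r_def distrib_left)
    have "(1 - p) * (1 + v) / (1 - r) = 1 + v / (1 - r)"
      using r by (simp add: field_simps) (simp add: r_def algebra_simps)
    also have "v / (1 - r) \<le> v / ((1 - p) / 2)"
      using \<open>(1 - p) / 2 \<le> 1 - r\<close> v p by (intro divide_left_mono) auto
    finally show ?thesis by (simp add: field_simps)
  qed
  finally show ?thesis
    by (simp add: mult_right_mono ennreal_leI)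
qed

end

section \<open>Counting the services of a sojourn\<close>

lemma summable_quadratic_geometric:
  fixes p a b c :: real
  assumes "0 < p" "p < 1"
  shows "summable (\<lambda>n. a * p ^ n * (real (Suc n) + real n * (b * real n + c)))"
proof (rule summable_comparison_test_bigo)
  define r where "r = sqrt p"
  have r: "0 < r" "r < 1" "p = r\<^sup>2"
    using assms by (auto simp: r_def)
  show "summable (\<lambda>n. norm (r ^ n))"
    using r by (auto intro: summable_geometric)
  have 1: "(\<lambda>n. r ^ n * real (Suc n)) \<in> O(\<lambda>n. 1)" "(\<lambda>n. r ^ n * real n) \<in> O(\<lambda>n. 1)" "(\<lambda>n. r ^ n * (real n)\<^sup>2) \<in> O(\<lambda>n. 1)"
    using r by real_asymp+
  have "(\<lambda>n. r ^ n * (a * (r ^ n * real (Suc n)) + a * b * (r ^ n * (real n)\<^sup>2) + a * c * (r ^ n * real n))) \<in> O(\<lambda>n. r ^ n * 1)"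
    using 1 by (intro landau_o.big.mult landau_o.big_refl sum_in_bigo) auto
  then show "(\<lambda>n. a * p ^ n * (real (Suc n) + real n * (b * real n + c))) \<in> O(\<lambda>n. r ^ n)"
    by (simp add: r(3) power2_eq_square power_mult_distrib algebra_simps)
qed

lemma countable_jump_indices: "countable jump_indices"
  by (rule countableI_type)

context feedback_queue
begin

text \<open>
  The indices realised by \<open>\<omega>\<close>: one for every service that takes place during the sojourn of the
  tagged customer, including its own services (\<open>i = 0\<close>). The pair \<open>(k, i)\<close> determines \<open>l\<close> and \<open>j\<close>.
\<close>

definition positions :: "'w \<Rightarrow> (nat \<times> nat \<times> nat \<times> nat) set" where
  "positions \<omega> = {(k, l, j, i). (k, l, j, i) \<in> jump_indices \<and> K \<omega> = k + l \<and> X (k - 1) \<omega> = j}"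

definition position_count :: "(nat \<Rightarrow> nat \<Rightarrow> 'w \<Rightarrow> bool) \<Rightarrow> 'w \<Rightarrow> nat" where
  "position_count Q \<omega> = card {(k, l, j, i). (k, l, j, i) \<in> positions \<omega> \<and> Q k i \<omega>}"

lemma positions_eq: "positions \<omega> = (\<lambda>(r, i). (Suc r, K \<omega> - Suc r, X r \<omega>, i)) ` (SIGMA r:{..<K \<omega>}. {..X r \<omega>})"
proof (intro subset_antisym subsetI)
  fix idx assume idx: "idx \<in> positions \<omega>"
  obtain k l j i where [simp]: "idx = (k, l, j, i)" by (cases idx)
  from idx show "idx \<in> (\<lambda>(r, i). (Suc r, K \<omega> - Suc r, X r \<omega>, i)) ` (SIGMA r:{..<K \<omega>}. {..X r \<omega>})"
    by (intro image_eqI[of _ _ "(k - 1, i)"]) (auto simp: positions_def jump_indices_def)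
qed (auto simp: positions_def jump_indices_def)

lemma finite_positions [simp]: "finite (positions \<omega>)"
  unfolding positions_eq by auto

lemma finite_positions_subset [simp]: "finite {(k, l, j, i). (k, l, j, i) \<in> positions \<omega> \<and> P k l j i}"
  by (rule finite_subset[OF _ finite_positions[of \<omega>]]) auto

lemma position_count_True: "position_count (\<lambda>_ _ _. True) \<omega> = (\<Sum>r<K \<omega>. 1 + X r \<omega>)"
proof -
  have "position_count (\<lambda>_ _ _. True) \<omega> = card (positions \<omega>)"
    unfolding position_count_def by (rule arg_cong[where f = card]) auto
  also have "\<dots> = card (SIGMA r:{..<K \<omega>}. {..X r \<omega>})"
    unfolding positions_eq by (intro card_image inj_onI) auto
  finally show ?thesis by simp
qed

lemma position_count_mono:
  "(\<And>k i. Q k i \<omega> \<Longrightarrow> R k i \<omega>) \<Longrightarrow> position_count Q \<omega> \<le> position_count R \<omega>"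
  unfolding position_count_def by (intro card_mono) auto

lemma position_count_pos_iff:
  "0 < position_count Q \<omega> \<longleftrightarrow> (\<exists>k i. 1 \<le> k \<and> k \<le> K \<omega> \<and> i \<le> X (k - 1) \<omega> \<and> Q k i \<omega>)"
proof -
  have "0 < position_count Q \<omega> \<longleftrightarrow> {(k, l, j, i). (k, l, j, i) \<in> positions \<omega> \<and> Q k i \<omega>} \<noteq> {}"
    unfolding position_count_def by (subst card_gt_0_iff) simp
  also have "\<dots> \<longleftrightarrow> (\<exists>k i. 1 \<le> k \<and> k \<le> K \<omega> \<and> i \<le> X (k - 1) \<omega> \<and> Q k i \<omega>)"
    unfolding positions_def jump_indices_def by (auto simp: le_iff_add)
  finally show ?thesis .
qed

lemma no_jump_iff: "no_jump y (K \<omega>) \<omega> \<longleftrightarrow> position_count (\<lambda>k i \<omega>. y < \<sigma> k i \<omega>) \<omega> = 0"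
proof -
  have "position_count (\<lambda>k i \<omega>. y < \<sigma> k i \<omega>) \<omega> = 0 \<longleftrightarrow> \<not> 0 < position_count (\<lambda>k i \<omega>. y < \<sigma> k i \<omega>) \<omega>"
    by simp
  also have "\<dots> \<longleftrightarrow> no_jump y (K \<omega>) \<omega>"
    unfolding position_count_pos_iff no_jump_def by (auto simp: not_less)
  finally show ?thesis by simp
qed

lemma nn_integral_position_count:
  assumes Q: "\<And>k i. 1 \<le> k \<Longrightarrow> Measurable.pred M (Q k i)"
  shows "(\<integral>\<^sup>+\<omega>. of_nat (position_count Q \<omega>) \<partial>M)
    = (\<integral>\<^sup>+(k, l, j, i). emeasure M {\<omega> \<in> space M. K \<omega> = k + l \<and> X (k - 1) \<omega> = j \<and> Q k i \<omega>} \<partial>count_space jump_indices)"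
    (is "_ = (\<integral>\<^sup>+idx. ?e idx \<partial>_)")
    and position_count_measurable: "position_count Q \<in> measurable M (count_space UNIV)"
proof -
  note visits_measurable [measurable]
  define A where "A = (\<lambda>(k, l, j, i). {\<omega> \<in> space M. K \<omega> = k + l \<and> X (k - 1) \<omega> = j \<and> Q k i \<omega>})"
  have A_sets: "A idx \<in> events" if "idx \<in> jump_indices" for idx
  proof -
    obtain k l j i where [simp]: "idx = (k, l, j, i)" by (cases idx)
    have [measurable]: "Measurable.pred M (Q k i)"
      using that by (intro Q) (auto simp: jump_indices_def)
    show ?thesis unfolding A_def by simp
  qed
  have count: "of_nat (position_count Q \<omega>) = (\<integral>\<^sup>+idx. indicator (A idx) \<omega> \<partial>count_space jump_indices)"
    if "\<omega> \<in> space M" for \<omega>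
  proof -
    let ?S = "{(k, l, j, i). (k, l, j, i) \<in> positions \<omega> \<and> Q k i \<omega>}"
    have "(\<integral>\<^sup>+idx. indicator (A idx) \<omega> \<partial>count_space jump_indices) = (\<integral>\<^sup>+idx. indicator ?S idx \<partial>count_space jump_indices)"
      using that by (intro nn_integral_cong) (auto simp: A_def positions_def indicator_def split: prod.splits)
    also have "\<dots> = emeasure (count_space jump_indices) ?S"
      by (intro nn_integral_indicator) (auto simp: positions_def)
    also have "\<dots> = of_nat (card ?S)"
      by (intro emeasure_count_space_finite finite_positions_subset) (auto simp: positions_def)
    finally show ?thesis by (simp add: position_count_def)
  qed
  interpret C: sigma_finite_measure "count_space jump_indices"
    by (rule sigma_finite_measure_count_space_countable[OF countable_jump_indices])
  interpret P: pair_sigma_finite "count_space jump_indices" M ..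
  have meas: "(\<lambda>(idx, \<omega>). indicator (A idx) \<omega> :: ennreal) \<in> borel_measurable (count_space jump_indices \<Otimes>\<^sub>M M)"
    using A_sets by (intro measurable_pair_measure_countable1 countable_jump_indices) auto
  have "(\<integral>\<^sup>+\<omega>. of_nat (position_count Q \<omega>) \<partial>M) = (\<integral>\<^sup>+\<omega>. (\<integral>\<^sup>+idx. indicator (A idx) \<omega> \<partial>count_space jump_indices) \<partial>M)"
    by (intro nn_integral_cong count)
  also have "\<dots> = (\<integral>\<^sup>+idx. (\<integral>\<^sup>+\<omega>. indicator (A idx) \<omega> \<partial>M) \<partial>count_space jump_indices)"
    using P.Fubini'[OF meas] by simp
  also have "\<dots> = (\<integral>\<^sup>+idx. ?e idx \<partial>count_space jump_indices)"
    using A_sets by (intro nn_integral_cong) (auto simp: A_def)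
  finally show "(\<integral>\<^sup>+\<omega>. of_nat (position_count Q \<omega>) \<partial>M) = (\<integral>\<^sup>+idx. ?e idx \<partial>count_space jump_indices)" .
  have "(\<lambda>\<omega>. \<integral>\<^sup>+idx. indicator (A idx) \<omega> \<partial>count_space jump_indices) \<in> borel_measurable M"
    using measurable_pair_swap[OF meas] by (intro C.borel_measurable_nn_integral) simp
  then have m: "(\<lambda>\<omega>. of_nat (position_count Q \<omega>) :: ennreal) \<in> borel_measurable M"
    by (rule measurable_cong[THEN iffD1, rotated]) (simp add: count)
  show "position_count Q \<in> measurable M (count_space UNIV)"
  proof (subst measurable_count_space_eq2_countable, safe)
    fix n
    have "position_count Q -` {n} \<inter> space M = {\<omega> \<in> space M. (of_nat (position_count Q \<omega>) :: ennreal) = of_nat n}"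
      by auto
    also have "\<dots> \<in> events" using m by measurable
    finally show "position_count Q -` {n} \<inter> space M \<in> events" .
  qed auto
qed

text \<open>
  The sources that precede service \<open>i\<close> of turn \<open>k\<close> in the lexicographic order, together with the arrival
  process and the number of visits. The order within a turn is a convention: in time, the tagged customer
  (\<open>i = 0\<close>) is served last.
\<close>

definition before :: "nat \<Rightarrow> nat \<Rightarrow> source set" where
  "before k i = {Visits} \<union> history (k - 1) \<union> {Service k i' | i'. i' < i}"

lemma before_sources: "1 \<le> k \<Longrightarrow> before k i \<subseteq> sources"
  using history_sources[of "k - 1"] by (auto simp: before_def sources_def)

text \<open>
  A service time is independent of the number of visits and of everything that precedes it; in particular, it is
  independent of the event that this service takes place during the sojourn.
\<close>

lemma emeasure_position_jump:
  assumes k: "1 \<le> k" and R: "Measurable.pred (info (before k i)) R" and S: "S \<in> sets borel"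
  shows "emeasure M {\<omega> \<in> space M. K \<omega> = k + l \<and> X (k - 1) \<omega> = j \<and> R \<omega> \<and> \<sigma> k i \<omega> \<in> S}
    = emeasure G S * emeasure M {\<omega> \<in> space M. K \<omega> = k + l \<and> X (k - 1) \<omega> = j \<and> R \<omega>}"
proof -
    let ?E = "{\<omega>. K \<omega> = k + l \<and> X (k - 1) \<omega> = j \<and> R \<omega>}"
    have [measurable]: "K \<in> measurable (info (before k i)) (count_space UNIV)"
      "X (k - 1) \<in> measurable (info (before k i)) (count_space UNIV)"
      by (intro visits_info X_info; auto simp: before_def)+
    note R [measurable] service_measurable[OF k, measurable] S [measurable]
    have E_info: "indicator ?E \<in> borel_measurable (info (before k i))"
      by (rule borel_measurable_indicator') measurable
    have [measurable]: "\<sigma> k i \<in> borel_measurable (info {Service k i})"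
      by (rule service_info) simp
    have meas: "(indicator ?E :: 'w \<Rightarrow> ennreal) \<in> borel_measurable M"
      using measurable_info_events[OF E_info before_sources[OF k]] .
    then have E_sets: "{\<omega> \<in> space M. \<omega> \<in> ?E} \<in> events"
      by (subst (asm) borel_measurable_indicator_iff) (simp add: Int_def conj_commute)
    have "emeasure M {\<omega> \<in> space M. K \<omega> = k + l \<and> X (k - 1) \<omega> = j \<and> R \<omega> \<and> \<sigma> k i \<omega> \<in> S}
        = (\<integral>\<^sup>+\<omega>. indicator ({\<omega> \<in> space M. \<omega> \<in> ?E} \<inter> (\<sigma> k i -` S \<inter> space M)) \<omega> \<partial>M)"
      using E_sets measurable_sets[OF service_measurable[OF k] S]
      by (subst nn_integral_indicator) (auto intro!: arg_cong[where f = "emeasure M"])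
    also have "\<dots> = (\<integral>\<^sup>+\<omega>. indicator ?E \<omega> * indicator S (\<sigma> k i \<omega>) \<partial>M)"
      by (intro nn_integral_cong) (auto split: split_indicator)
    also have "\<dots> = (\<integral>\<^sup>+\<omega>. indicator ?E \<omega> \<partial>M) * (\<integral>\<^sup>+\<omega>. indicator S (\<sigma> k i \<omega>) \<partial>M)"
    proof (rule nn_integral_indep_info[OF E_info _ _ before_sources[OF k]])
      show "(\<lambda>\<omega>. indicator S (\<sigma> k i \<omega>)) \<in> borel_measurable (info {Service k i})"
        by measurable
    qed (use k in \<open>auto simp: before_def history_def arrivals_def sources_def\<close>)
    also have "(\<integral>\<^sup>+\<omega>. indicator S (\<sigma> k i \<omega>) \<partial>M) = emeasure G S"
      using nn_integral_service[OF k, of "indicator S" i] S by simp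
    also have "(\<integral>\<^sup>+\<omega>. indicator ?E \<omega> \<partial>M) = (\<integral>\<^sup>+\<omega>. indicator {\<omega> \<in> space M. \<omega> \<in> ?E} \<omega> \<partial>M)"
      by (intro nn_integral_cong) (auto split: split_indicator)
    also have "\<dots> = emeasure M {\<omega> \<in> space M. \<omega> \<in> ?E}"
      using E_sets by (rule nn_integral_indicator)
    finally show ?thesis by (simp add: mult.commute)
qed

lemma nn_integral_position_count_jump:
  assumes Q: "\<And>k i. 1 \<le> k \<Longrightarrow> Measurable.pred (info (before k i)) (Q k i)" and S: "S \<in> sets borel"
  shows "(\<integral>\<^sup>+\<omega>. of_nat (position_count (\<lambda>k i \<omega>. Q k i \<omega> \<and> \<sigma> k i \<omega> \<in> S) \<omega>) \<partial>M)
    = emeasure G S * (\<integral>\<^sup>+\<omega>. of_nat (position_count Q \<omega>) \<partial>M)"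
proof -
  have QM: "Measurable.pred M (Q k i)" if "1 \<le> k" for k i
    using measurable_info_events[OF Q before_sources] that by blast
  have QSM: "Measurable.pred M (\<lambda>\<omega>. Q k i \<omega> \<and> \<sigma> k i \<omega> \<in> S)" if "1 \<le> k" for k i
  proof -
    note QM[OF that, measurable] service_measurable[OF that, measurable] S [measurable]
    show ?thesis by measurable
  qed
  have "emeasure M {\<omega> \<in> space M. K \<omega> = k + l \<and> X (k - 1) \<omega> = j \<and> Q k i \<omega> \<and> \<sigma> k i \<omega> \<in> S}
      = emeasure G S * emeasure M {\<omega> \<in> space M. K \<omega> = k + l \<and> X (k - 1) \<omega> = j \<and> Q k i \<omega>}"
    if k: "1 \<le> k" for k l j i
    by (rule emeasure_position_jump[OF k Q[OF k] S])
  then have "(\<integral>\<^sup>+\<omega>. of_nat (position_count (\<lambda>k i \<omega>. Q k i \<omega> \<and> \<sigma> k i \<omega> \<in> S) \<omega>) \<partial>M)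
    = (\<integral>\<^sup>+idx. emeasure G S * (case idx of (k, l, j, i) \<Rightarrow> emeasure M {\<omega> \<in> space M. K \<omega> = k + l \<and> X (k - 1) \<omega> = j \<and> Q k i \<omega>}) \<partial>count_space jump_indices)"
    by (subst nn_integral_position_count[OF QSM]) (auto intro!: nn_integral_cong simp: jump_indices_def)
  also have "\<dots> = emeasure G S * (\<integral>\<^sup>+\<omega>. of_nat (position_count Q \<omega>) \<partial>M)"
    by (subst nn_integral_cmult) (auto simp: nn_integral_position_count[OF QM])
  finally show ?thesis .
qed

text \<open>
  The arrival rate may be raised slightly without spoiling a strict bound on the load. This is the price of
  the envelope.
\<close>

lemma arrival_rate_slack:
  assumes "load A G p < \<rho>'"
  obtains lam where "1 / (\<integral>t. t \<partial>A) < lam" "0 < lam" "lam * (\<integral>s. s \<partial>G) / (1 - p) < \<rho>'"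
proof -
  let ?a = "\<integral>t. t \<partial>A" and ?b = "\<integral>s. s \<partial>G"
  have ab: "?a > 0" "?b > 0" using interarrival_mean service_mean by auto
  have "1 / ?a < \<rho>' * (1 - p) / ?b"
    using assms ab p by (simp add: load_def field_simps)
  then obtain lam where lam: "1 / ?a < lam" "lam < \<rho>' * (1 - p) / ?b"
    using dense by blast
  show ?thesis
  proof (rule that[OF lam(1)])
    show "0 < lam" using lam(1) ab by (smt (verit) divide_pos_pos)
    show "lam * ?b / (1 - p) < \<rho>'" using lam(2) ab p by (simp add: field_simps)
  qed
qed

text \<open>
  The mean number of services within \<open>n\<close> turns is polynomial in \<open>n\<close>, and the number of turns is geometric.
\<close>

lemma position_count_integrable:
  assumes stable: "load A G p < 1"
  shows "integrable M (\<lambda>\<omega>. real (position_count (\<lambda>_ _ _. True) \<omega>))"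
proof -
  let ?b = "\<integral>s. s \<partial>G"
  obtain lam where lam: "1 / (\<integral>t. t \<partial>A) < lam" "0 < lam" "lam * ?b / (1 - p) < 1"
    using arrival_rate_slack[OF stable] .
  obtain m \<theta>0 c where env: "arrival_envelope lam m" and \<theta>0: "\<theta>0 > 0" and c: "c \<ge> 0"
    and mom: "\<And>\<theta>. 0 \<le> \<theta> \<Longrightarrow> \<theta> \<le> \<theta>0 \<Longrightarrow> (\<integral>\<^sup>+\<omega>. ennreal (exp (\<theta> * m \<omega>)) \<partial>M) \<le> ennreal (1 + c * \<theta>)"
    using arrival_envelope_exists[OF lam(1)] by blast
  define \<mu> where "\<mu> = 1 / \<theta>0 * (1 + c * \<theta>0)"
  have [measurable]: "m \<in> borel_measurable M"
    using env measurable_info_events[OF _ arrivals_sources] by (auto simp: arrival_envelope_def)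
  have "(\<integral>\<^sup>+\<omega>. ennreal (m \<omega>) \<partial>M) \<le> (\<integral>\<^sup>+\<omega>. ennreal (1 / \<theta>0) * ennreal (exp (\<theta>0 * m \<omega>)) \<partial>M)"
  proof (intro nn_integral_mono)
    fix \<omega>
    have "\<theta>0 * m \<omega> \<le> exp (\<theta>0 * m \<omega>)"
      using exp_ge_add_one_self[of "\<theta>0 * m \<omega>"] by linarith
    then have "m \<omega> \<le> 1 / \<theta>0 * exp (\<theta>0 * m \<omega>)"
      using \<theta>0 by (simp add: field_simps)
    then show "ennreal (m \<omega>) \<le> ennreal (1 / \<theta>0) * ennreal (exp (\<theta>0 * m \<omega>))"
      using \<theta>0 by (simp add: ennreal_leI flip: ennreal_mult)
  qed
  also have "\<dots> \<le> ennreal (1 / \<theta>0) * ennreal (1 + c * \<theta>0)"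
    using \<theta>0 by (subst nn_integral_cmult) (auto intro!: mult_left_mono mom)
  also have "\<dots> = ennreal \<mu>"
    unfolding \<mu>_def using \<theta>0 c by (intro ennreal_mult[symmetric]) auto
  finally have \<mu>: "(\<integral>\<^sup>+\<omega>. ennreal (m \<omega>) \<partial>M) \<le> ennreal \<mu>" .
  have "\<mu> \<ge> 0" using \<theta>0 c by (simp add: \<mu>_def)
  have "?b > 0" by (rule service_mean)
  have drift: "lam * ?b + p \<le> 1" using lam p by (simp add: field_simps)
  define f where "f n = (1 - p) * p ^ n * (real (Suc n) + real n * (lam * ?b * real n + \<mu>))" for n
  have f_nonneg: "0 \<le> f n" for n
    using p lam \<open>\<mu> \<ge> 0\<close> \<open>?b > 0\<close> by (simp add: f_def)
  have "summable f"
    unfolding f_def using p by (intro summable_quadratic_geometric)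
  have "(\<integral>\<^sup>+\<omega>. of_nat (position_count (\<lambda>_ _ _. True) \<omega>) \<partial>M) = (\<integral>\<^sup>+\<omega>. ennreal (\<Sum>r<K \<omega>. 1 + real (X r \<omega>)) \<partial>M)"
    by (simp add: position_count_True ennreal_of_nat_eq_real_of_nat)
  also have "\<dots> = (\<Sum>n. ennreal ((1 - p) * p ^ n) * (\<integral>\<^sup>+\<omega>. ennreal (\<Sum>r<Suc n. 1 + real (X r \<omega>)) \<partial>M))"
  proof (rule nn_integral_at_visits[where H = "\<lambda>n \<omega>. ennreal (\<Sum>r<n. 1 + real (X r \<omega>))"])
    fix n
    have "(\<lambda>\<omega>. 1 + real (X r \<omega>)) \<in> borel_measurable (info (history n))" if "r < n" for r
      using that by (intro measurable_compose[OF X_info[OF history_mono]]) auto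
    then have "(\<lambda>\<omega>. \<Sum>r<n. 1 + real (X r \<omega>)) \<in> borel_measurable (info (history n))"
      by (intro borel_measurable_sum) simp
    then show "(\<lambda>\<omega>. ennreal (\<Sum>r<n. 1 + real (X r \<omega>))) \<in> borel_measurable (info (history n))"
      by (rule measurable_compose) simp
  qed
  also have "\<dots> \<le> (\<Sum>n. ennreal (f n))"
  proof (intro suminf_le)
    fix n
    have "(\<integral>\<^sup>+\<omega>. ennreal (\<Sum>r<Suc n. 1 + real (X r \<omega>)) \<partial>M) = (\<integral>\<^sup>+\<omega>. ennreal (real (Suc n)) + ennreal (\<Sum>r=0..n. real (X r \<omega>)) \<partial>M)"
    proof (rule nn_integral_cong)
      fix \<omega>
      have "(\<Sum>r<Suc n. 1 + real (X r \<omega>)) = real (Suc n) + (\<Sum>r=0..n. real (X r \<omega>))"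
        by (simp only: sum.distrib lessThan_Suc_atMost atMost_atLeast0) simp
      then show "ennreal (\<Sum>r<Suc n. 1 + real (X r \<omega>)) = ennreal (real (Suc n)) + ennreal (\<Sum>r=0..n. real (X r \<omega>))"
        by (simp only:) (intro ennreal_plus sum_nonneg, auto)
    qed
    also have "\<dots> = ennreal (real (Suc n)) + (\<integral>\<^sup>+\<omega>. ennreal (\<Sum>r=0..n. real (X r \<omega>)) \<partial>M)"
      by (subst nn_integral_add) (auto simp: emeasure_space_1)
    also have "\<dots> \<le> ennreal (real (Suc n)) + ennreal (real n * (lam * ?b * real n + \<mu>))"
      using lam \<mu> \<open>\<mu> \<ge> 0\<close> drift by (intro add_left_mono total_queue_mean_le[OF env]) auto
    also have "\<dots> = ennreal (real (Suc n) + real n * (lam * ?b * real n + \<mu>))"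
      using lam \<open>\<mu> \<ge> 0\<close> \<open>?b > 0\<close> by (intro ennreal_plus[symmetric]) auto
    finally have "ennreal ((1 - p) * p ^ n) * (\<integral>\<^sup>+\<omega>. ennreal (\<Sum>r<Suc n. 1 + real (X r \<omega>)) \<partial>M)
        \<le> ennreal ((1 - p) * p ^ n) * ennreal (real (Suc n) + real n * (lam * ?b * real n + \<mu>))"
      by (rule mult_left_mono) simp
    also have "\<dots> = ennreal (f n)"
      unfolding f_def using p lam \<open>\<mu> \<ge> 0\<close> \<open>?b > 0\<close> by (intro ennreal_mult[symmetric]) auto
    finally show "ennreal ((1 - p) * p ^ n) * (\<integral>\<^sup>+\<omega>. ennreal (\<Sum>r<Suc n. 1 + real (X r \<omega>)) \<partial>M) \<le> ennreal (f n)" .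
  qed auto
  also have "\<dots> = ennreal (\<Sum>n. f n)"
    by (intro suminf_ennreal2 f_nonneg \<open>summable f\<close>)
  also have "\<dots> < \<infinity>" by simp
  finally have fin: "(\<integral>\<^sup>+\<omega>. of_nat (position_count (\<lambda>_ _ _. True) \<omega>) \<partial>M) < \<infinity>" .
  have [measurable]: "position_count (\<lambda>_ _ _. True) \<in> measurable M (count_space UNIV)"
    by (rule position_count_measurable) simp
  show ?thesis
    using fin by (intro integrableI_nonneg) (auto simp: ennreal_of_nat_eq_real_of_nat)
qed

section \<open>Sojourns without a big service time\<close>

lemma sojourn_measurable [measurable]: "(\<lambda>\<omega>. T (K \<omega>) \<omega>) \<in> borel_measurable M"
  by (rule measurable_compose_countable[OF T_measurable visits_measurable])

lemma service_gt_measurable: "1 \<le> k \<Longrightarrow> Measurable.pred M (\<lambda>\<omega>. z < \<sigma> k i \<omega>)"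
proof -
  assume "1 \<le> k"
  note service_measurable[OF this, measurable]
  show ?thesis by measurable
qed

lemma no_jump_visits_measurable [measurable]: "Measurable.pred M (\<lambda>\<omega>. no_jump y (K \<omega>) \<omega>)"
proof -
  have [measurable]: "position_count (\<lambda>k i \<omega>. y < \<sigma> k i \<omega>) \<in> measurable M (count_space UNIV)"
    by (intro position_count_measurable service_gt_measurable)
  show ?thesis
    unfolding no_jump_iff by measurable
qed

lemma integrable_position_count:
  assumes stable: "load A G p < 1" and Q: "\<And>k i. 1 \<le> k \<Longrightarrow> Measurable.pred M (Q k i)"
  shows "integrable M (\<lambda>\<omega>. real (position_count Q \<omega>))"
proof (rule Bochner_Integration.integrable_bound[OF position_count_integrable[OF stable]])
  have [measurable]: "position_count Q \<in> measurable M (count_space UNIV)"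
    by (intro position_count_measurable Q)
  show "(\<lambda>\<omega>. real (position_count Q \<omega>)) \<in> borel_measurable M" by measurable
qed (auto intro!: position_count_mono)

lemma integral_position_count_jump:
  assumes stable: "load A G p < 1"
    and Q: "\<And>k i. 1 \<le> k \<Longrightarrow> Measurable.pred (info (before k i)) (Q k i)" and S: "S \<in> sets borel"
  shows "(\<integral>\<omega>. real (position_count (\<lambda>k i \<omega>. Q k i \<omega> \<and> \<sigma> k i \<omega> \<in> S) \<omega>) \<partial>M)
    = measure G S * (\<integral>\<omega>. real (position_count Q \<omega>) \<partial>M)"
proof -
  have QM: "Measurable.pred M (Q k i)" if "1 \<le> k" for k i
    using measurable_info_events[OF Q before_sources] that by blast
  have QSM: "Measurable.pred M (\<lambda>\<omega>. Q k i \<omega> \<and> \<sigma> k i \<omega> \<in> S)" if "1 \<le> k" for k i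
  proof -
    note QM[OF that, measurable] service_measurable[OF that, measurable] S [measurable]
    show ?thesis by measurable
  qed
  have "ennreal (\<integral>\<omega>. real (position_count (\<lambda>k i \<omega>. Q k i \<omega> \<and> \<sigma> k i \<omega> \<in> S) \<omega>) \<partial>M)
      = ennreal (measure G S) * ennreal (\<integral>\<omega>. real (position_count Q \<omega>) \<partial>M)"
    using nn_integral_position_count_jump[OF Q S]
      nn_integral_eq_integral[OF integrable_position_count[OF stable QM]]
      nn_integral_eq_integral[OF integrable_position_count[OF stable QSM]]
    by (simp add: ennreal_of_nat_eq_real_of_nat service.emeasure_eq_measure)
  then show ?thesis
    by (subst (asm) ennreal_mult[symmetric]) auto
qed

lemma load_pos: "0 < load A G p"
  using interarrival_mean service_mean p by (simp add: load_def)

text \<open>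
  Let \<open>v\<close> be the tail exponent at \<open>y\<close>, and split it as \<open>v = s + \<theta> * lam\<close> with \<open>s = c * v\<close>. To first
  order in \<open>v\<close>, the drift condition of the Lyapunov function is \<open>v * b < \<theta> * (1 - p)\<close> with \<open>b\<close> the mean service time, that is,
  the load at rate \<open>lam\<close> is below \<open>1 - c\<close>. This is where the critical constant \<open>1 - \<rho>\<close> comes from.
  The exponential moment without jumps is at least \<open>exp (s * x) - 1\<close> times the probability in question
  plus the probability of having no jump. The latter differs from 1 by \<open>O(tail G y)\<close>, so that only the
  excess of the moment over 1 remains.
\<close>

lemma no_big_jump_bound:
  assumes irv: "intermediate_regularly_varying G" and stable: "load A G p < 1"
    and c: "0 < c" "c < 1 - load A G p"
  obtains C where "C \<ge> 0"
    "eventually (\<lambda>y. \<forall>x>0. (exp (c * service.tail_exponent y * x) - 1) *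
        prob {\<omega> \<in> space M. x < T (K \<omega>) \<omega> \<and> no_jump y (K \<omega>) \<omega>} \<le> C * service.tail_exponent y) at_top"
proof -
  let ?b = "\<integral>s. s \<partial>G"
  have "load A G p < 1 - c" using c by simp
  then obtain lam where lam: "1 / (\<integral>t. t \<partial>A) < lam" "0 < lam" "lam * ?b / (1 - p) < 1 - c"
    using arrival_rate_slack by blast
  obtain m \<theta>0 c0 where env: "arrival_envelope lam m" and \<theta>0: "\<theta>0 > 0" and c0: "c0 \<ge> 0"
    and mom: "\<And>\<theta>. 0 \<le> \<theta> \<Longrightarrow> \<theta> \<le> \<theta>0 \<Longrightarrow> (\<integral>\<^sup>+\<omega>. ennreal (exp (\<theta> * m \<omega>)) \<partial>M) \<le> ennreal (1 + c0 * \<theta>)"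
    using arrival_envelope_exists[OF lam(1)] by blast
  define \<kappa> where "\<kappa> = (1 - c) / lam"
  have "c < 1" using c load_pos by simp
  then have "\<kappa> > 0" using lam by (simp add: \<kappa>_def)
  have "?b < \<kappa> * (1 - p)"
    using lam p by (simp add: \<kappa>_def field_simps)
  then obtain b' where b': "?b < b'" "b' < \<kappa> * (1 - p)"
    using dense by blast
  have "b' > 0" using b' service_mean by simp
  define u where "u = service.tail_exponent"
  note u_lim = service.tail_exponent_asymptotics[OF irv service_mean(1), folded u_def]
  define \<nu> where "\<nu> = (\<integral>\<omega>. real (position_count (\<lambda>_ _ _. True) \<omega>) \<partial>M)"
  have "\<nu> \<ge> 0" by (simp add: \<nu>_def)
  define d where "d = 2 / (1 - p) * b'"
  have "d \<ge> 0" using p \<open>b' > 0\<close> by (simp add: d_def)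
  define C where "C = d + c0 * \<kappa> + d * (c0 * \<kappa>) + \<nu>"
  have small: "eventually (\<lambda>y. a * u y < e) at_top" if "e > 0" for a e
    using tendsto_mult[OF tendsto_const u_lim(2), of a] that by (intro order_tendstoD(2)) auto
  have ev1: "eventually (\<lambda>y. 1 \<le> y * u y) at_top"
    using u_lim(1) by (simp add: filterlim_at_top)
  have ev2: "eventually (\<lambda>y. (\<integral>\<^sup>+s. ennreal (if s \<le> y then exp (u y * s) else 0) \<partial>G) \<le> ennreal (1 + u y * b')) at_top"
    unfolding u_def by (rule service.truncated_exp_moment_le[OF irv service_mean(1) service_nonneg b'(1)])
  have ev3: "eventually (\<lambda>y. (2 * p * b') * u y < 1 - p) at_top" "eventually (\<lambda>y. \<kappa> * u y < \<theta>0) at_top"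
    "eventually (\<lambda>y. \<kappa> * u y < 1) at_top" "eventually (\<lambda>y. 1 * u y < 1) at_top"
    "eventually (\<lambda>y. (p * \<kappa>\<^sup>2) * u y < \<kappa> * (1 - p) - b') at_top"
    using p \<theta>0 b' by (intro small; simp)+
  have "eventually (\<lambda>y. \<forall>x>0. (exp (c * u y * x) - 1) *
        prob {\<omega> \<in> space M. x < T (K \<omega>) \<omega> \<and> no_jump y (K \<omega>) \<omega>} \<le> C * u y) at_top"
    using eventually_gt_at_top[of 0] ev1 ev2 ev3
  proof eventually_elim
    case (elim y)
    have bound: "(exp (c * u y * x) - 1) * prob {\<omega> \<in> space M. x < T (K \<omega>) \<omega> \<and> no_jump y (K \<omega>) \<omega>} \<le> C * u y" if "0 < x" for x
    proof -
      define v where "v = u y"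
      define s where "s = c * v"
      define \<theta> where "\<theta> = \<kappa> * v"
      have "v > 0" using elim by (smt (verit) v_def zero_less_mult_pos)
      have "s > 0" using \<open>v > 0\<close> c by (simp add: s_def)
      have \<theta>: "0 < \<theta>" "\<theta> < \<theta>0" "\<theta> < 1" using elim \<open>v > 0\<close> \<open>\<kappa> > 0\<close> by (auto simp: \<theta>_def v_def)
      have sv: "s + \<theta> * lam = v" using lam by (simp add: s_def \<theta>_def \<kappa>_def field_simps)
      \<comment> \<open>The drift condition to second order, by \<open>exp \<theta> - 1 \<le> \<theta> + \<theta>\<^sup>2\<close>.\<close>
      have sub: "(1 + v * b') * (1 - p + p * exp \<theta>) \<le> exp \<theta>"
      proof -
        have "1 + v * b' \<le> exp (v * b')" by (rule exp_ge_add_one_self)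
        moreover have "1 - p + p * exp \<theta> \<le> exp (p * (exp \<theta> - 1))"
          using exp_ge_add_one_self[of "p * (exp \<theta> - 1)"] by (simp add: algebra_simps)
        ultimately have "(1 + v * b') * (1 - p + p * exp \<theta>) \<le> exp (v * b') * exp (p * (exp \<theta> - 1))"
          using p \<open>v > 0\<close> \<open>b' > 0\<close> by (intro mult_mono) auto
        also have "\<dots> = exp (v * b' + p * (exp \<theta> - 1))" by (simp add: exp_add)
        also have "\<dots> \<le> exp \<theta>"
        proof -
          have "exp \<theta> - 1 \<le> \<theta> + \<theta>\<^sup>2"
            using exp_bound[of \<theta>] \<theta> by simp
          then have "v * b' + p * (exp \<theta> - 1) \<le> v * b' + p * (\<theta> + \<theta>\<^sup>2)"
            using p by simp
          also have "\<dots> = v * (b' + p * \<kappa> + p * \<kappa>\<^sup>2 * v)"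
            by (simp add: \<theta>_def algebra_simps power2_eq_square)
          also have "\<dots> \<le> v * \<kappa>"
            using elim \<open>v > 0\<close> by (intro mult_left_mono) (auto simp: v_def algebra_simps)
          finally show ?thesis by (simp add: \<theta>_def mult.commute)
        qed
        finally show ?thesis .
      qed
      let ?NJ = "{\<omega> \<in> space M. no_jump y (K \<omega>) \<omega>}" and ?E = "{\<omega> \<in> space M. x < T (K \<omega>) \<omega> \<and> no_jump y (K \<omega>) \<omega>}"
      have "ennreal ((exp (s * x) - 1) * prob ?E + prob ?NJ) = ennreal (exp (s * x) - 1) * emeasure M ?E + emeasure M ?NJ"
        using \<open>s > 0\<close> \<open>0 < x\<close> by (simp add: emeasure_eq_measure ennreal_mult ennreal_plus)
      also have "\<dots> = (\<integral>\<^sup>+\<omega>. ennreal (exp (s * x) - 1) * indicator ?E \<omega> + indicator ?NJ \<omega> \<partial>M)"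
        by (simp add: nn_integral_add nn_integral_cmult)
      also have "\<dots> \<le> (\<integral>\<^sup>+\<omega>. (if no_jump y (K \<omega>) \<omega> then ennreal (exp (s * T (K \<omega>) \<omega>)) else 0) \<partial>M)"
      proof (rule nn_integral_mono_AE, use AE_regular[OF env] in eventually_elim)
        case (elim \<omega>)
        have "0 \<le> T (K \<omega>) \<omega>" by (rule T_nonneg[OF elim])
        show ?case
        proof (cases "no_jump y (K \<omega>) \<omega> \<and> \<omega> \<in> space M")
          case True
          show ?thesis
          proof (cases "x < T (K \<omega>) \<omega>")
            case gt: True
            have "ennreal (exp (s * x) - 1) + 1 = ennreal (exp (s * x))"
              using \<open>s > 0\<close> \<open>0 < x\<close> by (subst ennreal_1[symmetric], subst ennreal_plus[symmetric]) auto
            also have "\<dots> \<le> ennreal (exp (s * T (K \<omega>) \<omega>))"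
              using gt \<open>s > 0\<close> by (intro ennreal_leI) simp
            finally show ?thesis using True gt by simp
          next
            case False
            then show ?thesis
              using True \<open>0 \<le> T (K \<omega>) \<omega>\<close> \<open>s > 0\<close> by simp
          qed
        qed (auto simp: indicator_def)
      qed
      also have "\<dots> \<le> ennreal (1 + 2 / (1 - p) * (v * b')) * (\<integral>\<^sup>+\<omega>. ennreal (exp (\<theta> * m \<omega>)) \<partial>M)"
      proof (rule exp_moment_sojourn_no_jump_le[OF env])
        show "(\<integral>\<^sup>+t. ennreal (if t \<le> y then exp ((s + \<theta> * lam) * t) else 0) \<partial>G) \<le> ennreal (1 + v * b')"
          unfolding sv using elim by (simp only: v_def)
        show "2 * p * (v * b') \<le> 1 - p" using elim by (simp add: v_def mult_ac)
      qed (use lam \<theta> \<open>v > 0\<close> \<open>b' > 0\<close> sub in auto)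
      also have "\<dots> \<le> ennreal (1 + 2 / (1 - p) * (v * b')) * ennreal (1 + c0 * \<theta>)"
        using \<theta> by (intro mult_left_mono mom) auto
      also have "\<dots> = ennreal ((1 + d * v) * (1 + c0 * \<kappa> * v))"
      proof -
        have "2 / (1 - p) * (v * b') = d * v" "c0 * \<theta> = c0 * \<kappa> * v"
          by (simp_all add: d_def \<theta>_def)
        then show ?thesis
          using \<open>d \<ge> 0\<close> \<open>v > 0\<close> c0 \<open>\<kappa> > 0\<close> by (simp only:) (intro ennreal_mult[symmetric], auto)
      qed
      finally have "(exp (s * x) - 1) * prob ?E + prob ?NJ \<le> (1 + d * v) * (1 + c0 * \<kappa> * v)"
        by (rule ennreal_le_iff[THEN iffD1, rotated]) (use \<open>d \<ge> 0\<close> \<open>v > 0\<close> c0 \<open>\<kappa> > 0\<close> in auto)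
      also have "\<dots> = 1 + (d + c0 * \<kappa>) * v + d * (c0 * \<kappa>) * (v * v)"
        by (simp add: algebra_simps)
      also have "\<dots> \<le> 1 + (d + c0 * \<kappa>) * v + d * (c0 * \<kappa>) * (v * 1)"
        using \<open>d \<ge> 0\<close> \<open>v > 0\<close> c0 \<open>\<kappa> > 0\<close> elim by (intro add_left_mono mult_left_mono) (auto simp: v_def)
      finally have main: "(exp (s * x) - 1) * prob ?E + prob ?NJ \<le> 1 + (d + c0 * \<kappa> + d * (c0 * \<kappa>)) * v"
        by (simp add: algebra_simps)
      have "1 - prob ?NJ \<le> \<nu> * v"
      proof -
        have J: "Measurable.pred M (\<lambda>\<omega>. y < \<sigma> k i \<omega>)" if "1 \<le> k" for k i
          by (rule service_gt_measurable[OF that])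
        have int: "integrable M (\<lambda>\<omega>. real (position_count (\<lambda>k i \<omega>. y < \<sigma> k i \<omega>) \<omega>))"
          by (rule integrable_position_count[OF stable J])
        have "1 - prob ?NJ = prob (space M - ?NJ)"
          by (rule prob_compl[symmetric]) measurable
        also have "space M - ?NJ = {\<omega> \<in> space M. \<not> no_jump y (K \<omega>) \<omega>}" by auto
        also have "prob \<dots> = (\<integral>\<omega>. indicator {\<omega> \<in> space M. \<not> no_jump y (K \<omega>) \<omega>} \<omega> \<partial>M)"
          by simp
        also have "\<dots> \<le> (\<integral>\<omega>. real (position_count (\<lambda>k i \<omega>. y < \<sigma> k i \<omega>) \<omega>) \<partial>M)"
        proof (rule integral_mono[OF _ int])
          show "integrable M (indicator {\<omega> \<in> space M. \<not> no_jump y (K \<omega>) \<omega>} :: 'w \<Rightarrow> real)"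
            by (intro integrable_real_indicator) (auto simp: emeasure_eq_measure)
        qed (auto simp: no_jump_iff indicator_def)
        also have "\<dots> = tail G y * \<nu>"
          using integral_position_count_jump[OF stable, of "\<lambda>_ _ _. True" "{y<..}"]
          by (simp add: \<nu>_def service.tail_eq_measure)
        also have "tail G y \<le> v"
        proof -
          have "tail G y > 0" using irv by (simp add: intermediate_regularly_varying_def)
          then have "exp (v * y) * tail G y = 1 / y"
            unfolding v_def u_def using elim by (intro service.tail_exponent_exp) auto
          moreover have "1 * tail G y \<le> exp (v * y) * tail G y"
            using \<open>v > 0\<close> elim \<open>tail G y > 0\<close> by (intro mult_right_mono) auto
          moreover have "1 / y \<le> v" using elim by (simp add: v_def field_simps)
          ultimately show ?thesis by simp
        qed
        finally show ?thesis using \<open>\<nu> \<ge> 0\<close> by (simp add: mult.commute mult_right_mono)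
      qed
      with main show ?thesis
        by (simp add: C_def s_def v_def algebra_simps)
    qed
    then show ?case by blast
  qed
  moreover have "C \<ge> 0"
    using \<open>d \<ge> 0\<close> c0 \<open>\<kappa> > 0\<close> \<open>\<nu> \<ge> 0\<close> by (simp add: C_def)
  ultimately show ?thesis
    using that unfolding u_def by blast
qed

text \<open>
  With \<open>y = \<delta> * x\<close>, \<open>L = y * tail_exponent y\<close> and \<open>r = c / \<delta> > 1\<close>, the bound relative to \<open>tail G y\<close> is a multiple of
  \<open>L * exp L / (exp (r * L) - 1)\<close>, and \<open>L\<close> tends to infinity.
\<close>

lemma no_big_jump_negligible:
  assumes irv: "intermediate_regularly_varying G" and stable: "load A G p < 1"
    and \<delta>: "0 < \<delta>" "\<delta> < 1 - load A G p"
  shows "((\<lambda>x. prob {\<omega> \<in> space M. x < T (K \<omega>) \<omega> \<and> no_jump (\<delta> * x) (K \<omega>) \<omega>} / tail G x) \<longlongrightarrow> 0) at_top"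
proof -
  obtain c where c: "\<delta> < c" "c < 1 - load A G p"
    using \<delta> dense by blast
  then have "0 < c" using \<delta> by simp
  define u where "u = service.tail_exponent"
  define P where "P x y = prob {\<omega> \<in> space M. x < T (K \<omega>) \<omega> \<and> no_jump y (K \<omega>) \<omega>}" for x y
  obtain C where C: "C \<ge> 0" "eventually (\<lambda>y. \<forall>x>0. (exp (c * u y * x) - 1) * P x y \<le> C * u y) at_top"
    using no_big_jump_bound[OF irv stable \<open>0 < c\<close> c(2)] unfolding u_def P_def by blast
  obtain D where D: "D > 0" "eventually (\<lambda>x. tail G (\<delta> * x) \<le> D * tail G x) at_top"
    using service.irv_tail_dominated[OF irv \<delta>(1)] by blast
  note u_lim = service.tail_exponent_asymptotics[OF irv service_mean(1), folded u_def]
  have pos: "tail G x > 0" for x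
    using irv by (simp add: intermediate_regularly_varying_def)
  define r where "r = c / \<delta>"
  have "r > 1" using c \<delta> by (simp add: r_def)
  define h where "h L = L * exp L / (exp (r * L) - 1)" for L :: real
  have "(h \<longlongrightarrow> 0) at_top"
    unfolding h_def using \<open>r > 1\<close> by real_asymp
  then have h_lim: "((\<lambda>y. h (y * u y)) \<longlongrightarrow> 0) at_top"
    by (rule filterlim_compose[OF _ u_lim(1)])
  have scale: "filterlim (\<lambda>x. \<delta> * x) at_top at_top"
    using \<delta> by real_asymp
  have "eventually (\<lambda>y. P (y / \<delta>) y \<le> C * h (y * u y) * tail G y) at_top"
    using C(2) eventually_gt_at_top[of 0] filterlim_at_top_dense[THEN iffD1, OF u_lim(1), rule_format, of 0]
  proof eventually_elim
    case (elim y)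
    have L: "c * u y * (y / \<delta>) = r * (y * u y)" by (simp add: r_def)
    have "0 < r * (y * u y)" using elim \<open>r > 1\<close> by simp
    then have e: "0 < exp (r * (y * u y)) - 1" by simp
    have "(exp (r * (y * u y)) - 1) * P (y / \<delta>) y \<le> C * u y"
      using elim \<delta> L by (metis divide_pos_pos)
    then have "P (y / \<delta>) y \<le> C * u y / (exp (r * (y * u y)) - 1)"
      using e by (simp add: field_simps)
    also have "C * u y = C * (y * u y * exp (y * u y) * tail G y)"
    proof -
      have "exp (y * u y) * tail G y = 1 / y"
        using service.tail_exponent_exp[of y] elim pos[of y] by (simp add: u_def mult.commute)
      then show ?thesis using elim by (simp add: mult.assoc)
    qed
    finally show ?case by (simp add: h_def mult_ac)
  qed
  from eventually_compose_filterlim[OF this scale]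
  have "eventually (\<lambda>x. P x (\<delta> * x) \<le> C * h (\<delta> * x * u (\<delta> * x)) * tail G (\<delta> * x)) at_top"
    using \<delta> by simp
  moreover have "eventually (\<lambda>x. 0 \<le> h (\<delta> * x * u (\<delta> * x))) at_top"
    using eventually_compose_filterlim[OF filterlim_at_top_dense[THEN iffD1, OF u_lim(1), rule_format, of 0] scale]
    by eventually_elim (use \<open>r > 1\<close> in \<open>simp add: h_def\<close>)
  ultimately have upper: "eventually (\<lambda>x. P x (\<delta> * x) / tail G x \<le> C * D * h (\<delta> * x * u (\<delta> * x))) at_top"
    using D(2)
  proof eventually_elim
    case (elim x)
    have "P x (\<delta> * x) \<le> C * h (\<delta> * x * u (\<delta> * x)) * (D * tail G x)"
      using elim C(1) by (intro order_trans[OF elim(1)] mult_left_mono) auto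
    then show ?case using pos[of x] by (simp add: field_simps)
  qed
  have "((\<lambda>x. C * D * h (\<delta> * x * u (\<delta> * x))) \<longlongrightarrow> C * D * 0) at_top"
    by (intro tendsto_mult tendsto_const filterlim_compose[OF h_lim scale])
  then have lim: "((\<lambda>x. C * D * h (\<delta> * x * u (\<delta> * x))) \<longlongrightarrow> 0) at_top" by simp
  have "((\<lambda>x. P x (\<delta> * x) / tail G x) \<longlongrightarrow> 0) at_top"
  proof (rule tendsto_sandwich[OF _ upper tendsto_const lim])
    show "eventually (\<lambda>x. 0 \<le> P x (\<delta> * x) / tail G x) at_top"
      using pos by (auto simp: P_def less_imp_le)
  qed
  then show ?thesis by (simp add: P_def)
qed

section \<open>The principle of a single big jump\<close>

text \<open>
  The order is that of \<open>before\<close>, so that the event does not involve \<open>\<sigma> k i\<close> itself.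
\<close>

definition earlier_jump :: "real \<Rightarrow> nat \<Rightarrow> nat \<Rightarrow> 'w \<Rightarrow> bool" where
  "earlier_jump z k i \<omega> \<longleftrightarrow>
     (\<exists>k' i'. 1 \<le> k' \<and> (k' < k \<or> k' = k \<and> i' < i) \<and> i' \<le> X (k' - 1) \<omega> \<and> z < \<sigma> k' i' \<omega>)"

lemma earlier_jump_info: "1 \<le> k \<Longrightarrow> Measurable.pred (info (before k i)) (earlier_jump z k i)"
proof -
  define Q where "Q k' i' \<omega> \<longleftrightarrow> 1 \<le> k' \<and> (k' < k \<or> k' = k \<and> i' < i) \<and> i' \<le> X (k' - 1) \<omega> \<and> z < \<sigma> k' i' \<omega>" for k' i' \<omega>
  have [measurable]: "Measurable.pred (info (before k i)) (Q k' i')" for k' i'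
  proof (cases "1 \<le> k' \<and> (k' < k \<or> k' = k \<and> i' < i)")
    case True
    have "history (k' - 1) \<subseteq> before k i"
    proof -
      have "k' - 1 \<le> k - 1" using True by auto
      then have "history (k' - 1) \<subseteq> history (k - 1)" by (rule history_mono)
      then show ?thesis by (auto simp: before_def)
    qed
    then have [measurable]: "X (k' - 1) \<in> measurable (info (before k i)) (count_space UNIV)"
      by (rule X_info)
    have [measurable]: "\<sigma> k' i' \<in> borel_measurable (info (before k i))"
      using True by (intro service_info) (auto simp: before_def history_def)
    show ?thesis unfolding Q_def by measurable
  next
    case False
    then have "Q k' i' = (\<lambda>_. False)" unfolding Q_def by (intro ext) blast
    then show ?thesis by simp
  qed
  have "Measurable.pred (info (before k i)) (\<lambda>\<omega>. \<exists>k' i'. Q k' i' \<omega>)"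
    by measurable
  then show ?thesis
    unfolding Q_def earlier_jump_def [abs_def] .
qed

text \<open>
  At most one of the big services of a sojourn has no earlier one.
\<close>

lemma position_count_first_jump:
  "position_count (\<lambda>k i \<omega>. P \<omega> \<and> z < \<sigma> k i \<omega>) \<omega>
     \<le> of_bool (P \<omega>) + position_count (\<lambda>k i \<omega>. earlier_jump z k i \<omega> \<and> z < \<sigma> k i \<omega>) \<omega>"
proof (cases "P \<omega>")
  case True
  let ?S = "\<lambda>Q. {(k, l, j, i). (k, l, j, i) \<in> positions \<omega> \<and> Q k i \<omega>}"
  let ?first = "?S (\<lambda>k i \<omega>. \<not> earlier_jump z k i \<omega> \<and> z < \<sigma> k i \<omega>)"
  have first_le: "card ?first \<le> Suc 0"
  proof (subst card_le_Suc0_iff_eq, simp, safe)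
    fix k l j i k' l' j' i'
    assume pos: "(k, l, j, i) \<in> positions \<omega>" "(k', l', j', i') \<in> positions \<omega>"
      and first: "\<not> earlier_jump z k i \<omega>" "\<not> earlier_jump z k' i' \<omega>"
      and jump: "z < \<sigma> k i \<omega>" "z < \<sigma> k' i' \<omega>"
    from pos have rng: "1 \<le> k" "i \<le> X (k - 1) \<omega>" "1 \<le> k'" "i' \<le> X (k' - 1) \<omega>"
      by (auto simp: positions_def jump_indices_def)
    have "\<not> (k < k' \<or> k = k' \<and> i < i')" "\<not> (k' < k \<or> k' = k \<and> i' < i)"
      using first rng jump unfolding earlier_jump_def by blast+
    then have "k = k'" "i = i'" by auto
    with pos show "k = k'" "l = l'" "j = j'" "i = i'"
      by (auto simp: positions_def)
  qed
  have "?S (\<lambda>k i \<omega>. P \<omega> \<and> z < \<sigma> k i \<omega>) \<subseteq> ?first \<union> ?S (\<lambda>k i \<omega>. earlier_jump z k i \<omega> \<and> z < \<sigma> k i \<omega>)"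
    by auto
  then have "card (?S (\<lambda>k i \<omega>. P \<omega> \<and> z < \<sigma> k i \<omega>)) \<le> card (?first \<union> ?S (\<lambda>k i \<omega>. earlier_jump z k i \<omega> \<and> z < \<sigma> k i \<omega>))"
    by (intro card_mono) auto
  also have "\<dots> \<le> card ?first + card (?S (\<lambda>k i \<omega>. earlier_jump z k i \<omega> \<and> z < \<sigma> k i \<omega>))"
    by (rule card_Un_le)
  finally show ?thesis
    using True first_le by (simp add: position_count_def)
next
  case False
  then have "{(k, l, j, i). (k, l, j, i) \<in> positions \<omega> \<and> P \<omega> \<and> z < \<sigma> k i \<omega>} = {}"
    by auto
  then show ?thesis
    by (simp only: position_count_def card.empty)
qed

text \<open>
  Each sojourn consists of finitely many services, so none of them is above \<open>z\<close> once \<open>z\<close> is large; the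
  total number of services is an integrable majorant.
\<close>

lemma earlier_jump_count_tendsto_0:
  assumes stable: "load A G p < 1"
  shows "((\<lambda>z. \<integral>\<omega>. real (position_count (earlier_jump z) \<omega>) \<partial>M) \<longlongrightarrow> 0) at_top"
proof -
  have E: "Measurable.pred M (earlier_jump z k i)" if "1 \<le> k" for k i z
    using measurable_info_events[OF earlier_jump_info before_sources] that by blast
  have "((\<lambda>z. \<integral>\<omega>. real (position_count (earlier_jump z) \<omega>) \<partial>M) \<longlongrightarrow> (\<integral>\<omega>. 0 \<partial>M)) at_top"
  proof (rule integral_dominated_convergence_at_top)
    show "integrable M (\<lambda>\<omega>. real (position_count (\<lambda>_ _ _. True) \<omega>))"
      by (rule position_count_integrable[OF stable])
    show "(\<lambda>\<omega>. real (position_count (earlier_jump z) \<omega>)) \<in> borel_measurable M" for z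
    proof (rule borel_measurable_integrable, rule integrable_position_count[OF stable])
      show "Measurable.pred M (earlier_jump z k i)" if "1 \<le> k" for k i
        by (rule E[OF that])
    qed
    show "AE \<omega> in M. ((\<lambda>z. real (position_count (earlier_jump z) \<omega>)) \<longlongrightarrow> 0) at_top"
    proof (rule AE_I2)
      fix \<omega>
      let ?S = "SIGMA k:{1..K \<omega>}. {..X (k - 1) \<omega>}"
      have "eventually (\<lambda>z. \<forall>(k, i)\<in>?S. \<sigma> k i \<omega> \<le> z) at_top"
        by (intro eventually_ball_finite) (auto intro: eventually_ge_at_top)
      then have "eventually (\<lambda>z. real (position_count (earlier_jump z) \<omega>) = 0) at_top"
      proof eventually_elim
        case (elim z)
        have "\<not> 0 < position_count (earlier_jump z) \<omega>"
        proof
          assume "0 < position_count (earlier_jump z) \<omega>"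
          then obtain k k' i' where "k \<le> K \<omega>" "1 \<le> k'" "k' \<le> k" "i' \<le> X (k' - 1) \<omega>" "z < \<sigma> k' i' \<omega>"
            unfolding position_count_pos_iff earlier_jump_def by (metis less_imp_le order_refl)
          moreover from this have "(k', i') \<in> ?S" by auto
          ultimately show False using bspec[OF elim, of "(k', i')"] by simp
        qed
        then show ?case by simp
      qed
      then show "((\<lambda>z. real (position_count (earlier_jump z) \<omega>)) \<longlongrightarrow> 0) at_top"
        by (rule tendsto_eventually)
    qed
    show "eventually (\<lambda>z. AE \<omega> in M. norm (real (position_count (earlier_jump z) \<omega>)) \<le> real (position_count (\<lambda>_ _ _. True) \<omega>)) at_top"
      by (auto intro!: always_eventually position_count_mono)
  qed auto
  then show ?thesis by simp
qed

text \<open>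
  The expected number of big services exceeds the probability by at most the expected number of non-first big
  services. Conversely, if the sojourn time is above \<open>x\<close> and no service is above \<open>x * (1 - \<rho>)\<close>, then no
  service is above \<open>\<beta> * (x * (1 - \<rho>))\<close>, or some service lies between the two levels. The
  latter has probability at most a multiple of the mass of \<open>G\<close> between them, which is small relative to the tail
  for \<open>\<beta>\<close> near 1.
\<close>

lemma single_big_jump:
  assumes irv: "intermediate_regularly_varying G" and stable: "load A G p < 1"
  shows "((\<lambda>x. (prob {\<omega> \<in> space M. x < T (K \<omega>) \<omega>}
            - (\<integral>\<omega>. real (position_count (\<lambda>k i \<omega>. x < T (K \<omega>) \<omega> \<and> x * (1 - load A G p) < \<sigma> k i \<omega>) \<omega>) \<partial>M))
          / tail G x) \<longlongrightarrow> 0) at_top"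
proof (rule tendstoI)
  fix \<epsilon> :: real assume "\<epsilon> > 0"
  define d where "d = 1 - load A G p"
  have "d > 0" using stable by (simp add: d_def)
  define U where "U x = prob {\<omega> \<in> space M. x < T (K \<omega>) \<omega>}" for x
  define Q where "Q x = (\<lambda>k i \<omega>. x < T (K \<omega>) \<omega> \<and> x * d < \<sigma> k i \<omega>)" for x
  define S where "S x = (\<integral>\<omega>. real (position_count (Q x) \<omega>) \<partial>M)" for x
  define \<nu> where "\<nu> = (\<integral>\<omega>. real (position_count (\<lambda>_ _ _. True) \<omega>) \<partial>M)"
  define e where "e z = (\<integral>\<omega>. real (position_count (earlier_jump z) \<omega>) \<partial>M)" for z
  define P where "P \<delta> x = prob {\<omega> \<in> space M. x < T (K \<omega>) \<omega> \<and> no_jump (\<delta> * x) (K \<omega>) \<omega>}" for \<delta> x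
  have "\<nu> \<ge> 0" "\<And>z. e z \<ge> 0" by (auto simp: \<nu>_def e_def)
  have pos: "tail G x > 0" for x
    using irv by (simp add: intermediate_regularly_varying_def)
  obtain D where D: "D > 0" "eventually (\<lambda>x. tail G (d * x) \<le> D * tail G x) at_top"
    using service.irv_tail_dominated[OF irv \<open>d > 0\<close>] by blast
  define \<eta> where "\<eta> = \<epsilon> / (2 * D * (\<nu> + 1))"
  have "\<eta> > 0" using \<open>\<epsilon> > 0\<close> D \<open>\<nu> \<ge> 0\<close> by (simp add: \<eta>_def)
  obtain \<beta> where \<beta>: "0 < \<beta>" "\<beta> < 1" "eventually (\<lambda>x. tail G (\<beta> * x) \<le> (1 + \<eta>) * tail G x) at_top"
    using service.irv_tail_shrink[OF irv \<open>\<eta> > 0\<close>] by blast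
  have scale: "filterlim (\<lambda>x. d * x) at_top at_top"
    using \<open>d > 0\<close> by real_asymp
  have QM: "Measurable.pred M (Q x k i)" if "1 \<le> k" for x k i
    using service_gt_measurable[OF that, of "x * d" i] unfolding Q_def by measurable
  have Q_int: "integrable M (\<lambda>\<omega>. real (position_count (Q x) \<omega>))" for x
    by (rule integrable_position_count[OF stable QM])
  have lower: "S x - U x \<le> tail G (d * x) * e (d * x)" for x
  proof -
    have EM: "Measurable.pred M (\<lambda>\<omega>. earlier_jump (d * x) k i \<omega> \<and> d * x < \<sigma> k i \<omega>)" if "1 \<le> k" for k i
      using service_gt_measurable[OF that, of "d * x" i] measurable_info_events[OF earlier_jump_info[OF that, where z = "d * x" and i = i] before_sources[OF that]]
      by measurable
    have "S x \<le> (\<integral>\<omega>. indicator {\<omega> \<in> space M. x < T (K \<omega>) \<omega>} \<omega>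
        + real (position_count (\<lambda>k i \<omega>. earlier_jump (d * x) k i \<omega> \<and> d * x < \<sigma> k i \<omega>) \<omega>) \<partial>M)"
      unfolding S_def
    proof (rule integral_mono[OF Q_int])
      fix \<omega> assume "\<omega> \<in> space M"
      have "real (position_count (Q x) \<omega>)
          \<le> real (of_bool (x < T (K \<omega>) \<omega>) + position_count (\<lambda>k i \<omega>. earlier_jump (d * x) k i \<omega> \<and> d * x < \<sigma> k i \<omega>) \<omega>)"
        unfolding Q_def mult.commute[of x d] of_nat_le_iff by (rule position_count_first_jump)
      then show "real (position_count (Q x) \<omega>) \<le> indicator {\<omega> \<in> space M. x < T (K \<omega>) \<omega>} \<omega>
          + real (position_count (\<lambda>k i \<omega>. earlier_jump (d * x) k i \<omega> \<and> d * x < \<sigma> k i \<omega>) \<omega>)"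
        using \<open>\<omega> \<in> space M\<close> by (simp add: indicator_def)
    qed (auto intro!: Bochner_Integration.integrable_add integrable_position_count[OF stable EM] simp: emeasure_eq_measure)
    also have "\<dots> = U x + (\<integral>\<omega>. real (position_count (\<lambda>k i \<omega>. earlier_jump (d * x) k i \<omega> \<and> d * x < \<sigma> k i \<omega>) \<omega>) \<partial>M)"
      by (subst Bochner_Integration.integral_add)
         (auto intro!: integrable_position_count[OF stable EM] simp: emeasure_eq_measure U_def)
    also have "(\<integral>\<omega>. real (position_count (\<lambda>k i \<omega>. earlier_jump (d * x) k i \<omega> \<and> d * x < \<sigma> k i \<omega>) \<omega>) \<partial>M) = tail G (d * x) * e (d * x)"
      using integral_position_count_jump[OF stable, of "earlier_jump (d * x)" "{d * x<..}"] earlier_jump_info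
      by (simp add: e_def service.tail_eq_measure)
    finally show ?thesis by simp
  qed
  have upper: "U x - S x \<le> P (\<beta> * d) x + \<nu> * (tail G (\<beta> * (d * x)) - tail G (d * x))" if "x \<ge> 0" for x
  proof -
    define y where "y = \<beta> * (d * x)"
    have "y \<le> d * x" using \<beta> \<open>d > 0\<close> that by (simp add: y_def mult_left_le_one_le)
    have RM: "Measurable.pred M (\<lambda>\<omega>. \<sigma> k i \<omega> \<in> {y<..d * x})" if "1 \<le> k" for k i
    proof -
      note service_measurable[OF that, measurable]
      show ?thesis by measurable
    qed
    define R where "R \<omega> = position_count (\<lambda>k i \<omega>. \<sigma> k i \<omega> \<in> {y<..d * x}) \<omega>" for \<omega>
    have R_int: "integrable M (\<lambda>\<omega>. real (R \<omega>))"
      unfolding R_def by (rule integrable_position_count[OF stable RM])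
    have "U x = (\<integral>\<omega>. indicator {\<omega> \<in> space M. x < T (K \<omega>) \<omega>} \<omega> \<partial>M)"
      by (simp add: U_def)
    also have "\<dots> \<le> (\<integral>\<omega>. indicator {\<omega> \<in> space M. x < T (K \<omega>) \<omega> \<and> no_jump y (K \<omega>) \<omega>} \<omega> + real (position_count (Q x) \<omega>) + real (R \<omega>) \<partial>M)"
    proof (rule integral_mono)
      fix \<omega> assume "\<omega> \<in> space M"
      have "1 \<le> real (position_count (Q x) \<omega>) + real (R \<omega>)" if "x < T (K \<omega>) \<omega>" "\<not> no_jump y (K \<omega>) \<omega>"
      proof -
        have "0 < position_count (\<lambda>k i \<omega>. y < \<sigma> k i \<omega>) \<omega>"
          using that(2) by (simp add: no_jump_iff)
        then obtain k i where ki: "1 \<le> k" "k \<le> K \<omega>" "i \<le> X (k - 1) \<omega>" "y < \<sigma> k i \<omega>"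
          unfolding position_count_pos_iff by blast
        have "0 < position_count (Q x) \<omega> \<or> 0 < R \<omega>"
        proof (cases "x * d < \<sigma> k i \<omega>")
          case True
          then have "0 < position_count (Q x) \<omega>"
            unfolding position_count_pos_iff Q_def using ki that(1) by blast
          then show ?thesis ..
        next
          case False
          then have "\<sigma> k i \<omega> \<in> {y<..d * x}" using ki by (simp add: mult.commute)
          then have "0 < R \<omega>"
            unfolding position_count_pos_iff R_def using ki by blast
          then show ?thesis ..
        qed
        then show ?thesis by auto
      qed
      then show "indicator {\<omega> \<in> space M. x < T (K \<omega>) \<omega>} \<omega>
          \<le> indicator {\<omega> \<in> space M. x < T (K \<omega>) \<omega> \<and> no_jump y (K \<omega>) \<omega>} \<omega> + real (position_count (Q x) \<omega>) + real (R \<omega>)"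
        using \<open>\<omega> \<in> space M\<close> by (auto simp: indicator_def)
    qed (auto intro!: Bochner_Integration.integrable_add Q_int R_int simp: emeasure_eq_measure)
    also have "\<dots> = P (\<beta> * d) x + S x + (\<integral>\<omega>. real (R \<omega>) \<partial>M)"
      using Q_int R_int by (simp add: P_def S_def y_def emeasure_eq_measure mult.assoc)
    also have "(\<integral>\<omega>. real (R \<omega>) \<partial>M) = measure G {y<..d * x} * \<nu>"
      using integral_position_count_jump[OF stable, of "\<lambda>_ _ _. True" "{y<..d * x}"]
      by (simp add: R_def \<nu>_def)
    also have "measure G {y<..d * x} = tail G y - tail G (d * x)"
    proof -
      have "{y<..d * x} = {y<..} - {d * x<..}" by auto
      then show ?thesis
        using \<open>y \<le> d * x\<close> by (simp add: service.tail_eq_measure service.finite_measure_Diff)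
    qed
    finally show ?thesis by (simp add: y_def mult.commute)
  qed
  have "\<beta> * d < d" using \<beta> \<open>d > 0\<close> by simp
  then have "((\<lambda>x. P (\<beta> * d) x / tail G x) \<longlongrightarrow> 0) at_top"
    unfolding P_def using \<beta> \<open>d > 0\<close> by (intro no_big_jump_negligible[OF irv stable]) (auto simp: d_def)
  then have "eventually (\<lambda>x. P (\<beta> * d) x / tail G x < \<epsilon> / 2) at_top"
    using \<open>\<epsilon> > 0\<close> by (intro order_tendstoD(2)) auto
  moreover have "eventually (\<lambda>x. e (d * x) < \<epsilon> / D) at_top"
    using filterlim_compose[OF earlier_jump_count_tendsto_0[OF stable] scale] \<open>\<epsilon> > 0\<close> D(1)
    unfolding e_def by (intro order_tendstoD(2)) auto
  moreover note D(2) eventually_compose_filterlim[OF \<beta>(3) scale] eventually_ge_at_top[of 0]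
  ultimately have "eventually (\<lambda>x. \<bar>(U x - S x) / tail G x\<bar> < \<epsilon>) at_top"
  proof eventually_elim
    case (elim x)
    have "S x - U x < \<epsilon> * tail G x"
    proof -
      have "tail G (d * x) * e (d * x) \<le> (D * tail G x) * e (d * x)"
        using elim \<open>e (d * x) \<ge> 0\<close> by (intro mult_right_mono) auto
      also have "\<dots> < (D * tail G x) * (\<epsilon> / D)"
        using elim D(1) pos by (intro mult_strict_left_mono) auto
      finally show ?thesis using lower[of x] D(1) by (simp add: mult.commute)
    qed
    moreover have "U x - S x < \<epsilon> * tail G x"
    proof -
      have "P (\<beta> * d) x < \<epsilon> / 2 * tail G x"
        using elim(1) pos[of x] by (simp add: field_simps)
      moreover have "\<nu> * (tail G (\<beta> * (d * x)) - tail G (d * x)) \<le> \<epsilon> / 2 * tail G x"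
      proof -
        have "\<nu> * (tail G (\<beta> * (d * x)) - tail G (d * x)) \<le> (\<nu> + 1) * (\<eta> * tail G (d * x))"
        proof (rule mult_mono)
          show "0 \<le> tail G (\<beta> * (d * x)) - tail G (d * x)"
            using \<beta> \<open>d > 0\<close> elim service.tail_antimono[of "\<beta> * (d * x)" "d * x"]
            by (simp add: mult_left_le_one_le)
        qed (use elim \<open>\<nu> \<ge> 0\<close> in \<open>auto simp: algebra_simps\<close>)
        also have "\<dots> \<le> (\<nu> + 1) * (\<eta> * (D * tail G x))"
          using elim \<open>\<nu> \<ge> 0\<close> \<open>\<eta> > 0\<close> by (intro mult_left_mono) auto
        also have "\<dots> = \<epsilon> / 2 * tail G x"
        proof -
          have cancel: "n * (\<epsilon> / (2 * D * n) * (D * t)) = \<epsilon> / 2 * t" if "n > 0" for n t :: real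
            using that D(1) by simp
          show ?thesis
            unfolding \<eta>_def using \<open>\<nu> \<ge> 0\<close> by (intro cancel) simp
        qed
        finally show ?thesis .
      qed
      ultimately show ?thesis using upper[of x] elim by simp
    qed
    ultimately show ?case using pos[of x] by (simp add: abs_less_iff field_simps)
  qed
  then show "eventually (\<lambda>x. dist ((prob {\<omega> \<in> space M. x < T (K \<omega>) \<omega>}
            - (\<integral>\<omega>. real (position_count (\<lambda>k i \<omega>. x < T (K \<omega>) \<omega> \<and> x * (1 - load A G p) < \<sigma> k i \<omega>) \<omega>) \<partial>M))
          / tail G x) 0 < \<epsilon>) at_top"
    by (simp add: U_def S_def Q_def d_def)
qed

lemma tail_le_sojourn_tail: "tail G x \<le> prob {\<omega> \<in> space M. x < T (K \<omega>) \<omega>}"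
proof -
  have "tail G x = measure (distr M borel (\<sigma> 1 0)) {x<..}"
    by (simp add: service.tail_eq_measure service_distr)
  also have "\<dots> = prob (\<sigma> 1 0 -` {x<..} \<inter> space M)"
    by (rule measure_distr[OF service_measurable]) simp_all
  also have "\<dots> = prob {\<omega> \<in> space M. x < \<sigma> 1 0 \<omega>}"
    by (rule arg_cong[where f = prob]) auto
  also have "\<dots> \<le> prob {\<omega> \<in> space M. x < T (K \<omega>) \<omega>}"
  proof (rule finite_measure_mono_AE)
    show "AE \<omega> in M. \<omega> \<in> {\<omega> \<in> space M. x < \<sigma> 1 0 \<omega>} \<longrightarrow> \<omega> \<in> {\<omega> \<in> space M. x < T (K \<omega>) \<omega>}"
      using AE_visits_pos AE_service_nonneg
    proof eventually_elim
      case (elim \<omega>)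
      have "T k \<omega> \<le> T (Suc k) \<omega>" for k
        using elim by (auto simp: completion_time.simps(2) intro!: sum_nonneg)
      then have "T 1 \<omega> \<le> T (K \<omega>) \<omega>"
        by (rule lift_Suc_mono_le[where f = "\<lambda>k. T k \<omega>", OF _ elim(1)])
      moreover have "T 1 \<omega> = \<sigma> 1 0 \<omega>"
        using completion_time.simps(2)[of \<tau> \<sigma> B 0 \<omega>] by simp
      ultimately show ?case by auto
    qed
  qed measurable
  finally show ?thesis .
qed

end

section \<open>Tail asymptotics of the sojourn time\<close>

theorem theorem3p2:
  fixes M :: "'w measure" and A G :: "real measure" and p \<rho> :: real
    and \<tau> :: "nat \<Rightarrow> 'w \<Rightarrow> real" and \<sigma> :: "nat \<Rightarrow> nat \<Rightarrow> 'w \<Rightarrow> real"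
    and B :: "nat \<Rightarrow> nat \<Rightarrow> 'w \<Rightarrow> nat" and K :: "'w \<Rightarrow> nat"
    and g :: "nat \<Rightarrow> nat \<Rightarrow> nat \<Rightarrow> nat \<Rightarrow> real \<Rightarrow> real"
    and C :: "nat \<Rightarrow> nat \<Rightarrow> nat \<Rightarrow> nat \<Rightarrow> real"
  assumes queue: "feedback_queue M A G p \<tau> \<sigma> B K"
    and rho: "\<rho> = load A G p" and stable: "\<rho> < 1"
    and irv: "intermediate_regularly_varying G"
    and g_nonneg: "\<And>k l i j x. k \<ge> 1 \<Longrightarrow> i \<le> j \<Longrightarrow> x \<ge> 0 \<Longrightarrow> 0 \<le> g k l i j x"
    and g_asymp: "\<And>k l i j. k \<ge> 1 \<Longrightarrow> i \<le> j \<Longrightarrow>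
      (\<lambda>x. \<P>(\<omega> in M. sojourn_time \<tau> \<sigma> B K \<omega> > x \<and> K \<omega> = k + l \<and>
              queue_length \<tau> \<sigma> B (k - 1) \<omega> = j \<and> \<sigma> k i \<omega> > x * (1 - \<rho>)))
        \<sim>[at_top] g k l i j"
    and g_bound: "\<And>k l i j x. k \<ge> 1 \<Longrightarrow> i \<le> j \<Longrightarrow> x \<ge> 0 \<Longrightarrow> g k l i j x \<le> C k l i j * tail G x"
    and C_summable: "(\<lambda>(k, l, j, i). C k l i j) summable_on jump_indices"
  shows "(\<lambda>x. \<P>(\<omega> in M. sojourn_time \<tau> \<sigma> B K \<omega> > x))
           \<sim>[at_top] (\<lambda>x. \<Sum>\<^sub>\<infinity>(k, l, j, i)\<in>jump_indices. g k l i j x)"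
proof -
  interpret feedback_queue M A G p \<tau> \<sigma> B K by (rule queue)
  let ?W = "count_space jump_indices"
  define d where "d = 1 - \<rho>"
  have "d > 0" using stable by (simp add: d_def)
  have stable': "load A G p < 1" using stable rho by simp
  have pos: "tail G x > 0" for x
    using irv by (simp add: intermediate_regularly_varying_def)
  define U where "U x = prob {\<omega> \<in> space M. x < T (K \<omega>) \<omega>}" for x
  define Q where "Q x = (\<lambda>k i \<omega>. x < T (K \<omega>) \<omega> \<and> x * d < \<sigma> k i \<omega>)" for x
  define S where "S x = (\<integral>\<omega>. real (position_count (Q x) \<omega>) \<partial>M)" for x
  define P where "P x = (\<lambda>(k, l, j, i). prob {\<omega> \<in> space M. K \<omega> = k + l \<and> X (k - 1) \<omega> = j \<and> Q x k i \<omega>})" for x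
  define c where "c = (\<lambda>(k, l, j, i :: nat). prob {\<omega> \<in> space M. K \<omega> = k + l \<and> X (k - 1) \<omega> = j})"
  define g' where "g' x = (\<lambda>(k, l, j, i). g k l i j x)" for x
  define C' where "C' = (\<lambda>(k, l, j, i). C k l i j)"
  have P_nonneg: "0 \<le> P x idx" and c_nonneg: "0 \<le> c idx" for x idx
    by (auto simp: P_def c_def split: prod.split)
  have QM: "Measurable.pred M (Q x k i)" if "1 \<le> k" for x k i
    using service_gt_measurable[OF that, of "x * d" i] unfolding Q_def by measurable
  have Q_int: "integrable M (\<lambda>\<omega>. real (position_count (Q x) \<omega>))" for x
    by (rule integrable_position_count[OF stable' QM])
  have g'_bound: "0 \<le> g' x idx" "g' x idx \<le> C' idx * tail G x" if "idx \<in> jump_indices" "x \<ge> 0" for x idx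
    using that g_nonneg g_bound by (auto simp: g'_def C'_def jump_indices_def)

  \<comment> \<open>The expected number of big services is the sum of the joint probabilities.\<close>
  have P_int: "integrable ?W (P x)" and P_sum: "(\<integral>idx. P x idx \<partial>?W) = S x" for x
  proof -
    have "(\<integral>\<^sup>+idx. ennreal (P x idx) \<partial>?W) = (\<integral>\<^sup>+\<omega>. of_nat (position_count (Q x) \<omega>) \<partial>M)"
      by (subst nn_integral_position_count[OF QM]) (auto intro!: nn_integral_cong simp: P_def emeasure_eq_measure)
    also have "\<dots> = ennreal (S x)"
      unfolding S_def using nn_integral_eq_integral[OF Q_int, of x]
      by (simp add: ennreal_of_nat_eq_real_of_nat)
    finally have *: "(\<integral>\<^sup>+idx. ennreal (P x idx) \<partial>?W) = ennreal (S x)" .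
    have "has_bochner_integral ?W (P x) (S x)"
      by (rule has_bochner_integral_nn_integral[OF _ _ _ *]) (auto simp: P_nonneg S_def)
    then show "integrable ?W (P x)" "(\<integral>idx. P x idx \<partial>?W) = S x"
      by (auto simp: has_bochner_integral_iff)
  qed
  have c_int: "integrable ?W c"
  proof -
    have "(\<integral>\<^sup>+idx. ennreal (c idx) \<partial>?W) = (\<integral>\<^sup>+\<omega>. of_nat (position_count (\<lambda>_ _ _. True) \<omega>) \<partial>M)"
      by (subst nn_integral_position_count) (auto intro!: nn_integral_cong simp: c_def emeasure_eq_measure)
    also have "\<dots> < \<infinity>"
      using nn_integral_eq_integral[OF position_count_integrable[OF stable']] by (simp add: ennreal_of_nat_eq_real_of_nat)
    finally show ?thesis
      by (intro integrableI_nonneg) (auto simp: c_nonneg)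
  qed
  have C'_int: "integrable ?W C'"
  proof -
    have "(\<lambda>idx. norm (C' idx)) summable_on jump_indices"
      using C_summable unfolding C'_def by (rule summable_on_iff_abs_summable_on_real[THEN iffD1])
    then show ?thesis
      unfolding abs_summable_equivalent Infinite_Set_Sum.abs_summable_on_def .
  qed
  have P_le: "P x idx \<le> c idx * tail G (d * x)" if "idx \<in> jump_indices" for x idx
  proof -
    obtain k l j i where idx: "idx = (k, l, j, i)" by (cases idx)
    then have k: "1 \<le> k" using that by (simp add: jump_indices_def)
    note visits_measurable [measurable] service_measurable[OF k, measurable]
    have "ennreal (P x idx) = emeasure M {\<omega> \<in> space M. K \<omega> = k + l \<and> X (k - 1) \<omega> = j \<and> Q x k i \<omega>}"
      by (simp add: P_def idx emeasure_eq_measure)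
    also have "\<dots> \<le> emeasure M {\<omega> \<in> space M. K \<omega> = k + l \<and> X (k - 1) \<omega> = j \<and> True \<and> \<sigma> k i \<omega> \<in> {d * x<..}}"
    proof (rule emeasure_mono)
      show "{\<omega> \<in> space M. K \<omega> = k + l \<and> X (k - 1) \<omega> = j \<and> True \<and> \<sigma> k i \<omega> \<in> {d * x<..}} \<in> events"
        by measurable
    qed (auto simp: Q_def mult.commute)
    also have "\<dots> = emeasure G {d * x<..} * emeasure M {\<omega> \<in> space M. K \<omega> = k + l \<and> X (k - 1) \<omega> = j \<and> True}"
      by (rule emeasure_position_jump[OF k]) auto
    also have "\<dots> = ennreal (c idx * tail G (d * x))"
      by (simp add: c_def idx service.tail_eq_measure emeasure_eq_measure service.emeasure_eq_measure ennreal_mult mult.commute)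
    finally show ?thesis
      using c_nonneg pos[of "d * x"] by (simp add: ennreal_le_iff less_imp_le)
  qed
  obtain D where D: "D > 0" "eventually (\<lambda>x. tail G (d * x) \<le> D * tail G x) at_top"
    using service.irv_tail_dominated[OF irv \<open>d > 0\<close>] by blast

  \<comment> \<open>Both families are at most a summable multiple of the tail; for the joint probabilities this is
    independence of the jump from its past and the finite mean number of services.\<close>
  have "((\<lambda>x. \<integral>idx. \<bar>P x idx - g' x idx\<bar> / tail G x \<partial>?W) \<longlongrightarrow> (\<integral>idx. 0 \<partial>?W)) at_top"
  proof (rule integral_dominated_convergence_at_top)
    show "integrable ?W (\<lambda>idx. D * c idx + C' idx)"
      using c_int C'_int by simp
    show "AE idx in ?W. ((\<lambda>x. \<bar>P x idx - g' x idx\<bar> / tail G x) \<longlongrightarrow> 0) at_top"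
    proof (rule AE_I2, simp)
      fix idx :: "nat \<times> nat \<times> nat \<times> nat" assume idx: "idx \<in> jump_indices"
      obtain k l j i where [simp]: "idx = (k, l, j, i)" by (cases idx)
      have "{\<omega> \<in> space M. sojourn_time \<tau> \<sigma> B K \<omega> > x \<and> K \<omega> = k + l \<and> X (k - 1) \<omega> = j \<and> \<sigma> k i \<omega> > x * (1 - \<rho>)}
          = {\<omega> \<in> space M. K \<omega> = k + l \<and> X (k - 1) \<omega> = j \<and> Q x k i \<omega>}" for x
        by (auto simp: Q_def d_def sojourn_time_eq)
      then have "(\<lambda>x. P x idx) \<sim>[at_top] (\<lambda>x. g' x idx)"
        using g_asymp[of k i j l] idx by (simp add: P_def g'_def jump_indices_def)
      then have "(\<lambda>x. P x idx - g' x idx) \<in> o[at_top](\<lambda>x. g' x idx)"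
        by (rule asymp_equiv_imp_diff_smallo)
      also have "(\<lambda>x. g' x idx) \<in> O[at_top](tail G)"
        using eventually_ge_at_top[of 0]
        by (intro bigoI[of _ "C' idx"], eventually_elim) (use g'_bound[OF idx] pos in \<open>auto simp: abs_of_pos\<close>)
      finally have "((\<lambda>x. (P x idx - g' x idx) / tail G x) \<longlongrightarrow> 0) at_top"
        by (rule smalloD_tendsto)
      then show "((\<lambda>x. \<bar>P x idx - g' x idx\<bar> / tail G x) \<longlongrightarrow> 0) at_top"
        using pos by (drule_tac tendsto_rabs_zero) (simp add: abs_of_pos)
    qed
    show "eventually (\<lambda>x. AE idx in ?W. norm (\<bar>P x idx - g' x idx\<bar> / tail G x) \<le> D * c idx + C' idx) at_top"
      using D(2) eventually_ge_at_top[of 0]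
    proof eventually_elim
      case (elim x)
      show ?case
      proof (rule AE_I2, simp)
        fix idx :: "nat \<times> nat \<times> nat \<times> nat" assume idx: "idx \<in> jump_indices"
        have "\<bar>P x idx - g' x idx\<bar> \<le> P x idx + g' x idx"
          using P_nonneg[of x idx] g'_bound[OF idx elim(2)] by simp
        also have "\<dots> \<le> c idx * (D * tail G x) + C' idx * tail G x"
          using P_le[OF idx, of x] g'_bound[OF idx elim(2)] mult_left_mono[OF elim(1) c_nonneg[of idx]] by linarith
        finally show "\<bar>P x idx - g' x idx\<bar> / \<bar>tail G x\<bar> \<le> D * c idx + C' idx"
          using pos[of x] by (simp add: field_simps)
      qed
    qed
  qed auto
  then have diff: "((\<lambda>x. \<integral>idx. \<bar>P x idx - g' x idx\<bar> / tail G x \<partial>?W) \<longlongrightarrow> 0) at_top"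
    by simp
  define V where "V x = (\<Sum>\<^sub>\<infinity>(k, l, j, i)\<in>jump_indices. g k l i j x)" for x
  have "((\<lambda>x. (S x - V x) / tail G x) \<longlongrightarrow> 0) at_top"
  proof (rule Lim_null_comparison[OF _ diff])
    show "eventually (\<lambda>x. norm ((S x - V x) / tail G x) \<le> (\<integral>idx. \<bar>P x idx - g' x idx\<bar> / tail G x \<partial>?W)) at_top"
      using eventually_ge_at_top[of 0]
    proof eventually_elim
      case (elim x)
      have g_int: "integrable ?W (g' x)"
        using g'_bound[OF _ elim]
        by (intro Bochner_Integration.integrable_bound[OF integrable_mult_left[OF C'_int, of "tail G x"]])
           (auto simp: AE_count_space intro: order_trans[OF _ abs_ge_self])
      then have "infsetsum (g' x) jump_indices = infsum (g' x) jump_indices"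
        by (intro infsetsum_infsum) (simp only: Infinite_Set_Sum.abs_summable_on_def)
      then have "V x = (\<integral>idx. g' x idx \<partial>?W)"
        by (simp add: V_def g'_def infsetsum_def)
      then have "S x - V x = (\<integral>idx. P x idx - g' x idx \<partial>?W)"
        using P_int g_int by (simp add: P_sum)
      then have "\<bar>S x - V x\<bar> \<le> (\<integral>idx. \<bar>P x idx - g' x idx\<bar> \<partial>?W)"
        by (simp add: integral_abs_bound)
      then have "\<bar>S x - V x\<bar> / tail G x \<le> (\<integral>idx. \<bar>P x idx - g' x idx\<bar> \<partial>?W) / tail G x"
        using pos by (intro divide_right_mono) (auto simp: less_imp_le)
      then show ?case
        using pos[of x] by simp
    qed
  qed
  moreover have "((\<lambda>x. (U x - S x) / tail G x) \<longlongrightarrow> 0) at_top"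
    using single_big_jump[OF irv stable'] unfolding U_def S_def Q_def d_def rho by simp
  ultimately have "((\<lambda>x. (S x - V x) / tail G x + (U x - S x) / tail G x) \<longlongrightarrow> 0 + 0) at_top"
    by (intro tendsto_add)
  then have "((\<lambda>x. (U x - V x) / tail G x) \<longlongrightarrow> 0) at_top"
    by (simp add: add_divide_distrib[symmetric])
  then have "(\<lambda>x. U x - V x) \<in> o[at_top](tail G)"
    using pos by (intro smalloI_tendsto) (auto simp: less_imp_neq[symmetric])
  also have "tail G \<in> O[at_top](U)"
    using tail_le_sojourn_tail pos by (intro bigoI[of _ 1] always_eventually) (auto simp: U_def abs_of_pos)
  finally have "(\<lambda>x. V x - U x) \<in> o[at_top](U)"
    using landau_o.small.uminus_in_iff[of "\<lambda>x. U x - V x"] by simp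
  then have "V \<sim>[at_top] U"
    by (rule smallo_imp_asymp_equiv)
  then have "U \<sim>[at_top] V"
    by (rule asymp_equiv_symI)
  then show ?thesis
    unfolding U_def V_def sojourn_time_eq .
qed

end
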